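(* Let $\rho:\Gamma\to GL_2(\mathbb{C})$ be a $T$-determined, $T$-unitarizable representation and $\upsilon$ any multiplier system for $\Gamma$ with cusp parameter $m$. Write the eigenvalues of $\rho(T)$ as $\mathbf{e}(r_1),\mathbf{e}(r_2)$ with $r_j\in[0,1)$, let $\lambda_j\in[0,1)$ be the unique number with $\lambda_j\equiv r_j+\frac{m}{12}\pmod{\mathbb{Z}}$, $\lambda_0=\lambda_1+\lambda_2$, and $k_0=6\lambda_0-1$. Suppose $\mathcal{H}(\rho,\upsilon)=\bigoplus_{k\ge0}\mathcal{H}(k_0+2k,\rho,\upsilon)$ and let $F_0\in\mathcal{H}(k_0,\rho,\upsilon)$ be a nonzero vector whose components form a fundamental system of solutions of a second order MLDE in weight $k_0$. Then: (i) $\mathcal{H}(\rho,\upsilon)$ is a free $\mathcal{M}$-module of rank 2 with basis $\{F_0,DF_0\}$; (ii) $\mathcal{H}(\rho,\upsilon)=\mathcal{R}F_0$ is a cyclic $\mathcal{R}$-module; (iii) for all integers $k\ge0$, $\dim\mathcal{H}(k_0+2k,\rho,\upsilon)=\left[\frac{k}{3}\right]+1$.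
   Context: $\Gamma=SL(2,\mathbb{Z})$ acts on the upper half-plane $\mathbb{H}$ by Möbius transformations; $T=\begin{pmatrix}1&1\\0&1\end{pmatrix}$; $q=e^{2\pi iz}$, $\mathbf{e}(r)=e^{2\pi ir}$; $[x]$ is the greatest integer $\le x$. Complex powers use the principal branch of $\log$. For $k\in\mathbb{R}$, a multiplier system of weight $k$ is a map $\upsilon:\Gamma\to\{|w|=1\}$ such that $\nu(\gamma,z)=\upsilon(\gamma)(cz+d)^k$ ($\gamma=\begin{pmatrix}a&b\\c&d\end{pmatrix}$) satisfies $\nu(\gamma\sigma,z)=\nu(\gamma,\sigma z)\nu(\sigma,z)$; it is then also a multiplier system of weight $k+n$ for all $n\in\mathbb{Z}$. Its cusp parameter is the $m\in[0,12)$ with $\upsilon(T)=\mathbf{e}(m/12)$. Slash action: $(f|_k^\upsilon\gamma)(z)=\upsilon(\gamma)^{-1}(cz+d)^{-k}f(\gamma z)$. Moderate growth of holomorphic $f$ on $\mathbb{H}$: $|f(x+iy)|\le y^N$ for $y>c$, some $N,c>0$. $\mathcal{H}(k,\rho,\upsilon)$: column vectors $F$ of holomorphic moderate-growth functions with $F|_k^\upsilon\gamma=\rho(\gamma)F$ for all $\gamma\in\Gamma$; $\mathcal{H}(\rho,\upsilon)=\bigoplus_{n\in\mathbb{Z}}\mathcal{H}(k+n,\rho,\upsilon)$. $\mathcal{M}=\bigoplus_j\mathcal{M}_j=\mathbb{C}[E_4,E_6]$ is the graded ring of holomorphic integral-weight modular forms for $\Gamma$ (trivial multiplier), acting on $\mathcal{H}(\rho,\upsilon)$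 by componentwise multiplication. $T$-unitarizable: $\rho(T)$ conjugate to a unitary matrix. An irreducible $\rho$ of dimension $d$ is $T$-determined if every indecomposable $\rho':\Gamma\to GL_d(\mathbb{C})$ with $\rho'(T)$ having the same eigenvalues as $\rho(T)$ is irreducible. With $\eta=q^{1/24}\prod_{n\ge1}(1-q^n)$, $P=\frac{i}{\pi}\frac{\eta'}{\eta}$ and $D_kf=\frac{1}{2\pi i}\frac{df}{dz}+kPf$, the operator $D$ acts on $\mathcal{H}(k,\rho,\upsilon)$ componentwise as $D_k$ (landing in $\mathcal{H}(k+2,\rho,\upsilon)$), and $D^n=D_{k+2(n-1)}\circ\cdots\circ D_k$ on weight $k$. An MLDE of order $n$ in weight $k$ is $D_k^nf+M_4D_k^{n-2}f+\cdots+M_{2n}f=0$ with $M_{2j}\in\mathcal{M}_{2j}$; a fundamental system of solutions is a basis of its solution space. $\mathcal{R}$ is the skew polynomial ring $\mathcal{M}[d]$ with $dM=Md+DM$ for $M\in\mathcal{M}$, acting on $\mathcal{H}(\rho,\upsilon)$ by $d\cdot F=DF$ and multiplication by $\mathcal{M}$; so $\mathcal{H}(\rho,\upsilon)=\mathcal{R}F_0$ means every element is a finite sum $\sum_j M_jD^jF_0$ with $M_j\in\mathcal{M}$. *)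

theory Defs
  imports "HOL-Analysis.Analysis"
begin

type_synonym sl2 = "int \<times> int \<times> int \<times> int"  \<comment> \<open>(a,b,c,d) = matrix [[a,b],[c,d]]\<close>

definition SL2Z :: "sl2 set" where
  "SL2Z = {(a,b,c,d). a*d - b*c = 1}"

fun mmul :: "sl2 \<Rightarrow> sl2 \<Rightarrow> sl2" where
  "mmul (a,b,c,d) (a',b',c',d') = (a*a' + b*c', a*b' + b*d', c*a' + d*c', c*b' + d*d')"

definition Tmat :: sl2 where "Tmat = (1,1,0,1)"
definition Imat :: sl2 where "Imat = (1,0,0,1)"

definition UHP :: "complex set" where "UHP = {z. Im z > 0}"

fun mob :: "sl2 \<Rightarrow> complex \<Rightarrow> complex" where
  "mob (a,b,c,d) z = (of_int a * z + of_int b) / (of_int c * z + of_int d)"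

fun jfac :: "sl2 \<Rightarrow> complex \<Rightarrow> complex" where
  "jfac (a,b,c,d) z = of_int c * z + of_int d"

definition ee :: "real \<Rightarrow> complex" where "ee r = exp (2 * pi * \<i> * of_real r)"

definition nu :: "real \<Rightarrow> (sl2 \<Rightarrow> complex) \<Rightarrow> sl2 \<Rightarrow> complex \<Rightarrow> complex" where
  "nu k \<upsilon> \<gamma> z = \<upsilon> \<gamma> * (jfac \<gamma> z) powr (of_real k)"

definition multiplier_system :: "real \<Rightarrow> (sl2 \<Rightarrow> complex) \<Rightarrow> bool" where
  "multiplier_system k \<upsilon> \<longleftrightarrow>
     (\<forall>\<gamma>\<in>SL2Z. norm (\<upsilon> \<gamma>) = 1) \<and>
     (\<forall>\<gamma>\<in>SL2Z. \<forall>\<sigma>\<in>SL2Z. \<forall>z\<in>UHP.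
        nu k \<upsilon> (mmul \<gamma> \<sigma>) z = nu k \<upsilon> \<gamma> (mob \<sigma> z) * nu k \<upsilon> \<sigma> z)"

definition is_rep :: "(sl2 \<Rightarrow> complex^'n^'n) \<Rightarrow> bool" where
  "is_rep \<rho> \<longleftrightarrow> \<rho> Imat = mat 1 \<and>
     (\<forall>\<gamma>\<in>SL2Z. \<forall>\<sigma>\<in>SL2Z. \<rho> (mmul \<gamma> \<sigma>) = \<rho> \<gamma> ** \<rho> \<sigma>)"

definition csubspace :: "(complex^'n) set \<Rightarrow> bool" where
  "csubspace W \<longleftrightarrow> 0 \<in> W \<and> (\<forall>x\<in>W. \<forall>y\<in>W. x + y \<in> W) \<and> (\<forall>c. \<forall>x\<in>W. c *s x \<in> W)"

definition invariant_subspace :: "(sl2 \<Rightarrow> complex^'n^'n) \<Rightarrow> (complex^'n) set \<Rightarrow> bool" where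
  "invariant_subspace \<rho> W \<longleftrightarrow> csubspace W \<and> (\<forall>\<gamma>\<in>SL2Z. \<forall>v\<in>W. \<rho> \<gamma> *v v \<in> W)"

definition irreducible_rep :: "(sl2 \<Rightarrow> complex^'n^'n) \<Rightarrow> bool" where
  "irreducible_rep \<rho> \<longleftrightarrow> is_rep \<rho> \<and>
     (\<forall>W. invariant_subspace \<rho> W \<longrightarrow> W = {0} \<or> W = UNIV)"

definition indecomposable_rep :: "(sl2 \<Rightarrow> complex^'n^'n) \<Rightarrow> bool" where
  "indecomposable_rep \<rho> \<longleftrightarrow> is_rep \<rho> \<and>
     (\<forall>W1 W2. invariant_subspace \<rho> W1 \<and> invariant_subspace \<rho> W2 \<and> W1 \<inter> W2 = {0} \<and>
        (\<forall>v. \<exists>a\<in>W1. \<exists>b\<in>W2. v = a + b) \<longrightarrow> W1 = {0} \<or> W2 = {0})"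

definition same_eigenvalues :: "complex^'n^'n \<Rightarrow> complex^'n^'n \<Rightarrow> bool" where
  "same_eigenvalues A B \<longleftrightarrow> (\<forall>x. det (mat x - A) = det (mat x - B))"

definition T_determined :: "(sl2 \<Rightarrow> complex^'n^'n) \<Rightarrow> bool" where
  "T_determined \<rho> \<longleftrightarrow> irreducible_rep \<rho> \<and>
     (\<forall>\<rho>' :: sl2 \<Rightarrow> complex^'n^'n. indecomposable_rep \<rho>' \<and> same_eigenvalues (\<rho>' Tmat) (\<rho> Tmat)
        \<longrightarrow> irreducible_rep \<rho>')"

definition unitary_mat :: "complex^'n^'n \<Rightarrow> bool" where
  "unitary_mat U \<longleftrightarrow> (\<forall>i j. (\<Sum>k\<in>UNIV. U$i$k * cnj (U$j$k)) = (if i = j then 1 else 0))"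

definition T_unitarizable :: "(sl2 \<Rightarrow> complex^'n^'n) \<Rightarrow> bool" where
  "T_unitarizable \<rho> \<longleftrightarrow> (\<exists>(P::complex^'n^'n) (U::complex^'n^'n). invertible P \<and> unitary_mat U \<and> \<rho> Tmat ** P = P ** U)"

text \<open>Functions on the upper half-plane are represented as functions on all of complex,
  extended by 0 outside the upper half-plane.\<close>

definition moderate_growth :: "(complex \<Rightarrow> complex) \<Rightarrow> bool" where
  "moderate_growth f \<longleftrightarrow> (\<exists>N c. N > 0 \<and> c > 0 \<and>
     (\<forall>x y. y > c \<longrightarrow> norm (f (Complex x y)) \<le> y powr N))"

definition slash :: "real \<Rightarrow> (sl2 \<Rightarrow> complex) \<Rightarrow> sl2 \<Rightarrow> (complex \<Rightarrow> complex^'n) \<Rightarrow> complex \<Rightarrow> complex^'n" where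
  "slash k \<upsilon> \<gamma> F z = (inverse (\<upsilon> \<gamma>) * inverse ((jfac \<gamma> z) powr (of_real k))) *s F (mob \<gamma> z)"

definition vvmf :: "real \<Rightarrow> (sl2 \<Rightarrow> complex^'n^'n) \<Rightarrow> (sl2 \<Rightarrow> complex) \<Rightarrow> (complex \<Rightarrow> complex^'n) set" where
  "vvmf k \<rho> \<upsilon> = {F. (\<forall>z. z \<notin> UHP \<longrightarrow> F z = 0) \<and>
     (\<forall>i. (\<lambda>z. F z $ i) holomorphic_on UHP \<and> moderate_growth (\<lambda>z. F z $ i)) \<and>
     (\<forall>\<gamma>\<in>SL2Z. \<forall>z\<in>UHP. slash k \<upsilon> \<gamma> F z = \<rho> \<gamma> *v F z)}"

definition modforms :: "int \<Rightarrow> (complex \<Rightarrow> complex) set" where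
  "modforms j = {f. (\<forall>z. z \<notin> UHP \<longrightarrow> f z = 0) \<and> f holomorphic_on UHP \<and> moderate_growth f \<and>
     (\<forall>\<gamma>\<in>SL2Z. \<forall>z\<in>UHP. f (mob \<gamma> z) = (jfac \<gamma> z) powi j * f z)}"

definition eta :: "complex \<Rightarrow> complex" where
  "eta z = exp (2 * pi * \<i> * z / 24) * (\<Prod>n. (1 - exp (2 * pi * \<i> * of_nat (Suc n) * z)))"

definition Pfun :: "complex \<Rightarrow> complex" where
  "Pfun z = (\<i> / of_real pi) * deriv eta z / eta z"

definition Dop :: "real \<Rightarrow> (complex \<Rightarrow> complex) \<Rightarrow> complex \<Rightarrow> complex" where
  "Dop k f z = (if z \<in> UHP then deriv f z / (2 * of_real pi * \<i>) + of_real k * Pfun z * f z else 0)"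

definition Dvec :: "real \<Rightarrow> (complex \<Rightarrow> complex^'n) \<Rightarrow> complex \<Rightarrow> complex^'n" where
  "Dvec k F z = (\<chi> i. Dop k (\<lambda>w. F w $ i) z)"

fun Dpow :: "real \<Rightarrow> nat \<Rightarrow> (complex \<Rightarrow> complex^'n) \<Rightarrow> complex \<Rightarrow> complex^'n" where
  "Dpow k 0 F = F"
| "Dpow k (Suc n) F = Dvec (k + 2 * real n) (Dpow k n F)"

definition mlde2_solution :: "real \<Rightarrow> (complex \<Rightarrow> complex) \<Rightarrow> (complex \<Rightarrow> complex) \<Rightarrow> bool" where
  "mlde2_solution k M4 f \<longleftrightarrow> f holomorphic_on UHP \<and>
     (\<forall>z\<in>UHP. Dop (k + 2) (Dop k f) z + M4 z * f z = 0)"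

definition mlde2_fundamental_system ::
  "real \<Rightarrow> (complex \<Rightarrow> complex) \<Rightarrow> (complex \<Rightarrow> complex) \<Rightarrow> (complex \<Rightarrow> complex) \<Rightarrow> bool" where
  "mlde2_fundamental_system k M4 f1 f2 \<longleftrightarrow>
     mlde2_solution k M4 f1 \<and> mlde2_solution k M4 f2 \<and>
     (\<forall>g. mlde2_solution k M4 g \<longrightarrow> (\<exists>!(a,b). \<forall>z\<in>UHP. g z = a * f1 z + b * f2 z))"

definition has_cdim :: "('a \<Rightarrow> complex^'n) set \<Rightarrow> nat \<Rightarrow> bool" where
  "has_cdim V n \<longleftrightarrow> (\<exists>B :: nat \<Rightarrow> ('a \<Rightarrow> complex^'n). (\<forall>i<n. B i \<in> V) \<and>
     (\<forall>G\<in>V. \<exists>!c :: nat \<Rightarrow> complex. (\<forall>i\<ge>n. c i = 0) \<and> G = (\<lambda>z. \<Sum>i<n. c i *s B i z)))"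

end

theory Submission
  imports Defs "HOL-Complex_Analysis.Complex_Analysis" "HOL-Real_Asymp.Real_Asymp"
begin

text \<open>
  Let \<open>W = det (F\<^sub>0, DF\<^sub>0)\<close>. The differential equation gives \<open>DW = 0\<close>, so \<open>W\<close> is a nonzero multiple of
  \<open>\<eta>\<^bsup>24\<lambda>\<^esup>\<close> with \<open>\<lambda> = \<lambda>\<^sub>1 + \<lambda>\<^sub>2\<close> and has no zeros on the upper half-plane. By Cramer's rule every \<open>G\<close>
  equals \<open>M F\<^sub>0 + N DF\<^sub>0\<close> with \<open>M = det (G, DF\<^sub>0) / W\<close> and \<open>N = det (F\<^sub>0, G) / W\<close>; these transform
  like modular forms, and they are holomorphic at the cusp because in an eigenbasis of \<open>\<rho>(T)\<close> the
  numerators are \<open>q\<^sup>\<lambda>\<close> times a power series in \<open>q\<close>, exactly like \<open>W\<close>. The dimensions then follow from those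
  of the spaces of scalar modular forms. The transformation law of \<open>P\<close>, hence \<open>E\<^sub>4\<close>, \<open>E\<^sub>6\<close> and the
  modularity of \<open>\<eta>\<^bsup>24\<^esup>\<close>, is itself read off from that of \<open>W\<close>, whose weight \<open>2 k\<^sub>0 + 2 = 12 \<lambda>\<close> is nonzero.
\<close>

text \<open>Unitarizability makes \<rho>(T) diagonalizable, also for a double eigenvalue, so
  expansions at the cusp contain no powers of \<open>z\<close>. The number \<open>k0\<close> is the
  weight in which the Wronskian has no surplus zero at the cusp: a nonzero solution of
  \<open>DW = 0\<close> of weight \<open>12 * s\<close> has order exactly \<open>s\<close> there,
  and \<open>k0\<close> is fixed by \<open>2 * k0 + 2 = 12 * (l1 + l2)\<close>. Reading the law of
  \<open>P\<close> off the Wronskian looks circular, since \<open>D\<close> contains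
  \<open>P\<close>. It is not: the terms with \<open>P\<close> cancel in the Wronskian, so it
  transforms by the ordinary chain rule, while its differential equation still involves
  \<open>P\<close>. Comparing the two gives the law multiplied by the weight of the Wronskian. That
  weight is nonzero because equal exponents would annihilate the leading coefficient, which is a
  multiple of \<open>l1 - l2\<close>. A logarithm of the Euler product on the unit disc supplies all
  real powers of eta at once; no branch has to be followed on the upper half-plane.\<close>

no_notation fps_nth (infixl "$" 75)

section \<open>The modular group\<close>

lemma UHP_iff [simp]: "z \<in> UHP \<longleftrightarrow> Im z > 0"
  by (simp add: UHP_def)

lemma open_UHP: "open UHP"
  by (simp add: UHP_def open_halfspace_Im_gt)

lemma convex_UHP: "convex UHP"
  by (simp add: UHP_def convex_halfspace_Im_gt)

lemma connected_UHP: "connected UHP"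
  by (simp add: convex_UHP convex_connected)

lemma jfac_nonzero:
  assumes "\<gamma> \<in> SL2Z" "Im z > 0"
  shows "jfac \<gamma> z \<noteq> 0"
proof -
  obtain a b c d where g: "\<gamma> = (a, b, c, d)" using prod_cases4 by blast
  have "c = 0 \<and> d = 0" if "jfac \<gamma> z = 0"
  proof -
    have "Im (of_int c * z + of_int d) = 0" "Re (of_int c * z + of_int d) = 0"
      using that by (simp_all add: g)
    then show ?thesis using assms(2) by auto
  qed
  then show ?thesis using assms(1) by (auto simp: g SL2Z_def)
qed

lemma Im_mob:
  assumes "\<gamma> \<in> SL2Z" "Im z > 0"
  shows "Im (mob \<gamma> z) = Im z / (norm (jfac \<gamma> z))\<^sup>2"
proof -
  obtain a b c d where g: "\<gamma> = (a, b, c, d)" using prod_cases4 by blast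
  have "a * d - b * c = 1" using assms(1) by (simp add: g SL2Z_def)
  then have det: "real_of_int a * of_int d = 1 + of_int b * of_int c"
    by (metis add.commute diff_add_cancel of_int_1 of_int_add of_int_mult)
  have "(of_int a * Im z) * (of_int c * Re z + of_int d) - (of_int a * Re z + of_int b) * (of_int c * Im z)
      = Im z * (of_int a * of_int d) - of_int b * of_int c * Im z"
    by (simp add: algebra_simps)
  then show ?thesis
    by (simp add: g Im_divide cmod_power2) (simp add: det algebra_simps)
qed

lemma mob_UHP:
  assumes "\<gamma> \<in> SL2Z" "Im z > 0"
  shows "Im (mob \<gamma> z) > 0"
  using Im_mob[OF assms] jfac_nonzero[OF assms] assms(2) by simp

lemma mmul_SL2Z:
  assumes "\<gamma> \<in> SL2Z" "\<sigma> \<in> SL2Z"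
  shows "mmul \<gamma> \<sigma> \<in> SL2Z"
proof -
  obtain a b c d where g: "\<gamma> = (a, b, c, d)" using prod_cases4 by blast
  obtain a' b' c' d' where s: "\<sigma> = (a', b', c', d')" using prod_cases4 by blast
  have "(a*a' + b*c') * (c*b' + d*d') - (a*b' + b*d') * (c*a' + d*c') = (a*d - b*c) * (a'*d' - b'*c')"
    by algebra
  then show ?thesis using assms by (simp add: g s SL2Z_def)
qed

lemma jfac_mmul:
  assumes "\<gamma> \<in> SL2Z" "\<sigma> \<in> SL2Z" "Im z > 0"
  shows "jfac (mmul \<gamma> \<sigma>) z = jfac \<gamma> (mob \<sigma> z) * jfac \<sigma> z"
proof -
  obtain a b c d where g: "\<gamma> = (a, b, c, d)" using prod_cases4 by blast
  obtain a' b' c' d' where s: "\<sigma> = (a', b', c', d')" using prod_cases4 by blast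
  show ?thesis using jfac_nonzero[OF assms(2,3)] by (simp add: g s field_simps)
qed

lemma mob_mmul:
  assumes "\<gamma> \<in> SL2Z" "\<sigma> \<in> SL2Z" "Im z > 0"
  shows "mob (mmul \<gamma> \<sigma>) z = mob \<gamma> (mob \<sigma> z)"
proof -
  obtain a b c d where g: "\<gamma> = (a, b, c, d)" using prod_cases4 by blast
  obtain a' b' c' d' where s: "\<sigma> = (a', b', c', d')" using prod_cases4 by blast
  define N D where "N = of_int a' * z + of_int b'" and "D = of_int c' * z + of_int d'"
  have D: "D \<noteq> 0" using jfac_nonzero[OF assms(2,3)] by (simp add: s D_def)
  have frac: "x * N / D + y = (x * N + y * D) / D" for x y
    using D by (simp add: add_divide_distrib)
  have "mob \<gamma> (mob \<sigma> z) = (of_int a * N + of_int b * D) / (of_int c * N + of_int d * D)"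
    using D by (simp add: g s N_def [symmetric] D_def [symmetric] frac)
  also have "\<dots> = mob (mmul \<gamma> \<sigma>) z"
    by (simp add: g s N_def D_def algebra_simps)
  finally show ?thesis by simp
qed

lemma mob_has_derivative:
  assumes "\<gamma> \<in> SL2Z" "Im z > 0"
  shows "(mob \<gamma> has_field_derivative 1 / (jfac \<gamma> z)\<^sup>2) (at z)"
proof -
  obtain a b c d where g: "\<gamma> = (a, b, c, d)" using prod_cases4 by blast
  have "a * d - b * c = 1" using assms(1) by (simp add: g SL2Z_def)
  then have "complex_of_int a * of_int d - of_int b * of_int c = 1"
    by (metis of_int_1 of_int_diff of_int_mult)
  then have det: "complex_of_int a * of_int d = 1 + of_int b * of_int c"
    by (simp add: algebra_simps)
  have nz: "of_int c * z + of_int d \<noteq> 0"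
    using jfac_nonzero[OF assms] by (simp add: g)
  have "mob \<gamma> = (\<lambda>z. (of_int a * z + of_int b) / (of_int c * z + of_int d))"
    by (auto simp: g)
  moreover have "((\<lambda>z. (of_int a * z + of_int b) / (of_int c * z + of_int d)) has_field_derivative
      1 / (jfac \<gamma> z)\<^sup>2) (at z)"
    using nz by (auto intro!: derivative_eq_intros simp: g power2_eq_square)
      (simp add: det algebra_simps)
  ultimately show ?thesis by simp
qed

section \<open>Generators of the modular group and reduction to a strip\<close>

definition Smat :: sl2 where "Smat = (0, -1, 1, 0)"

lemma Tmat_SL2Z [simp]: "Tmat \<in> SL2Z" and Smat_SL2Z [simp]: "Smat \<in> SL2Z"
  and Imat_SL2Z [simp]: "Imat \<in> SL2Z"
  by (simp_all add: Tmat_def Smat_def Imat_def SL2Z_def)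

lemma mob_Tmat [simp]: "mob Tmat z = z + 1" and jfac_Tmat [simp]: "jfac Tmat z = 1"
  and mob_Smat [simp]: "mob Smat z = - 1 / z" and jfac_Smat [simp]: "jfac Smat z = z"
  and mob_Imat [simp]: "mob Imat z = z" and jfac_Imat [simp]: "jfac Imat z = 1"
  by (simp_all add: Tmat_def Smat_def Imat_def)

text \<open>Euclid's algorithm on the first column: powers of \<open>T\<close> reduce
  \<open>a\<close> modulo \<open>c\<close>, and \<open>S\<close> exchanges the rows. The case
  \<open>Tinv\<close> runs backwards from \<open>T \<gamma>\<close> to \<gamma>, so the inverse of
  \<open>T\<close> never has to be named.\<close>

lemma SL2Z_induct [consumes 1, case_names I S T Tinv]:
  assumes "\<gamma> \<in> SL2Z"
    and I: "Q Imat"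
    and S: "\<And>\<gamma>. \<gamma> \<in> SL2Z \<Longrightarrow> Q \<gamma> \<Longrightarrow> Q (mmul Smat \<gamma>)"
    and T: "\<And>\<gamma>. \<gamma> \<in> SL2Z \<Longrightarrow> Q \<gamma> \<Longrightarrow> Q (mmul Tmat \<gamma>)"
    and Tinv: "\<And>\<gamma>. \<gamma> \<in> SL2Z \<Longrightarrow> Q (mmul Tmat \<gamma>) \<Longrightarrow> Q \<gamma>"
  shows "Q \<gamma>"
proof -
  have shift: "Q (a + n * c, b + n * d, c, d) \<longleftrightarrow> Q (a, b, c, d)" if "(a, b, c, d) \<in> SL2Z" for n a b c d
  proof -
    have mem: "(a + n * c, b + n * d, c, d) \<in> SL2Z" for n
      using that by (simp add: SL2Z_def algebra_simps)
    have step: "Q (a + (n + 1) * c, b + (n + 1) * d, c, d) \<longleftrightarrow> Q (a + n * c, b + n * d, c, d)" for n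
    proof -
      have "mmul Tmat (a + n * c, b + n * d, c, d) = (a + (n + 1) * c, b + (n + 1) * d, c, d)"
        by (simp add: Tmat_def algebra_simps)
      then show ?thesis using T[OF mem[of n]] Tinv[OF mem[of n]] by metis
    qed
    show ?thesis
    proof (induction n rule: int_induct[where k = 0])
      case base then show ?case by simp
    next
      case (step1 i) then show ?case using step[of i] by simp
    next
      case (step2 i) then show ?case using step[of "i - 1"] by simp
    qed
  qed
  have "Q (a, b, c, d)" if "(a, b, c, d) \<in> SL2Z" for a b c d
    using that
  proof (induction "nat \<bar>c\<bar>" arbitrary: a b c d rule: less_induct)
    case less
    show ?case
    proof (cases "c = 0")
      case False
      define r s where "r = a mod c" and "s = b + (- (a div c)) * d"
      have r: "r = a + (- (a div c)) * c" by (simp add: r_def minus_div_mult_eq_mod [symmetric])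
      have rc: "\<bar>r\<bar> < \<bar>c\<bar>" using False by (simp add: r_def abs_mod_less)
      have rs: "(r, s, c, d) \<in> SL2Z"
        using less.prems by (simp add: r s_def SL2Z_def algebra_simps)
      have "(c, d, -r, -s) \<in> SL2Z" using rs by (simp add: SL2Z_def algebra_simps)
      then have "Q (c, d, -r, -s)" using less.hyps[of "-r" c d "-s"] rc by simp
      then have "Q (r, s, c, d)"
        using S[OF \<open>(c, d, -r, -s) \<in> SL2Z\<close>] by (simp add: Smat_def)
      then show ?thesis using shift[OF less.prems, of "- (a div c)"] by (simp add: r s_def)
    next
      case True
      then have ad: "a * d = 1" using less.prems by (simp add: SL2Z_def)
      have Q1: "Q (1, 0, 0, 1)" using I by (simp add: Imat_def)
      have "Q (0, -1, 1, 0)" using S[OF Imat_SL2Z I] by (simp add: Imat_def Smat_def)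
      \<comment> \<open>Minus the identity is the square of \<open>Smat\<close>.\<close>
      then have Qm: "Q (-1, 0, 0, -1)" using S[of Smat] by (simp add: Smat_def SL2Z_def)
      from ad consider "a = 1" "d = 1" | "a = -1" "d = -1"
        by (metis zmult_eq_1_iff)
      then show ?thesis
      proof cases
        case 1
        then show ?thesis using shift[of 1 0 0 1 b] Q1 True by (simp add: SL2Z_def)
      next
        case 2
        then show ?thesis using shift[of "-1" 0 0 "-1" "-b"] Qm True by (simp add: SL2Z_def)
      qed
    qed
  qed
  then show ?thesis using assms(1) by (metis prod_cases4)
qed

text \<open>Choosing \<open>\<gamma>\<close> so that \<open>Im (\<gamma> z)\<close> is close to its supremum over the orbit avoids showing that
  the maximum is attained.\<close>

lemma ex_mob_strip:
  assumes "Im z > 0"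
  shows "\<exists>\<gamma>\<in>SL2Z. \<bar>Re (mob \<gamma> z)\<bar> \<le> 1/2 \<and> 1/2 \<le> Im (mob \<gamma> z)"
proof -
  define A where "A = (\<lambda>\<gamma>. Im (mob \<gamma> z)) ` SL2Z"
  have ne: "A \<noteq> {}" unfolding A_def using Imat_SL2Z by blast
  have bound: "Im (mob \<gamma> z) \<le> max (Im z) (1 / Im z)" if "\<gamma> \<in> SL2Z" for \<gamma>
  proof -
    obtain a b c d where g: "\<gamma> = (a, b, c, d)" using prod_cases4 by blast
    have n: "(norm (jfac \<gamma> z))\<^sup>2 = (of_int c * Re z + of_int d)\<^sup>2 + (of_int c * Im z)\<^sup>2"
      by (simp add: g cmod_power2)
    show ?thesis
    proof (cases "c = 0")
      case True
      then have "d \<noteq> 0" using that by (auto simp: g SL2Z_def)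
      then have "1 \<le> \<bar>d\<bar>" by simp
      then have "(1::real)\<^sup>2 \<le> (of_int d)\<^sup>2"
        by (metis of_int_1 of_int_abs of_int_le_iff power2_abs abs_ge_zero one_le_power power_one)
      then have "1 \<le> (norm (jfac \<gamma> z))\<^sup>2" using n True by simp
      then have "Im (mob \<gamma> z) \<le> Im z"
        using Im_mob[OF that assms] assms by (simp add: divide_le_eq)
      then show ?thesis by simp
    next
      case False
      then have "1 \<le> \<bar>c\<bar>" by simp
      then have "(1::real) \<le> (of_int c)\<^sup>2"
        by (metis of_int_1 of_int_abs of_int_le_iff power2_abs abs_ge_zero one_le_power power_one)
      then have "1 * (Im z)\<^sup>2 \<le> (of_int c)\<^sup>2 * (Im z)\<^sup>2"
        by (intro mult_right_mono) auto
      then have *: "(Im z)\<^sup>2 \<le> (norm (jfac \<gamma> z))\<^sup>2"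
        unfolding n power_mult_distrib by (simp add: add_increasing)
      have "Im (mob \<gamma> z) \<le> Im z / (Im z)\<^sup>2"
        unfolding Im_mob[OF that assms] using * assms jfac_nonzero[OF that assms]
        by (intro divide_left_mono) auto
      also have "\<dots> = 1 / Im z" using assms by (simp add: power2_eq_square)
      finally show ?thesis by simp
    qed
  qed
  have bdd: "bdd_above A" unfolding A_def using bound by (rule bdd_aboveI2)
  have "Im z \<in> A" unfolding A_def by (rule image_eqI[of _ _ Imat]) simp_all
  then have "0 < Sup A" using cSup_upper[OF _ bdd] assms by fastforce
  \<comment> \<open>Any factor from 1/2 up to, but excluding, 1 would do: a factor t leads to
    \<open>norm w ^ 2 > t\<close> below, and \<open>Re w ^ 2\<close> takes away at most 1/4.\<close>
  then have "3/4 * Sup A < Sup A" by simp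
  then obtain \<gamma> where \<gamma>: "\<gamma> \<in> SL2Z" "3/4 * Sup A < Im (mob \<gamma> z)"
    unfolding less_cSup_iff[OF ne bdd] by (auto simp only: A_def)
  define n where "n = - round (Re (mob \<gamma> z))"
  define \<sigma> where "\<sigma> = mmul (1, n, 0, 1) \<gamma>"
  have s1: "(1, n, 0, 1) \<in> SL2Z" by (simp add: SL2Z_def)
  have \<sigma>: "\<sigma> \<in> SL2Z" unfolding \<sigma>_def by (intro mmul_SL2Z s1 \<gamma>)
  define w where "w = mob \<sigma> z"
  have w: "w = mob \<gamma> z + of_int n"
    unfolding w_def \<sigma>_def by (simp only: mob_mmul[OF s1 \<gamma>(1) assms]) simp
  have re: "\<bar>Re w\<bar> \<le> 1/2"
    using of_int_round_abs_le[of "Re (mob \<gamma> z)"] by (simp add: w n_def abs_minus_commute)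
  have imw: "Im w > 0" using mob_UHP[OF \<sigma> assms] by (simp add: w_def)
  have "Im (mob (mmul Smat \<sigma>) z) \<in> A"
    using mmul_SL2Z[OF Smat_SL2Z \<sigma>] by (auto simp: A_def)
  then have "Im (mob Smat w) \<le> Sup A"
    using cSup_upper[OF _ bdd] by (simp only: mob_mmul[OF Smat_SL2Z \<sigma> assms] w_def)
  also have "Sup A < 4/3 * Im w" using \<gamma>(2) by (simp add: w)
  finally have "Im w / (norm w)\<^sup>2 < 4/3 * Im w"
    unfolding Im_mob[OF Smat_SL2Z imw] by simp
  moreover have "0 < (norm w)\<^sup>2" using imw by auto
  ultimately have "Im w * 1 < Im w * (4/3 * (norm w)\<^sup>2)" by (simp add: pos_divide_less_eq mult_ac)
  then have "3/4 < (norm w)\<^sup>2" using imw mult_less_cancel_left_pos[OF imw] by fastforce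
  moreover have "(Re w)\<^sup>2 \<le> (1/2)\<^sup>2" using re by (metis abs_ge_zero power2_abs power_mono)
  ultimately have "(1/2)\<^sup>2 \<le> (Im w)\<^sup>2" unfolding cmod_power2 by (simp add: power2_eq_square)
  then have "1/2 \<le> Im w" using imw by (metis power2_le_imp_le less_imp_le)
  then show ?thesis using re \<sigma> by (auto simp: w_def)
qed

section \<open>Expansions at the cusp\<close>

abbreviation tpi :: complex where "tpi \<equiv> 2 * of_real pi * \<i>"

definition qpar :: "complex \<Rightarrow> complex" where "qpar z = exp (tpi * z)"

lemma norm_qpar: "norm (qpar z) = exp (- (2 * pi * Im z))"
  by (simp add: qpar_def)

lemma norm_qpar_less_1: "norm (qpar z) < 1 \<longleftrightarrow> Im z > 0"
  by (simp add: norm_qpar zero_less_mult_iff)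

lemma qpar_nonzero [simp]: "qpar z \<noteq> 0"
  by (simp add: qpar_def)

lemma qpar_Ln: "q \<noteq> 0 \<Longrightarrow> qpar (Ln q / tpi) = q"
  by (simp add: qpar_def)

lemma qpar_surj:
  assumes "q \<noteq> 0" "norm q < 1"
  obtains z where "Im z > 0" "qpar z = q"
  using that[of "Ln q / tpi"] qpar_Ln[OF assms(1)] norm_qpar_less_1[of "Ln q / tpi"] assms(2) by metis

lemma qpar_eq_imp:
  assumes "qpar z = qpar w"
  obtains n :: int where "z = w + of_int n"
proof -
  obtain n :: int where "tpi * z = tpi * w + (of_int (2 * n) * pi) * \<i>"
    using assms unfolding qpar_def exp_eq by auto
  also have "\<dots> = tpi * (w + of_int n)" by (simp add: algebra_simps)
  finally have "z = w + of_int n" by simp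
  then show ?thesis by (rule that)
qed

lemma qpar_deriv: "(qpar has_field_derivative tpi * qpar z) (at z)"
proof -
  have "((\<lambda>z. exp (tpi * z)) has_field_derivative tpi * exp (tpi * z)) (at z)"
    by (auto intro!: derivative_eq_intros)
  then show ?thesis by (simp add: qpar_def [abs_def])
qed

text \<open>The real power of \<open>q\<close> is written as an exponential in \<open>z\<close>,
  which fixes its branch. Since \<open>u\<close> is holomorphic at 0 as well, \<open>u 0\<close> is
  the leading coefficient, possibly zero. Values of \<open>f\<close> off the upper half-plane are
  left free.\<close>

definition qexp :: "real \<Rightarrow> (complex \<Rightarrow> complex) \<Rightarrow> (complex \<Rightarrow> complex) \<Rightarrow> bool" where
  "qexp l u f \<longleftrightarrow> u holomorphic_on ball 0 1 \<and>
     (\<forall>z. Im z > 0 \<longrightarrow> f z = exp (tpi * of_real l * z) * u (qpar z))"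

lemma qexpD:
  assumes "qexp l u f"
  shows "u holomorphic_on ball 0 1"
    and "Im z > 0 \<Longrightarrow> f z = exp (tpi * of_real l * z) * u (qpar z)"
  using assms by (auto simp: qexp_def)

lemma qexp0D: "qexp 0 u f \<Longrightarrow> Im z > 0 \<Longrightarrow> f z = u (qpar z)"
  by (simp add: qexp_def)

lemma qexp_cong:
  assumes "qexp l u f" "\<And>z. Im z > 0 \<Longrightarrow> f z = g z"
  shows "qexp l u g"
  using assms by (simp add: qexp_def)

lemma qexp_mult:
  assumes "qexp l u f" "qexp m v g"
  shows "qexp (l + m) (\<lambda>q. u q * v q) (\<lambda>z. f z * g z)"
  using assms unfolding qexp_def
  by (auto intro!: holomorphic_intros simp: ring_distribs exp_add)

lemma qexp_add:
  assumes "qexp l u f" "qexp l v g"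
  shows "qexp l (\<lambda>q. u q + v q) (\<lambda>z. f z + g z)"
  using assms unfolding qexp_def
  by (auto intro!: holomorphic_intros simp: ring_distribs)

lemma qexp_cmult:
  assumes "qexp l u f"
  shows "qexp l (\<lambda>q. c * u q) (\<lambda>z. c * f z)"
  using assms unfolding qexp_def by (auto intro!: holomorphic_intros)

lemma qexp_divide:
  assumes "qexp l u f" "qexp m v g" "\<And>q. norm q < 1 \<Longrightarrow> v q \<noteq> 0"
  shows "qexp (l - m) (\<lambda>q. u q / v q) (\<lambda>z. f z / g z)"
  using assms unfolding qexp_def
  by (auto intro!: holomorphic_intros simp: ring_distribs exp_diff)

lemma qexp_const: "qexp 0 (\<lambda>_. c) (\<lambda>_. c)"
  by (auto simp: qexp_def)

lemma qexp_mult0: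
  assumes "qexp 0 u f" "qexp 0 v g"
  shows "qexp 0 (\<lambda>q. u q * v q) (\<lambda>z. f z * g z)"
  using qexp_mult[OF assms] by simp

lemma qexp_power:
  assumes "qexp 0 u f"
  shows "qexp 0 (\<lambda>q. u q ^ n) (\<lambda>z. f z ^ n)"
  by (induction n) (auto intro: qexp_const qexp_mult0 assms)

lemma qexp_has_derivative:
  assumes "qexp l u f" "Im z > 0"
  shows "(f has_field_derivative
     tpi * (exp (tpi * of_real l * z) * (of_real l * u (qpar z) + qpar z * deriv u (qpar z)))) (at z)"
proof -
  have "qpar z \<in> ball 0 1" using assms(2) norm_qpar_less_1 by simp
  then have u: "(u has_field_derivative deriv u (qpar z)) (at (qpar z))"
    using qexpD(1)[OF assms(1)] holomorphic_derivI open_ball by blast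
  have u': "((\<lambda>z. u (qpar z)) has_field_derivative deriv u (qpar z) * (tpi * qpar z)) (at z)"
    by (rule DERIV_chain2[where g = qpar, OF u qpar_deriv])
  have "((\<lambda>z. exp (tpi * of_real l * z) * u (qpar z)) has_field_derivative
     tpi * (exp (tpi * of_real l * z) * (of_real l * u (qpar z) + qpar z * deriv u (qpar z)))) (at z)"
    by (rule derivative_eq_intros u' refl)+ (simp add: algebra_simps)
  then show ?thesis
    by (rule has_field_derivative_transform_within_open[OF _ open_UHP])
      (use assms qexpD(2)[OF assms(1)] in auto)
qed

lemma qexp_holomorphic: "qexp l u f \<Longrightarrow> f holomorphic_on UHP"
  by (auto simp: holomorphic_on_open[OF open_UHP] intro!: exI qexp_has_derivative)

lemma qexp_deriv:
  assumes "qexp l u f"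
  shows "qexp l (\<lambda>q. of_real l * u q + q * deriv u q) (\<lambda>z. deriv f z / tpi)"
  unfolding qexp_def
  using qexpD(1)[OF assms] DERIV_imp_deriv[OF qexp_has_derivative[OF assms]]
  by (auto intro!: holomorphic_intros)

lemma qpar_small:
  assumes "e > 0"
  obtains Y where "Y > 0" "\<And>z. Im z > Y \<Longrightarrow> norm (qpar z) < e"
proof -
  define Y where "Y = max 1 (- ln e / (2 * pi))"
  have "norm (qpar z) < e" if "Im z > Y" for z
  proof -
    have "- ln e / (2 * pi) < Im z" using that by (simp add: Y_def)
    then have "- (2 * pi * Im z) < ln e" by (simp add: field_simps)
    then show ?thesis using assms by (metis norm_qpar exp_less_cancel_iff exp_ln)
  qed
  then show ?thesis using that[of Y] by (simp add: Y_def)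
qed

lemma qexp_limit:
  assumes "qexp 0 u f" "e > 0"
  obtains Y where "Y > 0" "\<And>z. Im z > Y \<Longrightarrow> norm (f z - u 0) < e"
proof -
  have "continuous (at 0) u"
    using holomorphic_on_imp_continuous_on[OF qexpD(1)[OF assms(1)]]
    by (simp add: continuous_on_eq_continuous_at)
  then obtain d where "d > 0" and d: "\<And>q. norm q < d \<Longrightarrow> norm (u q - u 0) < e"
    using assms(2) unfolding continuous_at_eps_delta by (auto simp: dist_norm)
  obtain Y where "Y > 0" "\<And>z. Im z > Y \<Longrightarrow> norm (qpar z) < d"
    using qpar_small[OF \<open>d > 0\<close>] by blast
  then show ?thesis using that[of Y] d qexp0D[OF assms(1)] by force
qed

text \<open>Moderate growth allows no constant in front of the power of \<open>y\<close>. Constants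
  are absorbed by raising the exponent by 1 and restricting to \<open>y\<close> above the constant,
  here 2.\<close>

lemma moderate_growth_add:
  assumes "moderate_growth f" "moderate_growth g"
  shows "moderate_growth (\<lambda>z. f z + g z)"
proof -
  obtain N c N' c' where N: "N > 0" "N' > 0" "c > 0" "c' > 0"
    and f: "\<And>x y. y > c \<Longrightarrow> norm (f (Complex x y)) \<le> y powr N"
    and g: "\<And>x y. y > c' \<Longrightarrow> norm (g (Complex x y)) \<le> y powr N'"
    using assms unfolding moderate_growth_def by metis
  have "norm (f (Complex x y) + g (Complex x y)) \<le> y powr (max N N' + 1)" if y: "y > max 2 (max c c')" for x y
  proof -
    have "norm (f (Complex x y) + g (Complex x y)) \<le> y powr N + y powr N'"
      using f[of y x] g[of y x] y by (intro norm_triangle_mono) auto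
    also have "\<dots> \<le> y powr max N N' + y powr max N N'"
      using y by (intro add_mono powr_mono) auto
    also have "\<dots> \<le> y * y powr max N N'"
      using y mult_right_mono[of 2 y "y powr max N N'"] by simp
    also have "\<dots> = y powr (max N N' + 1)" using y by (simp add: powr_add)
    finally show ?thesis .
  qed
  then show ?thesis unfolding moderate_growth_def using N
    by (intro exI[of _ "max N N' + 1"] exI[of _ "max 2 (max c c')"]) auto
qed

lemma moderate_growth_cmult:
  assumes "moderate_growth f"
  shows "moderate_growth (\<lambda>z. a * f z)"
proof -
  obtain N c where N: "N > 0" "c > 0" and f: "\<And>x y. y > c \<Longrightarrow> norm (f (Complex x y)) \<le> y powr N"
    using assms unfolding moderate_growth_def by metis
  have "norm (a * f (Complex x y)) \<le> y powr (N + 1)" if y: "y > max (norm a) c" for x y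
  proof -
    have "y > 0" using y N by linarith
    have "norm (a * f (Complex x y)) \<le> y * y powr N"
      unfolding norm_mult using f[of y x] y \<open>y > 0\<close> by (intro mult_mono) auto
    also have "\<dots> = y powr (N + 1)" using \<open>y > 0\<close> by (simp add: powr_add)
    finally show ?thesis .
  qed
  then show ?thesis unfolding moderate_growth_def using N
    by (intro exI[of _ "N + 1"] exI[of _ "max (norm a) c"]) auto
qed

text \<open>Stronger than moderate growth and free of exponents; it is what a
  \<open>q\<close>-expansion with nonnegative exponent provides.\<close>

definition bounded_at_cusp :: "(complex \<Rightarrow> complex) \<Rightarrow> bool" where
  "bounded_at_cusp f \<longleftrightarrow> (\<exists>C Y. \<forall>z. Im z > Y \<longrightarrow> norm (f z) \<le> C)"

lemma bounded_at_cusp_add: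
  assumes "bounded_at_cusp f" "bounded_at_cusp g"
  shows "bounded_at_cusp (\<lambda>z. f z + g z)"
proof -
  obtain C Y C' Y' where "\<And>z. Im z > Y \<Longrightarrow> norm (f z) \<le> C" "\<And>z. Im z > Y' \<Longrightarrow> norm (g z) \<le> C'"
    using assms by (auto simp: bounded_at_cusp_def)
  then have "norm (f z + g z) \<le> C + C'" if "Im z > max Y Y'" for z
    using that by (intro norm_triangle_mono) auto
  then show ?thesis unfolding bounded_at_cusp_def by blast
qed

lemma bounded_at_cusp_cmult:
  assumes "bounded_at_cusp f"
  shows "bounded_at_cusp (\<lambda>z. c * f z)"
proof -
  obtain C Y where "\<And>z. Im z > Y \<Longrightarrow> norm (f z) \<le> C"
    using assms by (auto simp: bounded_at_cusp_def)
  then have "norm (c * f z) \<le> norm c * C" if "Im z > Y" for z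
    using that by (simp add: norm_mult mult_left_mono)
  then show ?thesis unfolding bounded_at_cusp_def by blast
qed

lemma bounded_at_cusp_mult:
  assumes "bounded_at_cusp f" "bounded_at_cusp g"
  shows "bounded_at_cusp (\<lambda>z. f z * g z)"
proof -
  obtain C Y C' Y' where b: "\<And>z. Im z > Y \<Longrightarrow> norm (f z) \<le> C" "\<And>z. Im z > Y' \<Longrightarrow> norm (g z) \<le> C'"
    using assms by (auto simp: bounded_at_cusp_def)
  have "norm (f z * g z) \<le> C * C'" if "Im z > max Y Y'" for z
    unfolding norm_mult using b that by (intro mult_mono) (auto intro: order_trans[OF norm_ge_zero])
  then show ?thesis unfolding bounded_at_cusp_def by blast
qed

lemma bounded_at_cusp_moderate:
  assumes "bounded_at_cusp f"
  shows "moderate_growth f"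
proof -
  obtain C Y where C: "\<And>z. Im z > Y \<Longrightarrow> norm (f z) \<le> C"
    using assms by (auto simp: bounded_at_cusp_def)
  have "norm (f (Complex x y)) \<le> y powr 1" if "y > max 1 (max Y C)" for x y
    using C[of "Complex x y"] that by simp
  then show ?thesis unfolding moderate_growth_def
    by (intro exI[of _ 1] exI[of _ "max 1 (max Y C)"]) auto
qed

lemma qexp_bounded:
  assumes "qexp l u f" "l \<ge> 0"
  shows "bounded_at_cusp f"
proof -
  have u: "qexp 0 u (\<lambda>z. u (qpar z))"
    using qexpD(1)[OF assms(1)] by (simp add: qexp_def)
  obtain Y where "Y > 0" and Y: "\<And>z. Im z > Y \<Longrightarrow> norm (u (qpar z) - u 0) < 1"
    using qexp_limit[OF u, of 1] by auto
  have "norm (f z) \<le> 1 * (norm (u 0) + 1)" if "Im z > Y" for z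
  proof -
    have "norm (exp (tpi * of_real l * z)) \<le> 1"
      using assms(2) that \<open>Y > 0\<close> by simp
    moreover have "norm (u (qpar z)) \<le> norm (u 0) + 1"
      using Y[OF that] norm_triangle_ineq2[of "u (qpar z)" "u 0"] by linarith
    ultimately have "norm (exp (tpi * of_real l * z)) * norm (u (qpar z)) \<le> 1 * (norm (u 0) + 1)"
      by (intro mult_mono) auto
    then show ?thesis
      using qexpD(2)[OF assms(1), of z] that \<open>Y > 0\<close> by (simp add: norm_mult)
  qed
  then show ?thesis unfolding bounded_at_cusp_def by blast
qed

text \<open>\<open>qpar\<close> maps the upper half-plane onto the punctured disc, and continuity of
  the analytic difference settles \<open>q = 0\<close>. The value at 0 is the point: it allows
  leading coefficients to be compared.\<close>

lemma qexp_unique: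
  assumes "qexp l u f" "qexp l v f" "norm q < 1"
  shows "u q = v q"
proof -
  have eq: "u w = v w" if "w \<noteq> 0" "norm w < 1" for w
    using qpar_surj[OF that] qexpD(2)[OF assms(1)] qexpD(2)[OF assms(2)] by force
  have "u 0 - v 0 = 0"
  proof (rule analytic_continuation[where f = "\<lambda>w. u w - v w" and S = "ball 0 1" and U = "ball 0 1 - {0}" and \<xi> = 0])
    show "(\<lambda>w. u w - v w) holomorphic_on ball 0 1"
      using assms by (auto intro!: holomorphic_intros simp: qexp_def)
    have "(0::complex) islimpt ball 0 1" by (rule interior_limit_point) auto
    then show "(0::complex) islimpt (ball 0 1 - {0})" by (simp add: islimpt_punctured [symmetric])
  qed (use eq in auto)
  then show ?thesis using eq assms(3) by (cases "q = 0") auto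
qed

text \<open>After division by the exponential the function has period 1 and so descends to the
  punctured disc. The singularity at 0 is removable because polynomial growth in \<open>Im z\<close>
  is only logarithmic in \<open>q\<close>.\<close>

lemma qexp_exists:
  assumes hol: "h holomorphic_on UHP" and mg: "moderate_growth h"
    and per: "\<And>z. Im z > 0 \<Longrightarrow> h (z + 1) = ee l * h z" and l: "0 \<le> l" "l < 1"
  shows "\<exists>u. qexp l u h"
proof -
  define g where "g = (\<lambda>z. h z * exp (- (tpi * of_real l * z)))"
  have g1: "g (z + 1) = g z" if "Im z > 0" for z
    using per[OF that] by (simp add: g_def ee_def ring_distribs exp_add exp_minus)
  have gn: "g (z + of_int n) = g z" if "Im z > 0" for z n
  proof (induction n rule: int_induct[where k = 0])
    case (step1 i)
    then show ?case using g1[of "z + of_int i"] that by (simp add: add.assoc)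
  next
    case (step2 i)
    then show ?case using g1[of "z + of_int (i - 1)"] that by (simp add: algebra_simps)
  qed simp
  have gq: "g z = g w" if "qpar z = qpar w" "Im w > 0" for z w
    using qpar_eq_imp[OF that(1)] gn[OF that(2)] by metis
  have ghol: "g holomorphic_on UHP"
    unfolding g_def by (intro holomorphic_intros hol)
  define U where "U = (\<lambda>q. g (Ln q / tpi))"
  have Uq: "U (qpar z) = g z" if "Im z > 0" for z
    unfolding U_def by (rule gq) (simp_all add: qpar_Ln that)
  \<comment> \<open>Two slit discs cover the punctured disc. The principal logarithm is holomorphic
    on \<open>A\<close> only.\<close>
  define A B where "A = (ball 0 1 - {0::complex}) \<inter> (- \<real>\<^sub>\<le>\<^sub>0)"
    and "B = (ball 0 1 - {0::complex}) \<inter> uminus -` (- \<real>\<^sub>\<le>\<^sub>0)"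
  have oA: "open A" and oB: "open B"
    by (auto simp: A_def B_def intro!: open_Int open_vimage continuous_intros)
  have AB: "A \<union> B = ball 0 1 - {0}"
    by (auto simp: A_def B_def complex_nonpos_Reals_iff complex_eq_iff)
  have UHP_of: "Im z > 0" if "qpar z = q" "q \<in> ball 0 1" for z q
    using that norm_qpar_less_1[of z] by auto
  have "(g \<circ> (\<lambda>q. Ln q / tpi)) holomorphic_on A"
  proof (rule holomorphic_on_compose_gen[OF _ ghol])
    show "(\<lambda>q. Ln q / tpi) holomorphic_on A"
      by (auto intro!: holomorphic_intros simp: A_def)
    show "(\<lambda>q. Ln q / tpi) ` A \<subseteq> UHP"
      using UHP_of[OF qpar_Ln] unfolding A_def by fastforce
  qed
  then have UA: "U holomorphic_on A" by (simp add: U_def o_def)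
  \<comment> \<open>A logarithm with its cut on the positive axis. It may differ from
    \<open>Ln\<close> by a period, which the periodicity of \<open>g\<close> makes invisible, so
    \<open>U\<close> is holomorphic on \<open>B\<close> too.\<close>
  define L where "L = (\<lambda>q. (Ln (- q) + \<i> * of_real pi) / tpi)"
  have qL: "qpar (L q) = q" if "q \<noteq> 0" for q
    using that by (simp add: qpar_def L_def exp_add mult.commute[of \<i>])
  have "(g \<circ> L) holomorphic_on B"
  proof (rule holomorphic_on_compose_gen[OF _ ghol])
    show "L holomorphic_on B"
      unfolding L_def by (auto intro!: holomorphic_intros simp: B_def)
    show "L ` B \<subseteq> UHP"
      using UHP_of[OF qL] unfolding B_def by fastforce
  qed
  moreover have "(g \<circ> L) q = U q" if "q \<in> B" for q
  proof -
    have "q \<noteq> 0" "q \<in> ball 0 1" using that by (auto simp: B_def)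
    then show ?thesis using Uq[OF UHP_of[OF qL]] qL by simp
  qed
  ultimately have UB: "U holomorphic_on B"
    using holomorphic_transform by blast
  have Uhol: "U holomorphic_on (ball 0 1 - {0})"
    using holomorphic_on_Un[OF UA UB oA oB] AB by simp
  obtain N c where N: "N > 0" "c > 0" and bd: "\<And>x y. y > c \<Longrightarrow> norm (h (Complex x y)) \<le> y powr N"
    using mg by (auto simp: moderate_growth_def)
  have lim: "((\<lambda>q. (q - 0) * U q) \<longlongrightarrow> 0) (at 0)"
  proof (rule Lim_null_comparison)
    define Y where "Y = (\<lambda>q::complex. - ln (norm q) / (2 * pi))"
    have "filterlim (\<lambda>q::complex. norm q) (at_right 0) (at 0)"
      unfolding filterlim_at by (auto simp: eventually_at_filter intro!: tendsto_eq_intros)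
    moreover have "filterlim (\<lambda>r::real. - ln r / (2 * pi)) at_top (at_right 0)"
      by real_asymp
    ultimately have Ytop: "filterlim Y at_top (at 0)"
      unfolding Y_def by (rule filterlim_compose[rotated])
    \<comment> \<open>The factor \<open>q\<close> contributes decay of rate \<open>2 * pi\<close>,
      of which the removed exponential uses up the part \<open>l\<close>; as \<open>l < 1\<close>,
      what remains still beats \<open>y powr N\<close>.\<close>
    have "((\<lambda>y::real. exp (- (2 * pi * (1 - l)) * y) * y powr N) \<longlongrightarrow> 0) at_top"
      using N l by real_asymp
    then show "((\<lambda>q. exp (- (2 * pi * (1 - l)) * Y q) * Y q powr N) \<longlongrightarrow> 0) (at 0)"
      using Ytop by (rule filterlim_compose)
    have "eventually (\<lambda>q. Y q > c) (at 0)"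
      using Ytop by (simp add: filterlim_at_top_dense)
    moreover have "eventually (\<lambda>q::complex. q \<in> ball 0 1 - {0}) (at 0)"
      by (intro eventually_at_in_open) auto
    ultimately show "\<forall>\<^sub>F q in at 0. norm ((q - 0) * U q) \<le> exp (- (2 * pi * (1 - l)) * Y q) * Y q powr N"
    proof eventually_elim
      case (elim q)
      then obtain z where z: "Im z > 0" "qpar z = q" using qpar_surj[of q] by auto
      have Y: "Y q = Im z" by (simp add: Y_def z(2) [symmetric] norm_qpar)
      have "norm (h z) \<le> Im z powr N" using bd[of "Im z" "Re z"] elim Y by (simp add: complex_surj)
      then have "exp (- (2 * pi * (1 - l)) * Im z) * norm (h z) \<le> exp (- (2 * pi * (1 - l)) * Im z) * Im z powr N"
        by (intro mult_left_mono) auto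
      moreover have "norm ((q - 0) * U q) = exp (- (2 * pi * (1 - l)) * Im z) * norm (h z)"
        using Uq[OF z(1)]
        by (simp add: z(2) g_def norm_mult z(2) [symmetric] norm_qpar ring_distribs exp_add [symmetric] del: z(2))
      ultimately show ?case by (simp add: Y)
    qed
  qed
  obtain u where u: "u holomorphic_on ball 0 1" "\<And>q. q \<in> ball 0 1 - {0} \<Longrightarrow> u q = U q"
    using holomorphic_on_extend_lim[OF Uhol] lim by auto
  have "h z = exp (tpi * of_real l * z) * u (qpar z)" if "Im z > 0" for z
  proof -
    have "u (qpar z) = g z" using u(2)[of "qpar z"] norm_qpar_less_1[of z] Uq[OF that] that by simp
    then show ?thesis by (simp add: g_def exp_minus)
  qed
  then show ?thesis using u(1) unfolding qexp_def by blast
qed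

section \<open>The eta function\<close>

definition euler_prod :: "complex \<Rightarrow> complex" where
  "euler_prod q = (\<Prod>n. 1 - q ^ Suc n)"

lemma euler_prod_convergent:
  fixes q :: complex
  assumes "norm q < 1"
  shows "convergent_prod (\<lambda>n. 1 - q ^ Suc n)"
proof -
  have "summable (\<lambda>n. norm q * norm q ^ n)"
    using assms by (intro summable_mult summable_geometric) auto
  then have "abs_convergent_prod (\<lambda>n. 1 - q ^ Suc n)"
    unfolding abs_convergent_prod_conv_summable by (simp add: norm_mult norm_power)
  then show ?thesis by (rule abs_convergent_prod_imp_convergent_prod)
qed

lemma euler_prod_nonzero:
  assumes "norm q < 1"
  shows "euler_prod q \<noteq> 0"
  unfolding euler_prod_def
proof (rule prodinf_nonzero[OF euler_prod_convergent[OF assms]])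
  fix n
  have "norm (q ^ Suc n) < 1"
    using assms power_decreasing[of 1 "Suc n" "norm q"] by (simp add: norm_mult norm_power)
  then show "1 - q ^ Suc n \<noteq> 0" by auto
qed

lemma euler_prod_holomorphic: "euler_prod holomorphic_on ball 0 1"
proof (rule holomorphic_uniform_sequence[OF open_ball])
  fix n show "(\<lambda>q. \<Prod>k<n. 1 - q ^ Suc k) holomorphic_on ball 0 1" for n
    by (intro holomorphic_intros)
next
  fix z :: complex assume "z \<in> ball 0 1"
  then obtain d where d: "d > 0" "cball z d \<subseteq> ball 0 1"
    using open_contains_cball_eq[OF open_ball] by blast
  have "uniformly_convergent_on (cball z d) (\<lambda>N q. \<Prod>n<N. 1 - q ^ Suc n)"
  proof (rule uniformly_convergent_on_prod')
    obtain r where r: "r < 1" "\<And>q. q \<in> cball z d \<Longrightarrow> norm q \<le> r"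
    proof -
      have "compact (cball z d)" "cball z d \<noteq> {}" using d by auto
      then obtain w where "w \<in> cball z d" "\<And>q. q \<in> cball z d \<Longrightarrow> norm q \<le> norm w"
        using continuous_attains_sup[of "cball z d" norm] continuous_on_norm_id by blast
      moreover from this d have "norm w < 1" by auto
      ultimately show ?thesis using that by blast
    qed
    then have r0: "0 \<le> r" using order_trans[OF norm_ge_zero r(2)[of z]] d by simp
    show "uniformly_convergent_on (cball z d) (\<lambda>N q. \<Sum>n<N. norm (1 - q ^ Suc n - 1))"
    proof (rule Weierstrass_m_test')
      show "summable (\<lambda>n. r * r ^ n)" using r r0 by (intro summable_mult summable_geometric) auto
      show "norm (norm (1 - q ^ Suc n - 1)) \<le> r * r ^ n" if "q \<in> cball z d" for n q
        using power_mono[OF r(2)[OF that] norm_ge_zero, of "Suc n"] by (simp add: norm_mult norm_power)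
    qed
  qed (auto intro!: continuous_intros)
  then obtain g where g: "uniform_limit (cball z d) (\<lambda>N q. \<Prod>n<N. 1 - q ^ Suc n) g sequentially"
    by (auto simp: uniformly_convergent_on_def)
  have "g q = euler_prod q" if "q \<in> cball z d" for q
  proof -
    have "(\<lambda>N. \<Prod>n<N. 1 - q ^ Suc n) \<longlonglongrightarrow> g q"
      using tendsto_uniform_limitI[OF g that] .
    moreover have "(\<lambda>N. \<Prod>n\<le>N. 1 - q ^ Suc n) \<longlonglongrightarrow> euler_prod q"
      unfolding euler_prod_def using that d by (intro convergent_prod_LIMSEQ euler_prod_convergent) auto
    ultimately show ?thesis
      using LIMSEQ_unique LIMSEQ_lessThan_iff_atMost by blast
  qed
  then have "uniform_limit (cball z d) (\<lambda>N q. \<Prod>n<N. 1 - q ^ Suc n) euler_prod sequentially"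
    using g by (subst uniform_limit_cong'[where g = "\<lambda>N q. \<Prod>n<N. 1 - q ^ Suc n" and i = g]) auto
  then show "\<exists>d>0. cball z d \<subseteq> ball 0 1 \<and> uniform_limit (cball z d) (\<lambda>N q. \<Prod>n<N. 1 - q ^ Suc n) euler_prod sequentially"
    using d by blast
qed

lemma eta_qexp: "qexp (1/24) euler_prod eta"
proof -
  have "eta z = exp (tpi * of_real (1/24) * z) * euler_prod (qpar z)" for z
  proof -
    have "exp (2 * of_real pi * \<i> * of_nat (Suc n) * z) = qpar z ^ Suc n" for n
      unfolding qpar_def exp_of_nat_mult [symmetric] by (simp add: algebra_simps)
    then have "(\<Prod>n. 1 - exp (2 * of_real pi * \<i> * of_nat (Suc n) * z)) = euler_prod (qpar z)"
      by (simp only: euler_prod_def)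
    then show ?thesis by (simp add: eta_def mult_ac)
  qed
  then show ?thesis using euler_prod_holomorphic by (simp add: qexp_def)
qed

text \<open>\<open>Pfun\<close> as a function of \<open>q\<close>: the logarithmic derivative of eta
  is \<open>tpi\<close> times \<open>1/24 + q E' / E\<close> with \<open>E\<close> the Euler
  product, and \<open>\<i> / pi * tpi = - 2\<close>.\<close>

definition Pser :: "complex \<Rightarrow> complex" where
  "Pser q = - 1/12 - 2 * (q * deriv euler_prod q / euler_prod q)"

lemma Pser_0: "Pser 0 = - 1/12"
  by (simp add: Pser_def)

lemma Pfun_qexp: "qexp 0 Pser Pfun"
proof -
  have "Pser holomorphic_on ball 0 1"
    unfolding Pser_def [abs_def] using euler_prod_holomorphic euler_prod_nonzero
    by (auto intro!: holomorphic_intros)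
  moreover have "Pfun z = Pser (qpar z)" if z: "Im z > 0" for z
  proof -
    define E where "E = exp (tpi * of_real (1/24) * z)"
    define Q where "Q = qpar z"
    have nz: "euler_prod Q \<noteq> 0" "E \<noteq> 0"
      using euler_prod_nonzero[of Q] norm_qpar_less_1 z by (auto simp: Q_def E_def)
    have e: "eta z = E * euler_prod Q"
      using qexpD(2)[OF eta_qexp z] by (simp add: E_def Q_def)
    have "deriv eta z = tpi * (E * (of_real (1/24) * euler_prod Q + Q * deriv euler_prod Q))"
      unfolding E_def Q_def by (rule DERIV_imp_deriv[OF qexp_has_derivative[OF eta_qexp z]])
    then show ?thesis
      using nz by (simp add: Pfun_def e Pser_def Q_def [symmetric]) (simp add: field_simps)
  qed
  ultimately show ?thesis by (simp add: qexp_def)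
qed

lemma Pfun_holomorphic: "Pfun holomorphic_on UHP"
  by (rule qexp_holomorphic[OF Pfun_qexp])

section \<open>The derivation D on expansions and on holomorphic functions\<close>

lemma Dop_qexp:
  assumes "qexp l u f"
  shows "qexp l (\<lambda>q. of_real l * u q + q * deriv u q + of_real k * (Pser q * u q)) (Dop k f)"
proof -
  have "qexp (0 + l) (\<lambda>q. Pser q * u q) (\<lambda>z. Pfun z * f z)"
    by (rule qexp_mult[OF Pfun_qexp assms])
  then have "qexp l (\<lambda>q. of_real l * u q + q * deriv u q + of_real k * (Pser q * u q))
      (\<lambda>z. deriv f z / tpi + of_real k * (Pfun z * f z))"
    by (intro qexp_add qexp_deriv qexp_cmult assms) simp
  then show ?thesis by (rule qexp_cong) (simp add: Dop_def)
qed

lemma Dop_holomorphic: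
  assumes "f holomorphic_on UHP"
  shows "Dop k f holomorphic_on UHP"
proof -
  have "(\<lambda>z. deriv f z / tpi + of_real k * Pfun z * f z) holomorphic_on UHP"
    by (intro holomorphic_intros assms holomorphic_deriv open_UHP Pfun_holomorphic) auto
  then show ?thesis by (rule holomorphic_transform) (simp add: Dop_def)
qed

lemma Dop_linear:
  assumes "f holomorphic_on UHP" "g holomorphic_on UHP"
  shows "Dop k (\<lambda>z. a * f z + b * g z) z = a * Dop k f z + b * Dop k g z"
proof (cases "Im z > 0")
  case True
  have "((\<lambda>z. a * f z + b * g z) has_field_derivative a * deriv f z + b * deriv g z) (at z)"
    using holomorphic_derivI[OF assms(1) open_UHP] holomorphic_derivI[OF assms(2) open_UHP] True
    by (auto intro!: derivative_eq_intros)
  then have "deriv (\<lambda>z. a * f z + b * g z) z = a * deriv f z + b * deriv g z"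
    by (rule DERIV_imp_deriv)
  then show ?thesis using True by (simp add: Dop_def algebra_simps add_divide_distrib)
qed (simp add: Dop_def)

text \<open>It exists because the Euler product has no zero on the disc. Any branch will do: another
  choice differs by a multiple of \<open>tpi\<close> and only rescales the powers of eta by nonzero
  constants.\<close>

definition log_euler :: "complex \<Rightarrow> complex" where
  "log_euler = (SOME g. g holomorphic_on ball 0 1 \<and> (\<forall>q\<in>ball 0 1. exp (g q) = euler_prod q))"

lemma log_euler_holomorphic: "log_euler holomorphic_on ball 0 1"
  and exp_log_euler: "norm q < 1 \<Longrightarrow> exp (log_euler q) = euler_prod q"
proof -
  obtain g where "g holomorphic_on ball 0 1" "\<And>q. q \<in> ball 0 1 \<Longrightarrow> exp (g q) = euler_prod q"
    using holomorphic_logarithm_exists[OF convex_ball open_ball euler_prod_holomorphic, of 0]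
      euler_prod_nonzero by auto
  then have "\<exists>g. g holomorphic_on ball 0 1 \<and> (\<forall>q\<in>ball 0 1. exp (g q) = euler_prod q)" by blast
  from someI_ex[OF this] show "log_euler holomorphic_on ball 0 1"
    "norm q < 1 \<Longrightarrow> exp (log_euler q) = euler_prod q"
    by (auto simp: log_euler_def)
qed

text \<open>The branch of \<open>\<eta>\<^bsup>24s\<^esup>\<close> with leading term \<open>q\<^sup>s\<close>.\<close>

definition eta_pow :: "real \<Rightarrow> complex \<Rightarrow> complex" where
  "eta_pow s z = exp (tpi * of_real s * z) * exp (24 * of_real s * log_euler (qpar z))"

lemma eta_pow_qexp: "qexp s (\<lambda>q. exp (24 * of_real s * log_euler q)) (eta_pow s)"
  unfolding qexp_def eta_pow_def using log_euler_holomorphic by (auto intro!: holomorphic_intros)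

lemma eta_pow_nonzero: "eta_pow s z \<noteq> 0"
  by (simp add: eta_pow_def)

text \<open>This says that D in weight \<open>12 * s\<close> annihilates the function:
  \<open>Pfun\<close> is a multiple of the logarithmic derivative of eta. The form with a plain
  derivative feeds the chain rule directly.\<close>

lemma eta_pow_has_derivative:
  assumes z: "Im z > 0"
  shows "(eta_pow s has_field_derivative - 12 * of_real s * tpi * Pfun z * eta_pow s z) (at z)"
proof -
  define Q where "Q = qpar z"
  have Q: "norm Q < 1" using z norm_qpar_less_1 by (simp add: Q_def)
  have dl: "(log_euler has_field_derivative deriv log_euler Q) (at Q)"
    using holomorphic_derivI[OF log_euler_holomorphic open_ball] Q by simp
  have "((\<lambda>q. exp (log_euler q)) has_field_derivative exp (log_euler Q) * deriv log_euler Q) (at Q)"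
    by (rule derivative_eq_intros dl refl)+
  then have "(euler_prod has_field_derivative exp (log_euler Q) * deriv log_euler Q) (at Q)"
    by (rule has_field_derivative_transform_within_open[OF _ open_ball[of 0 1]])
      (use Q exp_log_euler in auto)
  then have de: "deriv euler_prod Q = euler_prod Q * deriv log_euler Q"
    using exp_log_euler[OF Q] by (simp add: DERIV_imp_deriv)
  have "((\<lambda>q. exp (24 * of_real s * log_euler q)) has_field_derivative
      exp (24 * of_real s * log_euler Q) * (24 * of_real s * deriv log_euler Q)) (at Q)"
    by (rule derivative_eq_intros dl refl)+ simp
  then have dv: "deriv (\<lambda>q. exp (24 * of_real s * log_euler q)) Q =
      exp (24 * of_real s * log_euler Q) * (24 * of_real s * deriv log_euler Q)"
    by (rule DERIV_imp_deriv)
  have P: "Pfun z = - 1/12 - 2 * (Q * deriv log_euler Q)"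
    using qexp0D[OF Pfun_qexp z] euler_prod_nonzero[OF Q] by (simp add: Pser_def Q_def [symmetric] de)
  show ?thesis
    using qexp_has_derivative[OF eta_pow_qexp z, of s]
    unfolding Q_def [symmetric] dv by (simp add: P eta_pow_def Q_def [symmetric] algebra_simps)
qed

text \<open>The quotient by the nowhere vanishing \<open>eta_pow s\<close> has derivative 0. This
  identifies the Wronskian, and also the transform of \<open>eta_pow 1\<close> under a modular
  substitution.\<close>

lemma eta_pow_unique:
  assumes "\<And>z. Im z > 0 \<Longrightarrow> (f has_field_derivative - 12 * of_real s * tpi * Pfun z * f z) (at z)"
  obtains c where "\<And>z. Im z > 0 \<Longrightarrow> f z = c * eta_pow s z"
proof -
  have "\<exists>c. \<forall>z\<in>UHP. f z / eta_pow s z = c"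
  proof (rule has_field_derivative_zero_constant[OF convex_UHP])
    fix z assume "z \<in> UHP"
    then have z: "Im z > 0" by simp
    have "((\<lambda>z. f z / eta_pow s z) has_field_derivative 0) (at z)"
      by (rule derivative_eq_intros assms[OF z] eta_pow_has_derivative[OF z] eta_pow_nonzero refl)+
        (simp add: eta_pow_nonzero)
    then show "((\<lambda>z. f z / eta_pow s z) has_field_derivative 0) (at z within UHP)"
      by (rule has_field_derivative_at_within)
  qed
  then obtain c where "\<forall>z\<in>UHP. f z / eta_pow s z = c" by blast
  then show ?thesis using that[of c] eta_pow_nonzero by (force simp: field_simps)
qed

section \<open>Modular forms of level one\<close>

lemma modforms_mob:
  assumes "f \<in> modforms j" "\<gamma> \<in> SL2Z" "Im z > 0"
  shows "f (mob \<gamma> z) = (jfac \<gamma> z) powi j * f z"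
proof -
  have "\<forall>\<gamma>\<in>SL2Z. \<forall>z\<in>UHP. f (mob \<gamma> z) = (jfac \<gamma> z) powi j * f z"
    using assms(1) unfolding modforms_def mem_Collect_eq by (elim conjE)
  from bspec[OF bspec[OF this assms(2)]] show ?thesis using assms(3) by simp
qed

lemma modforms_outside: "f \<in> modforms j \<Longrightarrow> \<not> Im z > 0 \<Longrightarrow> f z = 0"
  unfolding modforms_def by simp

lemma modforms_qexp:
  assumes "f \<in> modforms j"
  obtains u where "qexp 0 u f"
proof -
  have "f (z + 1) = f z" if "Im z > 0" for z
    using modforms_mob[OF assms Tmat_SL2Z that] by simp
  moreover have "f holomorphic_on UHP"
    using assms unfolding modforms_def mem_Collect_eq by (elim conjE)
  moreover have "moderate_growth f"
    using assms unfolding modforms_def mem_Collect_eq by (elim conjE)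
  ultimately have "\<exists>u. qexp 0 u f"
    by (intro qexp_exists) (simp_all add: ee_def)
  then show ?thesis using that by blast
qed

lemma modformsI:
  assumes "\<And>z. \<not> Im z > 0 \<Longrightarrow> f z = 0" "qexp 0 u f"
    "\<And>\<gamma> z. \<gamma> \<in> SL2Z \<Longrightarrow> Im z > 0 \<Longrightarrow> f (mob \<gamma> z) = (jfac \<gamma> z) powi j * f z"
  shows "f \<in> modforms j"
  unfolding modforms_def mem_Collect_eq UHP_iff
  by (intro conjI allI impI ballI assms qexp_holomorphic[OF assms(2)]
      bounded_at_cusp_moderate[OF qexp_bounded[OF assms(2)]]) simp_all

lemma modforms_eqI:
  assumes "f \<in> modforms i" "g \<in> modforms j" "\<And>z. Im z > 0 \<Longrightarrow> f z = g z"
  shows "f = g"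
proof
  fix z show "f z = g z"
    using assms(3) modforms_outside[OF assms(1)] modforms_outside[OF assms(2)] by (cases "Im z > 0") auto
qed

lemma modforms_zero: "(\<lambda>z. 0) \<in> modforms j"
  using qexp_const[of 0] by (auto intro: modformsI)

lemma modforms_add:
  assumes "f \<in> modforms j" "g \<in> modforms j"
  shows "(\<lambda>z. f z + g z) \<in> modforms j"
proof -
  obtain u v where "qexp 0 u f" "qexp 0 v g" using assms modforms_qexp by metis
  from qexp_add[OF this] show ?thesis
    by (rule modformsI[rotated]) (use assms in \<open>auto simp: modforms_mob modforms_outside ring_distribs\<close>)
qed

lemma modforms_cmult:
  assumes "f \<in> modforms j"
  shows "(\<lambda>z. c * f z) \<in> modforms j"
proof -
  obtain u where "qexp 0 u f" using assms modforms_qexp by metis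
  from qexp_cmult[OF this] show ?thesis
    by (rule modformsI[rotated]) (use assms in \<open>auto simp: modforms_mob modforms_outside\<close>)
qed

lemma modforms_diff:
  assumes "f \<in> modforms j" "g \<in> modforms j"
  shows "(\<lambda>z. f z - g z) \<in> modforms j"
  using modforms_add[OF assms(1) modforms_cmult[OF assms(2), of "-1"]] by simp

lemma modforms_sum:
  assumes "\<And>i. i < (n::nat) \<Longrightarrow> B i \<in> modforms j"
  shows "(\<lambda>z. \<Sum>i<n. c i * B i z) \<in> modforms j"
  using assms
  by (induction n) (auto intro!: modforms_zero modforms_add modforms_cmult)

lemma modforms_mult:
  assumes "f \<in> modforms i" "g \<in> modforms j"
  shows "(\<lambda>z. f z * g z) \<in> modforms (i + j)"
proof -
  obtain u v where "qexp 0 u f" "qexp 0 v g" using assms modforms_qexp by metis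
  from qexp_mult0[OF this] show ?thesis
    by (rule modformsI[rotated])
      (use assms in \<open>auto simp: modforms_mob modforms_outside power_int_add jfac_nonzero\<close>)
qed

lemma modforms_const: "(\<lambda>z. if Im z > 0 then c else 0) \<in> modforms 0"
proof (rule modformsI)
  show "qexp 0 (\<lambda>_. c) (\<lambda>z. if Im z > 0 then c else 0)"
    by (rule qexp_cong[OF qexp_const]) simp
qed (auto simp: mob_UHP)

text \<open>The conditional matters for \<open>n = 0\<close>, where the bare power would be 1 off
  the upper half-plane.\<close>

lemma modforms_power:
  assumes "f \<in> modforms j"
  shows "(\<lambda>z. if Im z > 0 then f z ^ n else 0) \<in> modforms (int n * j)"
proof (induction n)
  case 0
  then show ?case using modforms_const[of 1] by (simp cong: if_cong)
next
  case (Suc n)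
  have "(\<lambda>z. if Im z > 0 then f z ^ Suc n else 0) = (\<lambda>z. f z * (if Im z > 0 then f z ^ n else 0))"
    by auto
  then show ?case using modforms_mult[OF assms Suc] by (simp add: algebra_simps)
qed

text \<open>Maximum modulus. In weight 0 the values are invariant, and near the cusp they are
  smaller than \<open>f z\<close>, so every value at least as large as \<open>f z\<close> in modulus
  recurs in a compact box. The maximum over the box is then global, \<open>f\<close> is constant,
  and its smallness near the cusp contradicts the choice of \<open>z\<close>.\<close>

lemma modforms_0_cusp_zero:
  assumes f: "f \<in> modforms 0" "qexp 0 u f" "u 0 = 0"
  shows "f z = 0"
proof (rule ccontr)
  assume nz: "f z \<noteq> 0"
  then have z: "Im z > 0" using modforms_outside[OF f(1)] by blast
  have inv: "f (mob \<gamma> w) = f w" if "\<gamma> \<in> SL2Z" "Im w > 0" for \<gamma> w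
    using modforms_mob[OF f(1) that] by simp
  have hol: "f holomorphic_on UHP" using qexp_holomorphic[OF f(2)] .
  obtain Y where "Y > 0" and Y: "\<And>w. Im w > Y \<Longrightarrow> norm (f w) < norm (f z)"
    using qexp_limit[OF f(2), of "norm (f z)"] nz f(3) by auto
  define K where "K = cbox (Complex (-1/2) (1/2)) (Complex (1/2) Y)"
  have K: "w \<in> K \<longleftrightarrow> \<bar>Re w\<bar> \<le> 1/2 \<and> 1/2 \<le> Im w \<and> Im w \<le> Y" for w
    by (auto simp: K_def in_cbox_complex_iff)
  have KU: "K \<subseteq> UHP" by (auto simp: K)
  have reduce: "\<exists>w'\<in>K. norm (f w) \<le> norm (f w')" if big: "Im w > 0" "norm (f w) \<ge> norm (f z)" for w
  proof -
    obtain \<gamma> where \<gamma>: "\<gamma> \<in> SL2Z" "\<bar>Re (mob \<gamma> w)\<bar> \<le> 1/2" "1/2 \<le> Im (mob \<gamma> w)"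
      using ex_mob_strip[OF big(1)] by blast
    have eq: "f (mob \<gamma> w) = f w" by (rule inv[OF \<gamma>(1) big(1)])
    then have "Im (mob \<gamma> w) \<le> Y" using Y[of "mob \<gamma> w"] big(2) by force
    then have "mob \<gamma> w \<in> K" using \<gamma> by (simp add: K)
    then show ?thesis using eq by (intro bexI[of _ "mob \<gamma> w"]) simp_all
  qed
  obtain z' where z': "z' \<in> K" "norm (f z) \<le> norm (f z')" using reduce[of z] z by blast
  have "compact K" by (simp add: K_def compact_cbox)
  moreover have "continuous_on K (\<lambda>w. norm (f w))"
    using KU hol by (intro continuous_intros) (auto intro: holomorphic_on_imp_continuous_on holomorphic_on_subset)
  ultimately obtain w0 where w0: "w0 \<in> K" "\<And>w. w \<in> K \<Longrightarrow> norm (f w) \<le> norm (f w0)"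
    using continuous_attains_sup[of K "\<lambda>w. norm (f w)"] z'(1) by blast
  have big: "norm (f z) \<le> norm (f w0)" using z' w0(2) by (meson order_trans)
  have max: "norm (f w) \<le> norm (f w0)" if "w \<in> UHP" for w
  proof (cases "norm (f w) \<ge> norm (f z)")
    case True
    then show ?thesis using reduce[of w] that w0(2) by fastforce
  qed (use big in auto)
  have "f constant_on UHP"
    by (rule maximum_modulus_principle[OF hol open_UHP connected_UHP open_UHP order_refl _ max])
      (use w0 KU in auto)
  then obtain c where c: "\<And>w. Im w > 0 \<Longrightarrow> f w = c" by (auto simp: constant_on_def)
  have "f (Complex 0 (Y + 1)) = c" "f z = c" using c \<open>Y > 0\<close> z by auto
  then show False using Y[of "Complex 0 (Y + 1)"] by simp
qed

text \<open>A primitive of a form of weight 2 changes by a constant under \<open>\<gamma>\<close>; the constant vanishes for the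
  elliptic elements \<open>S\<close> and \<open>ST\<close>, which have fixed points, hence also for \<open>T\<close>. But for \<open>T\<close> it is the
  constant term.\<close>

lemma modforms_2_cusp:
  assumes f: "f \<in> modforms 2" "qexp 0 u f"
  shows "u 0 = 0"
proof -
  obtain F where F': "\<And>z. z \<in> UHP \<Longrightarrow> (F has_field_derivative f z) (at z within UHP)"
    using holomorphic_convex_primitive'[OF convex_UHP open_UHP qexp_holomorphic[OF f(2)]] by blast
  have F: "(F has_field_derivative f z) (at z)" if "Im z > 0" for z
    using F'[of z] that at_within_open[OF _ open_UHP, of z] by simp
  have fixed: "F (mob \<gamma> z) = F z" if \<gamma>: "\<gamma> \<in> SL2Z" and p: "mob \<gamma> p = p" "Im p > 0" and z: "Im z > 0" for \<gamma> p z
  proof -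
    have "\<exists>c. \<forall>z\<in>UHP. F (mob \<gamma> z) - F z = c"
    proof (rule has_field_derivative_zero_constant[OF convex_UHP])
      fix w assume "w \<in> UHP"
      then have w: "Im w > 0" by simp
      have "((\<lambda>w. F (mob \<gamma> w) - F w) has_field_derivative f (mob \<gamma> w) * (1 / (jfac \<gamma> w)\<^sup>2) - f w) (at w)"
        by (intro DERIV_diff DERIV_chain2[where f = F and g = "mob \<gamma>", OF F[OF mob_UHP[OF \<gamma> w]]] F w
            mob_has_derivative \<gamma>)
      moreover have "f (mob \<gamma> w) * (1 / (jfac \<gamma> w)\<^sup>2) - f w = 0"
        using modforms_mob[OF f(1) \<gamma> w] jfac_nonzero[OF \<gamma> w] by simp
      ultimately show "((\<lambda>w. F (mob \<gamma> w) - F w) has_field_derivative 0) (at w within UHP)"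
        using has_field_derivative_at_within by metis
    qed
    then obtain c where c: "\<And>w. Im w > 0 \<Longrightarrow> F (mob \<gamma> w) - F w = c" by auto
    from c[OF p(2)] c[OF z] p(1) show ?thesis by simp
  qed
  have S: "F (- 1 / z) = F z" if "Im z > 0" for z
    using fixed[of Smat \<i> z] that by simp
  have ST: "F (- 1 / (z + 1)) = F z" if "Im z > 0" for z
  proof -
    \<comment> \<open>The cube root of unity in the upper half-plane; \<open>p^2 + p + 1 = 0\<close>
      is the fixed point equation of \<open>ST\<close>.\<close>
    define p where "p = Complex (-1/2) (sqrt 3 / 2)"
    have "p * (p + 1) = -1" by (simp add: p_def complex_eq_iff)
    moreover have "p + 1 \<noteq> 0" by (simp add: p_def complex_eq_iff)
    ultimately have "- 1 / (p + 1) = p" by (metis nonzero_mult_div_cancel_right)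
    then have "mob (0, -1, 1, 1) p = p" by simp
    then show ?thesis using fixed[of "(0, -1, 1, 1)" p z] that by (simp add: p_def SL2Z_def)
  qed
  have T: "F (z + 1) = F z" if "Im z > 0" for z
    using S[of "z + 1"] ST[of z] that by simp
  show ?thesis
  proof (rule ccontr)
    assume a: "u 0 \<noteq> 0"
    obtain Y where "Y > 0" and Y: "\<And>z. Im z > Y \<Longrightarrow> norm (f z - u 0) < norm (u 0) / 2"
      using qexp_limit[OF f(2), of "norm (u 0) / 2"] a by auto
    define z where "z = Complex 0 (Y + 1)"
    define H where "H = {z. Im z > Y}"
    \<comment> \<open>High up, \<open>f\<close> is close to \<open>u 0\<close>, so subtracting
      \<open>u 0 * z\<close> leaves a function of small derivative. By periodicity of
      \<open>F\<close> its change over a unit step is exactly \<open>- u 0\<close>, larger than the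
      derivative bound permits.\<close>
    have "norm ((F (z + 1) - u 0 * (z + 1)) - (F z - u 0 * z)) \<le> norm (u 0) / 2 * norm ((z + 1) - z)"
    proof (rule field_differentiable_bound[where S = H])
      show "convex H" unfolding H_def by (rule convex_halfspace_Im_gt)
      show "((\<lambda>z. F z - u 0 * z) has_field_derivative f w - u 0) (at w within H)" if "w \<in> H" for w
      proof -
        have "Im w > 0" using that \<open>Y > 0\<close> by (simp add: H_def)
        then have "((\<lambda>z. F z - u 0 * z) has_field_derivative f w - u 0) (at w)"
          by (auto intro!: derivative_eq_intros F)
        then show ?thesis by (rule has_field_derivative_at_within)
      qed
      show "norm (f w - u 0) \<le> norm (u 0) / 2" if "w \<in> H" for w
        using Y[of w] that by (simp add: H_def)
    qed (simp_all add: H_def z_def)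
    moreover have "F (z + 1) = F z" using T[of z] \<open>Y > 0\<close> by (simp add: z_def)
    ultimately show False using a by (simp add: algebra_simps norm_minus_commute)
  qed
qed

fun lower_left :: "sl2 \<Rightarrow> int" where "lower_left (a, b, c, d) = c"

lemma jfac_has_derivative: "(jfac \<gamma> has_field_derivative of_int (lower_left \<gamma>)) (at z)"
proof -
  obtain a b c d where g: "\<gamma> = (a, b, c, d)" using prod_cases4 by blast
  have "jfac \<gamma> = (\<lambda>z. of_int c * z + of_int d)" by (auto simp: g)
  then show ?thesis by (auto intro!: derivative_eq_intros simp: g)
qed

lemma jfac_powi_has_derivative:
  assumes "jfac \<gamma> z \<noteq> 0"
  shows "((\<lambda>w. jfac \<gamma> w powi j) has_field_derivative
    of_int j * of_int (lower_left \<gamma>) / jfac \<gamma> z * jfac \<gamma> z powi j) (at z)"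
proof -
  have "((\<lambda>w. jfac \<gamma> w powi j) has_field_derivative
      of_int j * jfac \<gamma> z powi (j - 1) * of_int (lower_left \<gamma>)) (at z)"
    by (rule DERIV_cong[OF DERIV_power_int[OF jfac_has_derivative disjI2[OF assms]]]) simp
  then show ?thesis using assms by (simp add: power_int_diff mult_ac)
qed

text \<open>The transformation law of \<open>P = - E\<^sub>2 / 12\<close>. For the theorem it is read off from the Wronskian
  of \<open>F\<^sub>0\<close>, so it is kept here as an assumption.\<close>

locale quasimodular_Pfun =
  assumes Pfun_mob: "\<And>\<gamma> z. \<gamma> \<in> SL2Z \<Longrightarrow> Im z > 0 \<Longrightarrow>
    Pfun (mob \<gamma> z) = (jfac \<gamma> z)\<^sup>2 * Pfun z - of_int (lower_left \<gamma>) * jfac \<gamma> z / tpi"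
begin

text \<open>The extra term in the law of \<open>P\<close> cancels the derivative of the automorphy
  factor. Only the logarithmic derivative of \<open>\<phi>\<close> enters, which covers integral and
  principal real powers alike; \<open>g\<close> may differ from \<open>f\<close> because \<rho>
  mixes the components of a vector.\<close>

lemma Dop_mob:
  assumes \<gamma>: "\<gamma> \<in> SL2Z" and f: "f holomorphic_on UHP" and g: "g holomorphic_on UHP"
    and \<phi>: "\<And>z. Im z > 0 \<Longrightarrow>
      (\<phi> has_field_derivative of_real k * of_int (lower_left \<gamma>) / jfac \<gamma> z * \<phi> z) (at z)"
    and fg: "\<And>z. Im z > 0 \<Longrightarrow> f (mob \<gamma> z) = \<phi> z * g z"
    and z: "Im z > 0"
  shows "Dop k f (mob \<gamma> z) = (jfac \<gamma> z)\<^sup>2 * \<phi> z * Dop k g z"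
proof -
  define J where "J = jfac \<gamma> z"
  have J: "J \<noteq> 0" unfolding J_def by (rule jfac_nonzero[OF \<gamma> z])
  have z': "Im (mob \<gamma> z) > 0" by (rule mob_UHP[OF \<gamma> z])
  have "(f has_field_derivative deriv f (mob \<gamma> z)) (at (mob \<gamma> z))"
    using holomorphic_derivI[OF f open_UHP] z' by simp
  then have "((\<lambda>z. f (mob \<gamma> z)) has_field_derivative deriv f (mob \<gamma> z) * (1 / J\<^sup>2)) (at z)"
    unfolding J_def by (rule DERIV_chain2[where g = "mob \<gamma>"]) (rule mob_has_derivative[OF \<gamma> z])
  moreover have "((\<lambda>z. \<phi> z * g z) has_field_derivative
      of_real k * of_int (lower_left \<gamma>) / J * \<phi> z * g z + deriv g z * \<phi> z) (at z)"
    using DERIV_mult[OF \<phi>[OF z] holomorphic_derivI[OF g open_UHP]] z by (simp add: J_def)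
  then have "((\<lambda>z. f (mob \<gamma> z)) has_field_derivative
      of_real k * of_int (lower_left \<gamma>) / J * \<phi> z * g z + deriv g z * \<phi> z) (at z)"
    by (rule has_field_derivative_transform_within_open[OF _ open_UHP]) (use z fg in auto)
  ultimately have "deriv f (mob \<gamma> z) * (1 / J\<^sup>2)
      = of_real k * of_int (lower_left \<gamma>) / J * \<phi> z * g z + deriv g z * \<phi> z"
    by (rule DERIV_unique)
  then have "deriv f (mob \<gamma> z)
      = J\<^sup>2 * (of_real k * of_int (lower_left \<gamma>) / J * \<phi> z * g z + deriv g z * \<phi> z)"
    using J by (simp add: field_simps)
  also have "\<dots> = J * of_real k * of_int (lower_left \<gamma>) * \<phi> z * g z + J\<^sup>2 * deriv g z * \<phi> z"
    using J by (simp add: ring_distribs power2_eq_square)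
  finally have d: "deriv f (mob \<gamma> z)
      = J * of_real k * of_int (lower_left \<gamma>) * \<phi> z * g z + J\<^sup>2 * deriv g z * \<phi> z" .
  define s where "s = 1 / tpi"
  have div: "x / tpi = x * s" for x by (simp add: s_def)
  show ?thesis
    using z z' unfolding Dop_def fg[OF z] Pfun_mob[OF \<gamma> z] d div J_def [symmetric]
    by (simp add: algebra_simps)
qed

lemma modforms_Dop:
  assumes f: "f \<in> modforms j" and k: "k = of_int j"
  shows "Dop k f \<in> modforms (j + 2)"
proof -
  obtain u where u: "qexp 0 u f" using f modforms_qexp by metis
  have "Dop k f (mob \<gamma> z) = jfac \<gamma> z powi (j + 2) * Dop k f z" if "\<gamma> \<in> SL2Z" "Im z > 0" for \<gamma> z
  proof -
    have "Dop k f (mob \<gamma> z) = (jfac \<gamma> z)\<^sup>2 * jfac \<gamma> z powi j * Dop k f z"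
    proof (rule Dop_mob[OF that(1) qexp_holomorphic[OF u] qexp_holomorphic[OF u] _ _ that(2)])
      show "((\<lambda>w. jfac \<gamma> w powi j) has_field_derivative
          of_real k * of_int (lower_left \<gamma>) / jfac \<gamma> w * jfac \<gamma> w powi j) (at w)" if "Im w > 0" for w
        using jfac_powi_has_derivative[OF jfac_nonzero[OF \<open>\<gamma> \<in> SL2Z\<close> that], of j] by (simp add: k)
    qed (simp add: modforms_mob[OF f that(1)])
    then show ?thesis by (simp add: power_int_add jfac_nonzero[OF that])
  qed
  then show ?thesis by (intro modformsI[OF _ Dop_qexp[OF u]]) (auto simp: Dop_def)
qed

text \<open>This is \<open>E\<^sub>4 / 144\<close>, by Ramanujan's formula for the derivative of \<open>E\<^sub>2\<close>.\<close>

definition Eis4 :: "complex \<Rightarrow> complex" where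
  "Eis4 z = (if Im z > 0 then deriv Pfun z / tpi + (Pfun z)\<^sup>2 else 0)"

text \<open>Differentiating the law of \<open>P\<close> produces a term linear in \<open>P\<close>
  and one quadratic in the lower left entry; squaring the law produces the same two with opposite
  sign. The constant term is the square of \<open>- 1/12\<close>.\<close>

lemma Eis4: "Eis4 \<in> modforms 4" "\<exists>u. qexp 0 u Eis4 \<and> u 0 = 1/144"
proof -
  have "qexp 0 (\<lambda>q. (0 * Pser q + q * deriv Pser q) + Pser q ^ 2) (\<lambda>z. deriv Pfun z / tpi + (Pfun z)\<^sup>2)"
    using qexp_add[OF qexp_deriv[OF Pfun_qexp] qexp_power[OF Pfun_qexp, of 2]] by simp
  then have q: "qexp 0 (\<lambda>q. (0 * Pser q + q * deriv Pser q) + Pser q ^ 2) Eis4"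
    by (rule qexp_cong) (simp add: Eis4_def)
  moreover have "(0 * Pser 0 + 0 * deriv Pser 0) + Pser 0 ^ 2 = 1/144"
    by (simp add: Pser_0 power2_eq_square)
  ultimately show "\<exists>u. qexp 0 u Eis4 \<and> u 0 = 1/144" by blast
  have "Eis4 (mob \<gamma> z) = jfac \<gamma> z powi 4 * Eis4 z" if \<gamma>: "\<gamma> \<in> SL2Z" and z: "Im z > 0" for \<gamma> z
  proof -
    define J C where "J = jfac \<gamma> z" and "C = (of_int (lower_left \<gamma>) :: complex)"
    have J: "J \<noteq> 0" unfolding J_def by (rule jfac_nonzero[OF \<gamma> z])
    have z': "Im (mob \<gamma> z) > 0" by (rule mob_UHP[OF \<gamma> z])
    have d: "(Pfun has_field_derivative deriv Pfun w) (at w)" if "Im w > 0" for w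
      using holomorphic_derivI[OF Pfun_holomorphic open_UHP] that by simp
    have "((\<lambda>z. Pfun (mob \<gamma> z)) has_field_derivative deriv Pfun (mob \<gamma> z) * (1 / J\<^sup>2)) (at z)"
      unfolding J_def by (rule DERIV_chain2[where g = "mob \<gamma>", OF d[OF z'] mob_has_derivative[OF \<gamma> z]])
    moreover have "((\<lambda>z. (jfac \<gamma> z)\<^sup>2 * Pfun z - of_int (lower_left \<gamma>) * jfac \<gamma> z / tpi)
        has_field_derivative 2 * J * C * Pfun z + J\<^sup>2 * deriv Pfun z - C * C / tpi) (at z)"
      by (auto intro!: derivative_eq_intros d[OF z] jfac_has_derivative simp: J_def C_def)
    then have "((\<lambda>z. Pfun (mob \<gamma> z)) has_field_derivative
        2 * J * C * Pfun z + J\<^sup>2 * deriv Pfun z - C * C / tpi) (at z)"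
      by (rule has_field_derivative_transform_within_open[OF _ open_UHP])
        (use z Pfun_mob[OF \<gamma>] in auto)
    ultimately have "deriv Pfun (mob \<gamma> z) * (1 / J\<^sup>2) = 2 * J * C * Pfun z + J\<^sup>2 * deriv Pfun z - C * C / tpi"
      by (rule DERIV_unique)
    then have d': "deriv Pfun (mob \<gamma> z) = J\<^sup>2 * (2 * J * C * Pfun z + J\<^sup>2 * deriv Pfun z - C * C / tpi)"
      using J by (simp add: field_simps)
    have P: "Pfun (mob \<gamma> z) = J\<^sup>2 * Pfun z - C * J / tpi"
      unfolding J_def C_def by (rule Pfun_mob[OF \<gamma> z])
    define s where "s = 1 / tpi"
    have div: "x / tpi = x * s" for x by (simp add: s_def)
    have "J\<^sup>2 * (2 * J * C * Pfun z + J\<^sup>2 * deriv Pfun z - C * C * s) * s + (J\<^sup>2 * Pfun z - C * J * s)\<^sup>2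
        = J ^ 4 * (deriv Pfun z * s + (Pfun z)\<^sup>2)"
      by algebra
    then show ?thesis
      using z z' by (simp add: Eis4_def d' P J_def [symmetric] div)
  qed
  then show "Eis4 \<in> modforms 4" by (intro modformsI[OF _ q]) (simp add: Eis4_def)
qed

text \<open>Powers of \<open>E4\<close> serve the weights \<open>4 * n\<close>, and
  \<open>E6\<close> times such powers the weights \<open>6 + 4 * n\<close>. Together these are all
  even nonnegative weights except 2.\<close>

lemma modforms_const_term_1:
  assumes "k \<noteq> 1"
  shows "\<exists>f u. f \<in> modforms (2 * int k) \<and> qexp 0 u f \<and> u 0 = 1"
proof -
  define norm1 where "norm1 f j \<longleftrightarrow> f \<in> modforms j \<and> (\<exists>u. qexp 0 u f \<and> u 0 = 1)" for f j
  have norm1I: "norm1 f j" if "f \<in> modforms j" "qexp 0 u f" "u 0 = 1" for f j u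
    using that unfolding norm1_def by blast
  obtain u where u: "qexp 0 u Eis4" "u 0 = 1/144" using Eis4(2) by blast
  have E4: "norm1 (\<lambda>z. 144 * Eis4 z) 4"
    by (rule norm1I[OF modforms_cmult[OF Eis4(1)] qexp_cmult[OF u(1)]]) (simp add: u(2))
  have "Dop 4 Eis4 \<in> modforms 6" using modforms_Dop[OF Eis4(1), of 4] by simp
  \<comment> \<open>The constant term of \<open>Dop 4 Eis4\<close> is
    \<open>4 * (- 1/12) * (1/144) = - 1/432\<close>.\<close>
  then have E6: "norm1 (\<lambda>z. - 432 * Dop 4 Eis4 z) 6"
    by (rule norm1I[OF modforms_cmult qexp_cmult[OF Dop_qexp[OF u(1)]]]) (simp add: u(2) Pser_0)
  have mult: "norm1 (\<lambda>z. f z * g z) (i + j)" if fg: "norm1 f i" "norm1 g j" for f g i j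
  proof -
    obtain v w where "qexp 0 v f" "v 0 = 1" "qexp 0 w g" "w 0 = 1" using fg unfolding norm1_def by blast
    then show ?thesis
      using fg by (intro norm1I[OF modforms_mult qexp_mult0]) (auto simp: norm1_def)
  qed
  have one: "norm1 (\<lambda>z. if Im z > 0 then 1 else 0) 0"
    by (rule norm1I[OF modforms_const qexp_cong[OF qexp_const[of 1]]]) simp_all
  have step: "\<exists>f. norm1 f (i + 4 * int n)" if "norm1 g i" for g i n
  proof (induction n)
    case 0
    then show ?case using that by auto
  next
    case (Suc n)
    then obtain f where "norm1 f (i + 4 * int n)" by blast
    from mult[OF this E4] show ?case by (auto simp: algebra_simps)
  qed
  have "\<exists>f. norm1 f (2 * int k)"
  proof (cases "even k")
    case True
    then obtain n where "k = 2 * n" by blast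
    then show ?thesis using step[OF one, of n] by simp
  next
    case False
    then obtain n where "k = 2 * n + 1" using oddE by blast
    then have "2 * int k = 6 + 4 * int (n - 1)" using assms by auto
    then show ?thesis using step[OF E6, of "n - 1"] by simp
  qed
  then show ?thesis unfolding norm1_def by blast
qed

section \<open>The discriminant form, the 24th power of eta\<close>

definition Disc :: "complex \<Rightarrow> complex" where
  "Disc z = (if Im z > 0 then eta_pow 1 z else 0)"

lemma Disc_qexp: "qexp 0 (\<lambda>q. q * exp (24 * log_euler q)) Disc"
  unfolding qexp_def using log_euler_holomorphic
  by (auto intro!: holomorphic_intros simp: Disc_def eta_pow_def qpar_def)

lemma Disc_nonzero: "Im z > 0 \<Longrightarrow> Disc z \<noteq> 0"
  by (simp add: Disc_def eta_pow_nonzero)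

text \<open>Undoing the weight 12 factor after the substitution gives a solution of the same first
  order equation, and solutions are unique up to a constant. That constant still depends on
  \<gamma>.\<close>

lemma Disc_mob_char:
  assumes \<gamma>: "\<gamma> \<in> SL2Z"
  obtains c where "\<And>z. Im z > 0 \<Longrightarrow> eta_pow 1 (mob \<gamma> z) = c * (jfac \<gamma> z ^ 12 * eta_pow 1 z)"
proof -
  define f where "f = (\<lambda>z. eta_pow 1 (mob \<gamma> z) * jfac \<gamma> z powi (- 12))"
  have "(f has_field_derivative - 12 * of_real 1 * tpi * Pfun z * f z) (at z)" if z: "Im z > 0" for z
  proof -
    define J C where "J = jfac \<gamma> z" and "C = (of_int (lower_left \<gamma>) :: complex)"
    define E V where "E = eta_pow 1 (mob \<gamma> z)" and "V = J powi (- 12)"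
    have J: "J \<noteq> 0" unfolding J_def by (rule jfac_nonzero[OF \<gamma> z])
    have P: "Pfun (mob \<gamma> z) = J\<^sup>2 * Pfun z - C * J / tpi"
      unfolding J_def C_def by (rule Pfun_mob[OF \<gamma> z])
    have d: "((\<lambda>z. eta_pow 1 (mob \<gamma> z)) has_field_derivative
        - 12 * of_real 1 * tpi * Pfun (mob \<gamma> z) * E * (1 / J\<^sup>2)) (at z)"
      unfolding J_def E_def
      by (rule DERIV_chain2[where g = "mob \<gamma>", OF eta_pow_has_derivative[OF mob_UHP[OF \<gamma> z]] mob_has_derivative[OF \<gamma> z]])
    have d': "((\<lambda>z. jfac \<gamma> z powi (- 12)) has_field_derivative - 12 * C / J * V) (at z)"
      using jfac_powi_has_derivative[of \<gamma> z "- 12"] J by (simp add: J_def C_def V_def)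
    have "(f has_field_derivative
        - 12 * of_real 1 * tpi * Pfun (mob \<gamma> z) * E * (1 / J\<^sup>2) * V + - 12 * C / J * V * E) (at z)"
      unfolding f_def using DERIV_mult[OF d d'] by (simp add: E_def V_def J_def)
    moreover have "- 12 * of_real 1 * tpi * Pfun (mob \<gamma> z) * E * (1 / J\<^sup>2) * V + - 12 * C / J * V * E
        = - 12 * tpi * Pfun z * (E * V)"
    proof -
      have "tpi * Pfun (mob \<gamma> z) * (1 / J\<^sup>2) = tpi * Pfun z - C / J"
        using J by (simp add: P right_diff_distrib diff_divide_distrib power2_eq_square)
      then have "- 12 * (tpi * Pfun (mob \<gamma> z) * (1 / J\<^sup>2)) * (E * V) - 12 * (C / J) * (E * V)
          = - 12 * (tpi * Pfun z) * (E * V)"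
        by (simp only:) (simp add: algebra_simps)
      then show ?thesis by (simp add: mult_ac)
    qed
    ultimately show ?thesis by (simp add: f_def E_def V_def J_def)
  qed
  then obtain c where c: "\<And>z. Im z > 0 \<Longrightarrow> f z = c * eta_pow 1 z" using eta_pow_unique by blast
  then have "eta_pow 1 (mob \<gamma> z) = c * (jfac \<gamma> z ^ 12 * eta_pow 1 z)" if "Im z > 0" for z
    using c[OF that] jfac_nonzero[OF \<gamma> that] by (simp add: f_def power_int_minus field_simps)
  then show ?thesis by (rule that)
qed

text \<open>On the generators the constant is 1: for \<open>T\<close> by the integral exponent of
  \<open>q\<close>, for \<open>S\<close> by evaluation at its fixed point \<open>\<i>\<close>, where
  \<open>\<i> ^ 12 = 1\<close> and the function does not vanish.\<close>

lemma Disc_modform: "Disc \<in> modforms 12"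
proof -
  define Q where "Q \<gamma> \<longleftrightarrow> (\<forall>z. Im z > 0 \<longrightarrow> eta_pow 1 (mob \<gamma> z) = jfac \<gamma> z ^ 12 * eta_pow 1 z)" for \<gamma>
  have QD: "eta_pow 1 (mob \<gamma> z) = jfac \<gamma> z ^ 12 * eta_pow 1 z" if "Q \<gamma>" "Im z > 0" for \<gamma> z
    using that by (simp add: Q_def)
  have translation: "eta_pow 1 (z + 1) = eta_pow 1 z" for z
    by (simp add: eta_pow_def qpar_def ring_distribs exp_add)
  have inversion: "eta_pow 1 (- 1 / z) = z ^ 12 * eta_pow 1 z" if "Im z > 0" for z
  proof -
    obtain c where c: "\<And>z. Im z > 0 \<Longrightarrow> eta_pow 1 (- 1 / z) = c * (z ^ 12 * eta_pow 1 z)"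
      using Disc_mob_char[OF Smat_SL2Z] by auto
    have "\<i> ^ 12 = 1" by (simp add: eval_nat_numeral)
    then have "c = 1" using c[of \<i>] eta_pow_nonzero[of 1 \<i>] by simp
    then show ?thesis using c[OF that] by simp
  qed
  have "Q \<gamma>" if "\<gamma> \<in> SL2Z" for \<gamma>
    using that
  proof (induction rule: SL2Z_induct)
    case I
    then show ?case by (simp add: Q_def)
  next
    case (S \<gamma>)
    have "eta_pow 1 (mob (mmul Smat \<gamma>) z) = jfac (mmul Smat \<gamma>) z ^ 12 * eta_pow 1 z" if z: "Im z > 0" for z
      unfolding mob_mmul[OF Smat_SL2Z S(1) z] jfac_mmul[OF Smat_SL2Z S(1) z] mob_Smat jfac_Smat
        inversion[OF mob_UHP[OF S(1) z]] QD[OF S(2) z] by (simp add: power_mult_distrib)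
    then show ?case by (simp add: Q_def)
  next
    case (T \<gamma>)
    have "eta_pow 1 (mob (mmul Tmat \<gamma>) z) = jfac (mmul Tmat \<gamma>) z ^ 12 * eta_pow 1 z" if z: "Im z > 0" for z
      unfolding mob_mmul[OF Tmat_SL2Z T(1) z] jfac_mmul[OF Tmat_SL2Z T(1) z] mob_Tmat jfac_Tmat
        translation QD[OF T(2) z] by simp
    then show ?case by (simp add: Q_def)
  next
    case (Tinv \<gamma>)
    have "eta_pow 1 (mob \<gamma> z) = jfac \<gamma> z ^ 12 * eta_pow 1 z" if z: "Im z > 0" for z
      using QD[OF Tinv(2) z]
      unfolding mob_mmul[OF Tmat_SL2Z Tinv(1) z] jfac_mmul[OF Tmat_SL2Z Tinv(1) z] mob_Tmat jfac_Tmat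
        translation by simp
    then show ?case by (simp add: Q_def)
  qed
  then have "eta_pow 1 (mob \<gamma> z) = jfac \<gamma> z ^ 12 * eta_pow 1 z" if "\<gamma> \<in> SL2Z" "Im z > 0" for \<gamma> z
    using that QD by blast
  then show ?thesis by (intro modformsI[OF _ Disc_qexp]) (auto simp: Disc_def mob_UHP)
qed

text \<open>\<open>Disc\<close> has no zeros on the upper half-plane and only a simple one at the
  cusp, which the vanishing constant term of \<open>f\<close> compensates.\<close>

lemma modforms_divide_Disc:
  assumes f: "f \<in> modforms j" "qexp 0 u f" "u 0 = 0"
  shows "(\<lambda>z. f z / Disc z) \<in> modforms (j - 12)"
proof -
  define v where "v = (\<lambda>q. if q = 0 then deriv u 0 else (u q - u 0) / (q - 0))"
  have hol: "v holomorphic_on ball 0 1"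
    unfolding v_def by (rule pole_lemma_open[OF qexpD(1)[OF f(2)] open_ball])
  have v: "u q = q * v q" if "q \<noteq> 0" for q
    using that f(3) by (simp add: v_def)
  have "f z / Disc z = v (qpar z) / exp (24 * log_euler (qpar z))" if "Im z > 0" for z
    using that qexp0D[OF f(2) that] v[OF qpar_nonzero, of z]
    by (simp add: Disc_def eta_pow_def) (simp add: qpar_def)
  then have "qexp 0 (\<lambda>q. v q / exp (24 * log_euler q)) (\<lambda>z. f z / Disc z)"
    unfolding qexp_def using hol log_euler_holomorphic by (auto intro!: holomorphic_intros)
  then show ?thesis
    by (rule modformsI[rotated])
      (auto simp: modforms_outside[OF f(1)] modforms_mob[OF f(1)] modforms_mob[OF Disc_modform]
        power_int_diff jfac_nonzero)
qed

text \<open>The 12th power of \<open>f\<close> times the power \<open>- j\<close> of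
  \<open>Disc\<close> has weight 0. It vanishes at the cusp since at least one factor
  \<open>Disc\<close> is present, so it is zero, while \<open>Disc\<close> is not.\<close>

lemma modforms_negative:
  assumes f: "f \<in> modforms j" and "j < 0"
  shows "f z = 0"
proof (cases "Im z > 0")
  case z: True
  define n where "n = nat (- j)"
  define h where "h = (\<lambda>z. (if Im z > 0 then f z ^ 12 else 0) * (if Im z > 0 then Disc z ^ n else 0))"
  have "h \<in> modforms (int 12 * j + int n * 12)"
    unfolding h_def by (intro modforms_mult modforms_power f Disc_modform)
  then have h: "h \<in> modforms 0" using \<open>j < 0\<close> by (simp add: n_def)
  obtain u where u: "qexp 0 u f" using f modforms_qexp by metis
  obtain v where v: "qexp 0 v Disc" "v 0 = 0" using Disc_qexp by force
  have "qexp 0 (\<lambda>q. u q ^ 12 * v q ^ n) h"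
    by (rule qexp_cong[OF qexp_mult0[OF qexp_power[OF u] qexp_power[OF v(1)]]]) (simp add: h_def)
  then have "h z = 0"
    by (rule modforms_0_cusp_zero[OF h]) (use v(2) \<open>j < 0\<close> in \<open>simp add: n_def\<close>)
  then show ?thesis using Disc_nonzero[OF z] z by (simp add: h_def)
qed (use modforms_outside[OF f] in auto)

text \<open>A basis indexed below \<open>n\<close>. Coefficients from index \<open>n\<close> on are
  unconstrained, which makes it easy to append a form. Independence is tested on the upper
  half-plane, where quotients by \<open>Disc\<close> make sense.\<close>

definition modforms_dim :: "int \<Rightarrow> nat \<Rightarrow> bool" where
  "modforms_dim j n \<longleftrightarrow> (\<exists>B. (\<forall>i<n. B i \<in> modforms j) \<and>
     (\<forall>f\<in>modforms j. \<exists>c. \<forall>z. f z = (\<Sum>i<n. c i * B i z)) \<and>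
     (\<forall>c. (\<forall>z. Im z > 0 \<longrightarrow> (\<Sum>i<n. c i * B i z) = 0) \<longrightarrow> (\<forall>i<n. c i = 0)))"

lemma modforms_dim_negative: "j < 0 \<Longrightarrow> modforms_dim j 0"
  using modforms_negative by (simp add: modforms_dim_def)

text \<open>The constant term of such a form vanishes, so division by \<open>Disc\<close> leads to
  weight -10.\<close>

lemma modforms_dim_2: "modforms_dim 2 0"
proof -
  have "f z = 0" if f: "f \<in> modforms 2" for f z
  proof (cases "Im z > 0")
    case True
    obtain u where u: "qexp 0 u f" using f modforms_qexp by metis
    have "(\<lambda>z. f z / Disc z) \<in> modforms (2 - 12)"
      by (rule modforms_divide_Disc[OF f u modforms_2_cusp[OF f u]])
    then have "f z / Disc z = 0" by (rule modforms_negative) simp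
    then show ?thesis using Disc_nonzero[OF True] by simp
  qed (use modforms_outside[OF f] in auto)
  then show ?thesis by (simp add: modforms_dim_def)
qed

text \<open>Every form is a multiple of \<open>E\<close> plus \<open>Disc\<close> times a form of
  weight \<open>j - 12\<close>: subtract the constant term times \<open>E\<close> and
  divide.\<close>

lemma modforms_dim_step:
  assumes dim: "modforms_dim (j - 12) n"
    and E: "E \<in> modforms j" "qexp 0 e E" "e 0 = 1"
  shows "modforms_dim j (Suc n)"
proof -
  obtain B where B: "\<forall>i<n. B i \<in> modforms (j - 12)"
    and span: "\<forall>f\<in>modforms (j - 12). \<exists>c. \<forall>z. f z = (\<Sum>i<n. c i * B i z)"
    and indep: "\<forall>c. (\<forall>z. Im z > 0 \<longrightarrow> (\<Sum>i<n. c i * B i z) = 0) \<longrightarrow> (\<forall>i<n. c i = 0)"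
    using dim unfolding modforms_dim_def by (elim exE conjE)
  define B' where "B' = (\<lambda>i. if i < n then (\<lambda>z. Disc z * B i z) else E)"
  have sum_B': "(\<Sum>i<Suc n. c i * B' i z) = Disc z * (\<Sum>i<n. c i * B i z) + c n * E z" for c z
  proof -
    have "(\<Sum>i<n. c i * B' i z) = (\<Sum>i<n. Disc z * (c i * B i z))"
      by (intro sum.cong) (auto simp: B'_def)
    then show ?thesis by (simp add: sum_distrib_left B'_def)
  qed
  have "B' i \<in> modforms j" for i
    using modforms_mult[OF Disc_modform B[rule_format, of i]] E(1) by (simp add: B'_def)
  moreover have "\<exists>c. \<forall>z. f z = (\<Sum>i<Suc n. c i * B' i z)" if f: "f \<in> modforms j" for f
  proof -
    obtain u where u: "qexp 0 u f" using f modforms_qexp by metis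
    define a where "a = u 0"
    define g where "g = (\<lambda>z. f z - a * E z)"
    have g: "g \<in> modforms j" unfolding g_def by (intro modforms_diff modforms_cmult f E)
    have gq: "qexp 0 (\<lambda>q. u q + (- a) * e q) g"
      using qexp_add[OF u qexp_cmult[OF E(2), of "- a"]] by (simp add: g_def)
    have div: "(\<lambda>z. g z / Disc z) \<in> modforms (j - 12)"
      by (rule modforms_divide_Disc[OF g gq]) (simp add: a_def E(3))
    then obtain c where c: "\<forall>z. g z / Disc z = (\<Sum>i<n. c i * B i z)"
      using bspec[OF span div] by (elim exE)
    have "f z = (\<Sum>i<Suc n. (c(n := a)) i * B' i z)" for z
    proof (cases "Im z > 0")
      case True
      have "(\<Sum>i<n. (c(n := a)) i * B i z) = g z / Disc z"
        unfolding c[rule_format] by (intro sum.cong) auto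
      then show ?thesis unfolding sum_B' using Disc_nonzero[OF True] by (simp add: g_def)
    next
      case False
      then show ?thesis
        unfolding sum_B' using modforms_outside[OF f] modforms_outside[OF E(1)] by (simp add: Disc_def)
    qed
    then show ?thesis by (intro exI allI)
  qed
  moreover have "\<forall>i<Suc n. c i = 0" if c: "\<And>z. Im z > 0 \<Longrightarrow> (\<Sum>i<Suc n. c i * B' i z) = 0" for c
  proof -
    define g where "g = (\<lambda>z. \<Sum>i<n. c i * B i z)"
    have "g \<in> modforms (j - 12)" unfolding g_def by (intro modforms_sum B[rule_format])
    then obtain v where v: "qexp 0 v g" using modforms_qexp by blast
    have sum0: "Disc z * g z + c n * E z = 0" if "Im z > 0" for z
      using c[OF that] unfolding sum_B' g_def .
    \<comment> \<open>Two expansions of the same function, one of them zero; at \<open>q = 0\<close>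
      only \<open>c n\<close> survives.\<close>
    have "qexp 0 (\<lambda>q. q * exp (24 * log_euler q) * v q + c n * e q) (\<lambda>z. Disc z * g z + c n * E z)"
      by (intro qexp_add qexp_mult0 qexp_cmult Disc_qexp v E)
    moreover have "qexp 0 (\<lambda>_. 0) (\<lambda>z. Disc z * g z + c n * E z)"
      by (rule qexp_cong[OF qexp_const]) (simp add: sum0)
    ultimately have "0 * exp (24 * log_euler 0) * v 0 + c n * e 0 = 0"
      by (rule qexp_unique) simp
    then have cn: "c n = 0" by (simp add: E(3))
    have "g z = 0" if "Im z > 0" for z using sum0[OF that] cn Disc_nonzero[OF that] by simp
    then have "\<forall>i<n. c i = 0" using indep[rule_format, of c] by (simp add: g_def)
    then show ?thesis using cn less_Suc_eq by auto
  qed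
  ultimately show ?thesis
    unfolding modforms_dim_def by (intro exI[of _ B'] conjI ballI allI impI) simp_all
qed

text \<open>Multiplication by \<open>Disc\<close> raises \<open>k\<close> by 6. For
  \<open>k < 6\<close> the step starts from a negative weight and yields dimension 1, apart from the
  gap at \<open>k = 1\<close>.\<close>

lemma modforms_dim_even: "modforms_dim (2 * int k) (if k mod 6 = 1 then k div 6 else k div 6 + 1)"
proof (induction k rule: less_induct)
  case (less k)
  show ?case
  proof (cases "k = 1")
    case True
    then show ?thesis using modforms_dim_2 by simp
  next
    case False
    then obtain E e where E: "E \<in> modforms (2 * int k)" "qexp 0 e E" "e 0 = 1"
      using modforms_const_term_1 by blast
    show ?thesis
    proof (cases "k < 6")
      case True
      then have "modforms_dim (2 * int k - 12) 0" by (intro modforms_dim_negative) auto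
      from modforms_dim_step[OF this E] show ?thesis using True False by simp
    next
      case False
      then have k6: "6 \<le> k" by simp
      then have "2 * int (k - 6) = 2 * int k - 12" by auto
      with less.IH[of "k - 6"] k6
      have "modforms_dim (2 * int k - 12) (if (k - 6) mod 6 = 1 then (k - 6) div 6 else (k - 6) div 6 + 1)"
        by simp
      moreover have "(if k mod 6 = 1 then k div 6 else k div 6 + 1)
          = Suc (if (k - 6) mod 6 = 1 then (k - 6) div 6 else (k - 6) div 6 + 1)"
        using k6 by (simp add: le_mod_geq le_div_geq)
      ultimately show ?thesis using modforms_dim_step[OF _ E] by simp
    qed
  qed
qed

end

section \<open>Two-dimensional linear algebra\<close>

text \<open>The determinant with columns \<open>u\<close> and \<open>v\<close>. With one argument
  fixed it serves as a linear coordinate functional.\<close>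

definition cr :: "complex^2 \<Rightarrow> complex^2 \<Rightarrow> complex" where
  "cr u v = u $ 1 * v $ 2 - u $ 2 * v $ 1"

lemma matrix_vector_2: "((A::complex^2^2) *v x) $ i = A $ i $ 1 * x $ 1 + A $ i $ 2 * x $ 2"
  by (simp add: matrix_vector_mult_def sum_2)

lemma cr_self [simp]: "cr u u = 0"
  and cr_smult_left: "cr (a *s u) v = a * cr u v"
  and cr_smult_right: "cr u (a *s v) = a * cr u v"
  and cr_add_left: "cr (u + u') v = cr u v + cr u' v"
  and cr_add_right: "cr u (v + v') = cr u v + cr u v'"
  by (simp_all add: cr_def algebra_simps)

lemma cr_mult: "cr (A *v u) (A *v v) = det A * cr u v"
  by (simp add: cr_def matrix_vector_2 det_2 algebra_simps)

text \<open>The Pluecker relation; with \<open>v1\<close>, \<open>v2\<close> a basis it recovers a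
  determinant of two vectors from their coordinates.\<close>

lemma cr_Pluecker: "cr u v * cr v1 v2 = cr u v1 * cr v v2 - cr u v2 * cr v v1"
  by (simp add: cr_def algebra_simps)

lemma cr_component: "u $ i * cr v1 v2 = cr u v2 * v1 $ i - cr u v1 * v2 $ i"
  using exhaust_2[of i] by (auto simp: cr_def algebra_simps)

lemma cr_eq_0_imp:
  assumes "cr u v = 0" "u \<noteq> 0"
  obtains t where "v = t *s u"
proof -
  obtain i where i: "u $ i \<noteq> 0" using assms(2) by (auto simp: vec_eq_iff)
  have "u $ i * v $ j = u $ j * v $ i" for j
    using assms(1) exhaust_2[of i] exhaust_2[of j] by (elim disjE) (simp_all add: cr_def)
  then have "v $ j = (v $ i / u $ i) * u $ j" for j
    using i by (simp add: eq_divide_eq mult.commute)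
  then have "v = (v $ i / u $ i) *s u"
    unfolding vec_eq_iff vector_smult_component by (intro allI)
  then show ?thesis by (rule that)
qed

lemma mat_mult_vector: "mat e *v (v::complex^2) = e *s v"
  unfolding vec_eq_iff forall_2 matrix_vector_2 by (simp add: mat_def)

lemma eigenvector_exists:
  fixes A :: "complex^2^2"
  assumes "det (mat e - A) = 0"
  obtains v where "v \<noteq> 0" "A *v v = e *s v"
proof -
  have "\<not> invertible (mat e - A)" using assms by (simp add: invertible_det_nz)
  then obtain v where v: "v \<noteq> 0" "(mat e - A) *v v = 0"
    by (auto simp: invertible_left_inverse matrix_left_invertible_ker)
  then have "A *v v = e *s v" by (simp add: matrix_vector_mult_diff_rdistrib mat_mult_vector)
  then show ?thesis using that v(1) by blast
qed

text \<open>Every entry of a unitary matrix has modulus at most 1, so a trace of modulus 2 forces the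
  diagonal entries to agree and the off-diagonal ones to vanish.\<close>

lemma unitary_double_eigenvalue:
  fixes U :: "complex^2^2"
  assumes U: "unitary_mat U" and e: "norm e = 1"
    and eig: "\<And>x. det (mat x - U) = (x - e) * (x - e)"
  shows "U = mat e"
proof -
  have d: "(x - U$1$1) * (x - U$2$2) - U$1$2 * U$2$1 = (x - e) * (x - e)" for x
    using eig[of x] by (simp add: det_2 mat_def)
  define \<delta> where "\<delta> = U$1$1 - e"
  have "U$1$1 + U$2$2 = 2 * e" using d[of 0] d[of 1] by (simp add: algebra_simps)
  then have a: "U$1$1 = e + \<delta>" "U$2$2 = e - \<delta>" by (simp_all add: \<delta>_def algebra_simps)
  have row: "(norm (U$i$1))\<^sup>2 + (norm (U$i$2))\<^sup>2 = 1" for i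
  proof -
    have "(\<Sum>k\<in>UNIV. U$i$k * cnj (U$i$k)) = 1" using U by (simp add: unitary_mat_def)
    then have "complex_of_real ((norm (U$i$1))\<^sup>2 + (norm (U$i$2))\<^sup>2) = 1"
      by (simp only: sum_2 of_real_add complex_norm_square)
    then show ?thesis using of_real_eq_1_iff by blast
  qed
  \<comment> \<open>The parallelogram law. The two unit rows have total squared length 2, so nothing
    is left for \<open>\<delta>\<close> and the off-diagonal entries.\<close>
  have par: "(norm (e + \<delta>))\<^sup>2 + (norm (e - \<delta>))\<^sup>2 = 2 + 2 * (norm \<delta>)\<^sup>2"
  proof -
    have "(norm (e + \<delta>))\<^sup>2 + (norm (e - \<delta>))\<^sup>2 = 2 * (norm e)\<^sup>2 + 2 * (norm \<delta>)\<^sup>2"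
      unfolding power2_norm_eq_inner
      by (simp add: inner_add_left inner_add_right inner_diff_left inner_diff_right inner_commute)
    then show ?thesis using e by simp
  qed
  have "(norm (e + \<delta>))\<^sup>2 + (norm (U$1$2))\<^sup>2 = 1" "(norm (U$2$1))\<^sup>2 + (norm (e - \<delta>))\<^sup>2 = 1"
    using row[of 1] row[of 2] a by simp_all
  then have "(norm \<delta>)\<^sup>2 = 0 \<and> (norm (U$1$2))\<^sup>2 = 0 \<and> (norm (U$2$1))\<^sup>2 = 0"
    using par zero_le_power2[of "norm \<delta>"] zero_le_power2[of "norm (U$1$2)"] zero_le_power2[of "norm (U$2$1)"]
    by (intro conjI) linarith+
  then have z: "\<delta> = 0" "U$1$2 = 0" "U$2$1 = 0" by simp_all
  have "U $ i $ j = mat e $ i $ j" for i j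
    using exhaust_2[of i] exhaust_2[of j] a z by (auto simp: mat_def)
  then show ?thesis by (simp add: vec_eq_iff)
qed

text \<open>Distinct eigenvalues give independent eigenvectors. For a double eigenvalue the unitary
  conjugate is scalar, hence so is \<open>A\<close>, and any basis works; this excludes a Jordan
  block.\<close>

lemma eigenbasis_unitarizable:
  fixes A P U :: "complex^2^2"
  assumes P: "invertible P" and U: "unitary_mat U" and AP: "A ** P = P ** U"
    and e: "norm e1 = 1" and eig: "\<And>x. det (mat x - A) = (x - e1) * (x - e2)"
  obtains v1 v2 where "cr v1 v2 \<noteq> 0" "A *v v1 = e1 *s v1" "A *v v2 = e2 *s v2"
proof (cases "e1 = e2")
  case False
  obtain v1 where v1: "v1 \<noteq> 0" "A *v v1 = e1 *s v1"
    by (rule eigenvector_exists[of e1 A]) (auto simp: eig)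
  obtain v2 where v2: "v2 \<noteq> 0" "A *v v2 = e2 *s v2"
    by (rule eigenvector_exists[of e2 A]) (auto simp: eig)
  have "cr v1 v2 \<noteq> 0"
  proof
    assume "cr v1 v2 = 0"
    then obtain t where t: "v2 = t *s v1" using cr_eq_0_imp v1(1) by blast
    have "A *v v2 = t *s (A *v v1)" unfolding t by (simp add: vec_eq_iff matrix_vector_2 algebra_simps)
    then have "e2 *s v2 = t *s (e1 *s v1)" using v1(2) v2(2) by simp
    also have "\<dots> = e1 *s v2" unfolding t by (simp add: mult.commute)
    finally have "e2 *s v2 = e1 *s v2" .
    then have "(e2 - e1) *s v2 = 0" by (simp add: vec_eq_iff algebra_simps)
    then show False using False v2(1) by (simp add: vec_eq_iff)
  qed
  then show ?thesis using that v1 v2 by blast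
next
  case True
  have "det (mat x - U) = (x - e1) * (x - e1)" for x
  proof -
    have "(mat x - A) ** P = P ** (mat x - U)"
    proof -
      have c: "mat x ** P = P ** mat x" by (simp add: vec_eq_iff matrix_matrix_mult_def mat_def sum_2 forall_2)
      have "(mat x - A) ** P = mat x ** P - A ** P"
        by (simp add: vec_eq_iff matrix_matrix_mult_def sum_2 algebra_simps)
      also have "\<dots> = P ** mat x - P ** U" unfolding c AP ..
      also have "\<dots> = P ** (mat x - U)"
        by (simp add: vec_eq_iff matrix_matrix_mult_def sum_2 algebra_simps)
      finally show ?thesis .
    qed
    then have "det (mat x - A) * det P = det P * det (mat x - U)" by (metis det_mul)
    then show ?thesis using P True by (simp add: invertible_det_nz eig)
  qed
  then have Ue: "U = mat e1" by (intro unitary_double_eigenvalue U e)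
  obtain P' where P': "P ** P' = mat 1" using P by (auto simp: invertible_def)
  have "A *v v = e1 *s v" for v
  proof -
    have "A *v v = (A ** P) *v (P' *v v)"
      using P' by (metis matrix_vector_mul_assoc matrix_vector_mul_lid)
    also have "\<dots> = P *v (mat e1 *v (P' *v v))" by (simp add: AP Ue matrix_vector_mul_assoc matrix_mul_assoc)
    also have "mat e1 *v (P' *v v) = e1 *s (P' *v v)" by (rule mat_mult_vector)
    also have "P *v \<dots> = e1 *s (P *v (P' *v v))" by (simp add: vec_eq_iff matrix_vector_2 algebra_simps)
    also have "P *v (P' *v v) = v" using P' by (simp add: matrix_vector_mul_assoc)
    finally show ?thesis .
  qed
  moreover have "cr (vector [1, 0]) (vector [0, 1]) \<noteq> 0" by (simp add: cr_def)
  ultimately show ?thesis using that True by blast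
qed

section \<open>The Wronskian of a second-order equation\<close>

text \<open>Abel's identity. The terms with \<open>M4\<close> cancel, and the weights
  \<open>k\<close> and \<open>k + 2\<close> of the two factors add up to
  \<open>2 * k + 2 = 12 * s\<close>.\<close>

lemma mlde2_wronskian:
  assumes f: "mlde2_solution k M4 f" and g: "mlde2_solution k M4 g" and s: "k + 1 = 6 * s"
  obtains C where "\<And>z. Im z > 0 \<Longrightarrow> f z * Dop k g z - g z * Dop k f z = C * eta_pow s z"
proof (rule eta_pow_unique[of "\<lambda>z. f z * Dop k g z - g z * Dop k f z" s])
  fix z assume z: "Im z > 0"
  have D: "(h has_field_derivative tpi * (Dop k h z - of_real k * Pfun z * h z)) (at z)
      \<and> (Dop k h has_field_derivative tpi * (- M4 z * h z - of_real (k + 2) * Pfun z * Dop k h z)) (at z)"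
    if h: "mlde2_solution k M4 h" for h
  proof -
    have hol: "h holomorphic_on UHP" using h by (simp add: mlde2_solution_def)
    have Dhol: "Dop k h holomorphic_on UHP" by (rule Dop_holomorphic[OF hol])
    have "Dop (k + 2) (Dop k h) z + M4 z * h z = 0" using h z by (simp add: mlde2_solution_def)
    then have "deriv (Dop k h) z / tpi + (of_real (k + 2) * Pfun z * Dop k h z + M4 z * h z) = 0"
      using z unfolding Dop_def[of "k + 2"] by (simp only: UHP_iff if_True add.assoc)
    then have "deriv (Dop k h) z / tpi = - M4 z * h z - of_real (k + 2) * Pfun z * Dop k h z"
      by (simp only: add_eq_0_iff2) simp
    then have "deriv (Dop k h) z = (- M4 z * h z - of_real (k + 2) * Pfun z * Dop k h z) * tpi"
      by (subst (asm) divide_eq_eq) simp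
    then have "deriv (Dop k h) z = tpi * (- M4 z * h z - of_real (k + 2) * Pfun z * Dop k h z)"
      by (simp only: mult.commute)
    moreover have "deriv h z = tpi * (Dop k h z - of_real k * Pfun z * h z)"
      using z by (simp add: Dop_def)
    ultimately show ?thesis
      using holomorphic_derivI[OF hol open_UHP] holomorphic_derivI[OF Dhol open_UHP] z by (metis UHP_iff)
  qed
  have s': "12 * complex_of_real s = 2 * of_real k + 2"
  proof -
    have "12 * s = 2 * k + 2" using s by simp
    then show ?thesis by (metis of_real_add of_real_mult of_real_numeral)
  qed
  have "((\<lambda>z. f z * Dop k g z - g z * Dop k f z) has_field_derivative
      tpi * (Dop k f z - of_real k * Pfun z * f z) * Dop k g z
      + f z * (tpi * (- M4 z * g z - of_real (k + 2) * Pfun z * Dop k g z))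
      - (tpi * (Dop k g z - of_real k * Pfun z * g z) * Dop k f z
      + g z * (tpi * (- M4 z * f z - of_real (k + 2) * Pfun z * Dop k f z)))) (at z)"
    using D[OF f] D[OF g] by (auto intro!: derivative_eq_intros)
  moreover have "tpi * (Dop k f z - of_real k * Pfun z * f z) * Dop k g z
      + f z * (tpi * (- M4 z * g z - of_real (k + 2) * Pfun z * Dop k g z))
      - (tpi * (Dop k g z - of_real k * Pfun z * g z) * Dop k f z
      + g z * (tpi * (- M4 z * f z - of_real (k + 2) * Pfun z * Dop k f z)))
    = - (12 * of_real s) * tpi * Pfun z * (f z * Dop k g z - g z * Dop k f z)"
    unfolding s' by (simp add: algebra_simps)
  ultimately show "((\<lambda>z. f z * Dop k g z - g z * Dop k f z) has_field_derivative
      - 12 * of_real s * tpi * Pfun z * (f z * Dop k g z - g z * Dop k f z)) (at z)"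
    by simp
qed (use that in blast)

text \<open>The zero function is a solution, and both \<open>(a, b)\<close> and
  \<open>(0, 0)\<close> represent it.\<close>

lemma mlde2_fundamental_independent:
  assumes "mlde2_fundamental_system k M4 f g" "\<And>z. Im z > 0 \<Longrightarrow> a * f z + b * g z = 0"
  shows "a = 0 \<and> b = 0"
proof -
  have D0: "Dop l (\<lambda>_. 0) = (\<lambda>_. 0)" for l by (auto simp: Dop_def)
  have "mlde2_solution k M4 (\<lambda>_. 0)" unfolding mlde2_solution_def D0 by simp
  then have "\<exists>!(a, b). \<forall>z\<in>UHP. (0::complex) = a * f z + b * g z"
    using assms(1) unfolding mlde2_fundamental_system_def by blast
  then have "\<exists>!p. \<forall>z\<in>UHP. (0::complex) = fst p * f z + snd p * g z"
    unfolding case_prod_beta .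
  moreover have "\<forall>z\<in>UHP. (0::complex) = fst (a, b) * f z + snd (a, b) * g z"
    using assms(2) by simp
  moreover have "\<forall>z\<in>UHP. (0::complex) = fst (0, 0) * f z + snd (0, 0) * g z" by simp
  ultimately have "(a, b) = (0, 0)" by (metis (no_types, lifting))
  then show ?thesis by simp
qed

text \<open>If the Wronskian vanished identically, \<open>g / f\<close> would be constant near a
  point where \<open>f\<close> is nonzero, and continuation would make the two solutions
  dependent.\<close>

lemma mlde2_wronskian_nonzero:
  assumes sys: "mlde2_fundamental_system k M4 f g"
  shows "\<exists>z. Im z > 0 \<and> f z * Dop k g z - g z * Dop k f z \<noteq> 0"
proof (rule ccontr)
  assume "\<not> ?thesis"
  then have W: "f z * Dop k g z = g z * Dop k f z" if "Im z > 0" for z using that by auto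
  have f: "f holomorphic_on UHP" and g: "g holomorphic_on UHP"
    using sys by (simp_all add: mlde2_fundamental_system_def mlde2_solution_def)
  obtain z0 where z0: "Im z0 > 0" "f z0 \<noteq> 0"
    using mlde2_fundamental_independent[OF sys, of 1 0] by auto
  have "continuous_on UHP f" using f by (rule holomorphic_on_imp_continuous_on)
  then have "open (UHP \<inter> f -` (- {0}))"
    by (intro continuous_open_preimage open_UHP) auto
  then obtain d where d: "d > 0" "ball z0 d \<subseteq> UHP \<inter> f -` (- {0})"
    using z0 by (metis IntI UHP_iff open_contains_ball vimageI ComplI singletonD)
  have "\<exists>c. \<forall>z\<in>ball z0 d. g z / f z = c"
  proof (rule has_field_derivative_zero_constant[OF convex_ball])
    fix z assume zb: "z \<in> ball z0 d"
    then have z: "Im z > 0" "f z \<noteq> 0" using d by auto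
    have df: "(f has_field_derivative deriv f z) (at z)" and dg: "(g has_field_derivative deriv g z) (at z)"
      using holomorphic_derivI[OF f open_UHP] holomorphic_derivI[OF g open_UHP] z by auto
    have "f z * (deriv g z / tpi) = g z * (deriv f z / tpi)"
      using W[OF z(1)] z(1) by (simp add: Dop_def algebra_simps)
    then have "f z * deriv g z = g z * deriv f z" by (simp add: field_simps)
    then have "((\<lambda>z. g z / f z) has_field_derivative 0) (at z)"
      using DERIV_divide[OF dg df z(2)] by (simp add: algebra_simps)
    then show "((\<lambda>z. g z / f z) has_field_derivative 0) (at z within ball z0 d)"
      by (rule has_field_derivative_at_within)
  qed
  then obtain c where c: "\<And>z. z \<in> ball z0 d \<Longrightarrow> g z / f z = c" by blast
  have "c * f z + (-1) * g z = 0" if "Im z > 0" for z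
  proof (rule analytic_continuation[where f = "\<lambda>z. c * f z + (-1) * g z" and S = UHP and U = "ball z0 d" and \<xi> = z0])
    show "(\<lambda>z. c * f z + (-1) * g z) holomorphic_on UHP" by (intro holomorphic_intros f g)
    show "z0 islimpt ball z0 d" using d(1) by (simp add: islimpt_ball)
    show "c * f w + (-1) * g w = 0" if "w \<in> ball z0 d" for w
    proof -
      have "f w \<noteq> 0" using d(2) that by auto
      then have "g w = c * f w" using c[OF that] by (simp add: divide_eq_eq)
      then show ?thesis by simp
    qed
  qed (use d z0 that open_UHP connected_UHP in auto)
  from mlde2_fundamental_independent[OF sys this] show False by simp
qed

section \<open>Vector-valued modular forms\<close>

lemma
  assumes "F \<in> vvmf k \<rho> \<upsilon>"
  shows vvmf_outside: "\<not> Im z > 0 \<Longrightarrow> F z = 0"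
    and vvmf_holomorphic: "(\<lambda>z. F z $ i) holomorphic_on UHP"
    and vvmf_moderate: "moderate_growth (\<lambda>z. F z $ i)"
    and vvmf_slash: "\<gamma> \<in> SL2Z \<Longrightarrow> Im z > 0 \<Longrightarrow> slash k \<upsilon> \<gamma> F z = \<rho> \<gamma> *v F z"
proof -
  have 1: "\<forall>z. z \<notin> UHP \<longrightarrow> F z = 0"
    using assms unfolding vvmf_def mem_Collect_eq by (elim conjE)
  have 2: "\<forall>i. (\<lambda>z. F z $ i) holomorphic_on UHP \<and> moderate_growth (\<lambda>z. F z $ i)"
    using assms unfolding vvmf_def mem_Collect_eq by (elim conjE)
  have 3: "\<forall>\<gamma>\<in>SL2Z. \<forall>z\<in>UHP. slash k \<upsilon> \<gamma> F z = \<rho> \<gamma> *v F z"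
    using assms unfolding vvmf_def mem_Collect_eq by (elim conjE)
  show "\<not> Im z > 0 \<Longrightarrow> F z = 0" using 1 by simp
  show "(\<lambda>z. F z $ i) holomorphic_on UHP" "moderate_growth (\<lambda>z. F z $ i)" using 2 by blast+
  show "slash k \<upsilon> \<gamma> F z = \<rho> \<gamma> *v F z" if "\<gamma> \<in> SL2Z" "Im z > 0"
    using bspec[OF bspec[OF 3 that(1)]] that(2) by simp
qed

lemma vvmf_mob:
  assumes F: "F \<in> vvmf k \<rho> \<upsilon>" and \<gamma>: "\<gamma> \<in> SL2Z" "\<upsilon> \<gamma> \<noteq> 0" and z: "Im z > 0"
  shows "F (mob \<gamma> z) = (\<upsilon> \<gamma> * jfac \<gamma> z powr of_real k) *s (\<rho> \<gamma> *v F z)"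
proof -
  have "\<upsilon> \<gamma> * jfac \<gamma> z powr of_real k * (inverse (\<upsilon> \<gamma>) * inverse (jfac \<gamma> z powr of_real k)) = 1"
    using \<gamma>(2) jfac_nonzero[OF \<gamma>(1) z] by (simp add: field_simps)
  then show ?thesis
    by (simp only: vvmf_slash[OF F \<gamma>(1) z, symmetric] slash_def vector_smult_assoc vector_smult_lid)
qed

lemma vvmfI:
  assumes out: "\<And>z. \<not> Im z > 0 \<Longrightarrow> F z = 0"
    and hol: "\<And>i. (\<lambda>z. F z $ i) holomorphic_on UHP"
    and bd: "\<And>i. bounded_at_cusp (\<lambda>z. F z $ i)"
    and \<upsilon>: "\<And>\<gamma>. \<gamma> \<in> SL2Z \<Longrightarrow> \<upsilon> \<gamma> \<noteq> 0"
    and mob: "\<And>\<gamma> z. \<gamma> \<in> SL2Z \<Longrightarrow> Im z > 0 \<Longrightarrow>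
      F (mob \<gamma> z) = (\<upsilon> \<gamma> * jfac \<gamma> z powr of_real k) *s (\<rho> \<gamma> *v F z)"
  shows "F \<in> vvmf k \<rho> \<upsilon>"
proof -
  have "slash k \<upsilon> \<gamma> F z = \<rho> \<gamma> *v F z" if "\<gamma> \<in> SL2Z" "Im z > 0" for \<gamma> z
  proof -
    have "inverse (\<upsilon> \<gamma>) * inverse (jfac \<gamma> z powr of_real k) * (\<upsilon> \<gamma> * jfac \<gamma> z powr of_real k) = 1"
      using \<upsilon>[OF that(1)] jfac_nonzero[OF that] by (simp add: field_simps)
    then show ?thesis
      by (simp only: slash_def mob[OF that] vector_smult_assoc vector_smult_lid)
  qed
  then show ?thesis
    unfolding vvmf_def mem_Collect_eq UHP_iff
    by (intro conjI allI impI ballI out hol bounded_at_cusp_moderate[OF bd]) simp_all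
qed

lemma powr_add_int:
  fixes z :: complex
  assumes "z \<noteq> 0"
  shows "z powr of_real (k + of_int n) = z powr of_real k * z powi n"
  using assms complex_powr_of_int[of z n] by (simp add: powr_add)

text \<open>For \<open>c \<noteq> 0\<close> the number \<open>jfac \<gamma> z\<close> is not real
  and stays off the branch cut. For \<open>c = 0\<close> it may lie on the cut, but it is
  constant.\<close>

lemma jfac_powr_has_derivative:
  assumes \<gamma>: "\<gamma> \<in> SL2Z" and z: "Im z > 0"
  shows "((\<lambda>w. jfac \<gamma> w powr of_real k) has_field_derivative
    of_real k * of_int (lower_left \<gamma>) / jfac \<gamma> z * jfac \<gamma> z powr of_real k) (at z)"
proof -
  obtain a b c d where g: "\<gamma> = (a, b, c, d)" using prod_cases4 by blast
  show ?thesis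
  proof (cases "c = 0")
    case True
    then show ?thesis by (simp add: g)
  next
    case False
    then have "jfac \<gamma> z \<notin> \<real>\<^sub>\<le>\<^sub>0" using z by (auto simp: g complex_nonpos_Reals_iff)
    then have "((\<lambda>w. jfac \<gamma> w powr of_real k) has_field_derivative
        of_real k * jfac \<gamma> z powr (of_real k - 1) * of_int (lower_left \<gamma>)) (at z)"
      by (rule DERIV_chain2[where g = "jfac \<gamma>", OF has_field_derivative_powr jfac_has_derivative])
    then show ?thesis using jfac_nonzero[OF \<gamma> z] by (simp add: powr_diff mult_ac)
  qed
qed

lemma cr_Dvec:
  assumes "\<And>i. (\<lambda>z. F z $ i) holomorphic_on UHP"
  shows "cr (Dvec k F z) v = Dop k (\<lambda>z. cr (F z) v) z"
proof -
  have "(\<lambda>z. cr (F z) v) = (\<lambda>z. v $ 2 * F z $ 1 + (- v $ 1) * F z $ 2)"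
    by (auto simp: cr_def)
  then have "Dop k (\<lambda>z. cr (F z) v) z = v $ 2 * Dop k (\<lambda>z. F z $ 1) z + (- v $ 1) * Dop k (\<lambda>z. F z $ 2) z"
    by (simp only: Dop_linear[OF assms assms])
  then show ?thesis by (simp add: cr_def Dvec_def)
qed

text \<open>Pairing with an eigenvector of \<open>\<rho>(T)\<close> picks out the component belonging to the other eigenvalue.\<close>

lemma vvmf_coordinate_qexp:
  assumes F: "F \<in> vvmf k \<rho> \<upsilon>" and \<upsilon>: "\<upsilon> Tmat = ee s"
    and v: "\<rho> Tmat *v v = e' *s v" and det: "det (\<rho> Tmat) = ee r * e'" and e': "e' \<noteq> 0"
  shows "\<exists>u. qexp (frac (r + s)) u (\<lambda>z. cr (F z) v)"
proof (rule qexp_exists)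
  have lin: "(\<lambda>z. cr (F z) v) = (\<lambda>z. v $ 2 * F z $ 1 + (- v $ 1) * F z $ 2)"
    by (auto simp: cr_def)
  show "(\<lambda>z. cr (F z) v) holomorphic_on UHP"
    unfolding lin by (intro holomorphic_intros vvmf_holomorphic[OF F])
  show "moderate_growth (\<lambda>z. cr (F z) v)"
    unfolding lin by (intro moderate_growth_add moderate_growth_cmult vvmf_moderate[OF F])
  have ee_add: "ee (x + y) = ee x * ee y" for x y
    by (simp add: ee_def ring_distribs exp_add)
  have "ee (of_int n) = 1" for n
    using exp_integer_2pi[of "of_int n"] by (simp add: ee_def mult_ac)
  then have "ee (frac x) = ee x" for x
    using ee_add[of "frac x" "of_int \<lfloor>x\<rfloor>"] by (simp add: frac_def)
  then have frac: "ee (frac (r + s)) = ee r * ee s" by (simp add: ee_add)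
  have "\<upsilon> Tmat \<noteq> 0" by (simp add: \<upsilon> ee_def)
  show "cr (F (z + 1)) v = ee (frac (r + s)) * cr (F z) v" if "Im z > 0" for z
  proof -
    have T: "F (z + 1) = ee s *s (\<rho> Tmat *v F z)"
      using vvmf_mob[OF F Tmat_SL2Z \<open>\<upsilon> Tmat \<noteq> 0\<close> that] by (simp add: \<upsilon>)
    \<comment> \<open>Applying \<rho>(T) to both arguments multiplies the pairing by the determinant
      \<open>ee r * e'\<close>, and the eigenvector accounts for the factor
      \<open>e'\<close>.\<close>
    have "e' * cr (\<rho> Tmat *v F z) v = cr (\<rho> Tmat *v F z) (\<rho> Tmat *v v)"
      by (simp add: v cr_smult_right)
    also have "\<dots> = ee r * e' * cr (F z) v" by (simp add: cr_mult det)
    finally have "cr (\<rho> Tmat *v F z) v = ee r * cr (F z) v" using e' by simp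
    then show ?thesis by (simp add: T cr_smult_left frac)
  qed
qed (simp_all add: frac_lt_1)

text \<open>The terms with the derivative of \<open>\<phi>\<close> cancel, so plain derivatives
  suffice and the law of \<open>P\<close> is not presupposed. That law is derived from this
  one.\<close>

lemma wronskian_mob:
  assumes \<gamma>: "\<gamma> \<in> SL2Z" and z: "Im z > 0"
    and f: "f1 holomorphic_on UHP" "f2 holomorphic_on UHP"
    and g: "g1 holomorphic_on UHP" "g2 holomorphic_on UHP"
    and \<phi>: "(\<phi> has_field_derivative \<phi>') (at z)"
    and fg: "\<And>w. Im w > 0 \<Longrightarrow> f1 (mob \<gamma> w) = \<phi> w * g1 w" "\<And>w. Im w > 0 \<Longrightarrow> f2 (mob \<gamma> w) = \<phi> w * g2 w"
  shows "f1 (mob \<gamma> z) * deriv f2 (mob \<gamma> z) - f2 (mob \<gamma> z) * deriv f1 (mob \<gamma> z)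
    = (jfac \<gamma> z)\<^sup>2 * (\<phi> z)\<^sup>2 * (g1 z * deriv g2 z - g2 z * deriv g1 z)"
proof -
  define J where "J = jfac \<gamma> z"
  have J: "J \<noteq> 0" unfolding J_def by (rule jfac_nonzero[OF \<gamma> z])
  have D: "deriv f (mob \<gamma> z) = J\<^sup>2 * (\<phi>' * g z + deriv g z * \<phi> z)"
    if f: "f holomorphic_on UHP" and g: "g holomorphic_on UHP"
      and fg: "\<And>w. Im w > 0 \<Longrightarrow> f (mob \<gamma> w) = \<phi> w * g w" for f g
  proof -
    have "(f has_field_derivative deriv f (mob \<gamma> z)) (at (mob \<gamma> z))"
      using holomorphic_derivI[OF f open_UHP] mob_UHP[OF \<gamma> z] by simp
    then have "((\<lambda>z. f (mob \<gamma> z)) has_field_derivative deriv f (mob \<gamma> z) * (1 / J\<^sup>2)) (at z)"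
      unfolding J_def by (rule DERIV_chain2[where g = "mob \<gamma>"]) (rule mob_has_derivative[OF \<gamma> z])
    moreover have "((\<lambda>z. \<phi> z * g z) has_field_derivative \<phi>' * g z + deriv g z * \<phi> z) (at z)"
      using DERIV_mult[OF \<phi> holomorphic_derivI[OF g open_UHP]] z by simp
    then have "((\<lambda>z. f (mob \<gamma> z)) has_field_derivative \<phi>' * g z + deriv g z * \<phi> z) (at z)"
      by (rule has_field_derivative_transform_within_open[OF _ open_UHP]) (use z fg in auto)
    ultimately have "deriv f (mob \<gamma> z) * (1 / J\<^sup>2) = \<phi>' * g z + deriv g z * \<phi> z"
      by (rule DERIV_unique)
    then show ?thesis using J by (simp add: field_simps)
  qed
  have D1: "deriv f1 (mob \<gamma> z) = J\<^sup>2 * (\<phi>' * g1 z + deriv g1 z * \<phi> z)"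
    by (intro D f g fg)
  have D2: "deriv f2 (mob \<gamma> z) = J\<^sup>2 * (\<phi>' * g2 z + deriv g2 z * \<phi> z)"
    by (intro D f g fg)
  show ?thesis
    unfolding D1 D2 fg(1)[OF z] fg(2)[OF z] J_def [symmetric]
    by (simp add: algebra_simps power2_eq_square)
qed

text \<open>The parameter \<open>s\<close> stands for \<open>m / 12\<close>. The eigenbasis is part
  of the data, so equal and distinct eigenvalues are treated alike.\<close>

locale minimal_vvmf =
  fixes \<rho> :: "sl2 \<Rightarrow> complex^2^2" and \<upsilon> :: "sl2 \<Rightarrow> complex" and k0 s r1 r2 :: real
    and F0 :: "complex \<Rightarrow> complex^2" and v1 v2 :: "complex^2" and M4 :: "complex \<Rightarrow> complex"
  assumes \<upsilon>_nonzero: "\<And>\<gamma>. \<gamma> \<in> SL2Z \<Longrightarrow> \<upsilon> \<gamma> \<noteq> 0"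
    and \<upsilon>_T: "\<upsilon> Tmat = ee s"
    and eigenbasis: "cr v1 v2 \<noteq> 0" "\<rho> Tmat *v v1 = ee r1 *s v1" "\<rho> Tmat *v v2 = ee r2 *s v2"
    and F0: "F0 \<in> vvmf k0 \<rho> \<upsilon>"
    and fundamental: "mlde2_fundamental_system k0 M4 (\<lambda>z. F0 z $ 1) (\<lambda>z. F0 z $ 2)"
    and k0: "k0 + 1 = 6 * (frac (r1 + s) + frac (r2 + s))"
begin

definition l1 :: real where "l1 = frac (r1 + s)"
definition l2 :: real where "l2 = frac (r2 + s)"

text \<open>The indices cross over because pairing with \<open>v2\<close> kills the component along
  \<open>v2\<close> and leaves the one along \<open>v1\<close>, whose exponent is
  \<open>l1\<close>.\<close>

definition coordinates :: "(complex \<Rightarrow> complex^2) \<Rightarrow> (complex \<Rightarrow> complex) \<Rightarrow> (complex \<Rightarrow> complex) \<Rightarrow> bool" where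
  "coordinates F a b \<longleftrightarrow> qexp l1 a (\<lambda>z. cr (F z) v2) \<and> qexp l2 b (\<lambda>z. cr (F z) v1)"

lemma l_nonneg: "0 \<le> l1" "0 \<le> l2"
  by (simp_all add: l1_def l2_def)

lemma vvmf_coordinates:
  assumes F: "F \<in> vvmf k \<rho> \<upsilon>"
  obtains a b where "coordinates F a b"
proof -
  have "det (\<rho> Tmat) * cr v1 v2 = ee r1 * ee r2 * cr v1 v2"
    by (simp add: cr_mult [symmetric] eigenbasis cr_smult_left cr_smult_right)
  then have det: "det (\<rho> Tmat) = ee r1 * ee r2" using eigenbasis(1) by simp
  have nz: "ee x \<noteq> 0" for x by (simp add: ee_def)
  have "\<exists>a. qexp l1 a (\<lambda>z. cr (F z) v2)" unfolding l1_def
    by (rule vvmf_coordinate_qexp[OF F \<upsilon>_T eigenbasis(3)]) (simp_all add: det nz)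
  moreover have "\<exists>b. qexp l2 b (\<lambda>z. cr (F z) v1)" unfolding l2_def
    by (rule vvmf_coordinate_qexp[OF F \<upsilon>_T eigenbasis(2)]) (simp_all add: det nz)
  ultimately show ?thesis using that unfolding coordinates_def by blast
qed

lemma coordinates_Dvec:
  assumes F: "coordinates F a b" "\<And>i. (\<lambda>z. F z $ i) holomorphic_on UHP"
  shows "coordinates (Dvec k F)
    (\<lambda>q. of_real l1 * a q + q * deriv a q + of_real k * (Pser q * a q))
    (\<lambda>q. of_real l2 * b q + q * deriv b q + of_real k * (Pser q * b q))"
  using F(1) unfolding coordinates_def cr_Dvec[OF F(2)] by (auto intro: Dop_qexp)

text \<open>Each product in the Pluecker relation has one factor of either exponent. Hence every
  determinant of two forms carries the same power of \<open>q\<close> as the Wronskian.\<close>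

lemma coordinates_cr:
  assumes X: "coordinates X a b" and Y: "coordinates Y c d"
  shows "qexp (l1 + l2) (\<lambda>q. (b q * c q - a q * d q) / cr v1 v2) (\<lambda>z. cr (X z) (Y z))"
proof -
  have "qexp (l1 + l2) (\<lambda>q. b q * c q) (\<lambda>z. cr (X z) v1 * cr (Y z) v2)"
    using qexp_mult[of l2 b _ l1 c] X Y unfolding coordinates_def by (simp add: add.commute)
  moreover have "qexp (l1 + l2) (\<lambda>q. a q * d q) (\<lambda>z. cr (X z) v2 * cr (Y z) v1)"
    using qexp_mult[of l1 a _ l2 d] X Y unfolding coordinates_def by simp
  ultimately have "qexp (l1 + l2) (\<lambda>q. b q * c q + (-1) * (a q * d q))
      (\<lambda>z. cr (X z) v1 * cr (Y z) v2 + (-1) * (cr (X z) v2 * cr (Y z) v1))"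
    by (intro qexp_add qexp_cmult)
  then have "qexp (l1 + l2) (\<lambda>q. inverse (cr v1 v2) * (b q * c q + (-1) * (a q * d q)))
      (\<lambda>z. inverse (cr v1 v2) * (cr (X z) v1 * cr (Y z) v2 + (-1) * (cr (X z) v2 * cr (Y z) v1)))"
    by (rule qexp_cmult)
  moreover have "inverse (cr v1 v2) * (cr (X z) v1 * cr (Y z) v2 + (-1) * (cr (X z) v2 * cr (Y z) v1))
      = cr (X z) (Y z)" for z
    using cr_Pluecker[of "X z" "Y z" v1 v2] eigenbasis(1) by (simp add: field_simps)
  ultimately show ?thesis by (simp add: divide_inverse mult.commute)
qed

lemma coordinates_bounded:
  assumes "coordinates F a b"
  shows "bounded_at_cusp (\<lambda>z. F z $ i)"
proof -
  have "F z $ i = (v1 $ i / cr v1 v2) * cr (F z) v2 + (- (v2 $ i) / cr v1 v2) * cr (F z) v1" for z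
    using cr_component[of "F z" i v1 v2] eigenbasis(1) by (simp add: field_simps)
  moreover have "bounded_at_cusp (\<lambda>z. (v1 $ i / cr v1 v2) * cr (F z) v2 + (- (v2 $ i) / cr v1 v2) * cr (F z) v1)"
    using assms l_nonneg unfolding coordinates_def
    by (intro bounded_at_cusp_add bounded_at_cusp_cmult) (auto intro: qexp_bounded)
  ultimately show ?thesis by simp
qed

section \<open>The Wronskian of the minimal form and its transformation law\<close>

abbreviation D0 :: "complex \<Rightarrow> complex^2" where "D0 \<equiv> Dvec k0 F0"

definition W :: "complex \<Rightarrow> complex" where "W z = cr (F0 z) (D0 z)"

lemma F0_holomorphic: "(\<lambda>z. F0 z $ i) holomorphic_on UHP"
  by (rule vvmf_holomorphic[OF F0])

lemma W_Dop: "W z = F0 z $ 1 * Dop k0 (\<lambda>z. F0 z $ 2) z - F0 z $ 2 * Dop k0 (\<lambda>z. F0 z $ 1) z"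
  by (simp add: W_def cr_def Dvec_def)

text \<open>The contributions of \<open>P\<close> cancel, which leaves the ordinary
  Wronskian.\<close>

lemma W_deriv:
  "Im z > 0 \<Longrightarrow> W z = (F0 z $ 1 * deriv (\<lambda>z. F0 z $ 2) z - F0 z $ 2 * deriv (\<lambda>z. F0 z $ 1) z) / tpi"
  unfolding W_Dop by (simp add: Dop_def algebra_simps diff_divide_distrib)

lemma W_eta_pow: obtains C where "C \<noteq> 0" "\<And>z. Im z > 0 \<Longrightarrow> W z = C * eta_pow (l1 + l2) z"
proof -
  have sol: "mlde2_solution k0 M4 (\<lambda>z. F0 z $ 1)" "mlde2_solution k0 M4 (\<lambda>z. F0 z $ 2)"
    using fundamental by (simp_all add: mlde2_fundamental_system_def)
  obtain C where C: "\<And>z. Im z > 0 \<Longrightarrow> W z = C * eta_pow (l1 + l2) z"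
    using mlde2_wronskian[OF sol, of "l1 + l2"] k0 unfolding W_Dop l1_def l2_def by blast
  moreover have "C \<noteq> 0"
    using mlde2_wronskian_nonzero[OF fundamental] C unfolding W_Dop [symmetric] by auto
  ultimately show ?thesis by (rule that[rotated])
qed

lemma W_nonzero: "Im z > 0 \<Longrightarrow> W z \<noteq> 0"
  using W_eta_pow eta_pow_nonzero by (metis mult_eq_0_iff)

text \<open>The series has no zero even at \<open>q = 0\<close>, so the order of \<open>W\<close> at
  the cusp is exactly \<open>l1 + l2\<close> and division by \<open>W\<close> creates no
  pole.\<close>

lemma W_qexp: obtains \<omega> where "qexp (l1 + l2) \<omega> W" "\<And>q. \<omega> q \<noteq> 0"
proof -
  obtain C where C: "C \<noteq> 0" "\<And>z. Im z > 0 \<Longrightarrow> W z = C * eta_pow (l1 + l2) z"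
    using W_eta_pow by blast
  have "qexp (l1 + l2) (\<lambda>q. C * exp (24 * of_real (l1 + l2) * log_euler q)) W"
    by (rule qexp_cong[OF qexp_cmult[OF eta_pow_qexp]]) (simp add: C(2))
  then show ?thesis using that C(1) by auto
qed

text \<open>If \<open>l1 = l2\<close>, the leading coefficient of the Wronskian would vanish.\<close>

lemma l_pos: "l1 + l2 > 0"
proof -
  obtain a b where ab: "coordinates F0 a b" using vvmf_coordinates[OF F0] .
  obtain \<omega> where \<omega>: "qexp (l1 + l2) \<omega> W" "\<omega> 0 \<noteq> 0" using W_qexp by metis
  define u where "u = (\<lambda>q. (b q * (of_real l1 * a q + q * deriv a q + of_real k0 * (Pser q * a q))
      - a q * (of_real l2 * b q + q * deriv b q + of_real k0 * (Pser q * b q))) / cr v1 v2)"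
  have "qexp (l1 + l2) u W"
    using coordinates_cr[OF ab coordinates_Dvec[OF ab F0_holomorphic, of k0]]
    unfolding u_def W_def .
  then have "u 0 \<noteq> 0" using qexp_unique[OF _ \<omega>(1), of u 0] \<omega>(2) by simp
  \<comment> \<open>At \<open>q = 0\<close> the terms with derivatives drop out and those with
    \<open>Pser\<close> cancel.\<close>
  moreover have "u 0 = of_real (l1 - l2) * (a 0 * b 0) / cr v1 v2"
    by (simp add: u_def algebra_simps)
  ultimately have "l1 \<noteq> l2" by auto
  then show ?thesis using l_nonneg by linarith
qed

lemma F0_mob:
  assumes "\<gamma> \<in> SL2Z" "Im z > 0"
  shows "F0 (mob \<gamma> z) = (\<upsilon> \<gamma> * jfac \<gamma> z powr of_real k0) *s (\<rho> \<gamma> *v F0 z)"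
  using vvmf_mob[OF F0 assms(1) \<upsilon>_nonzero[OF assms(1)] assms(2)] .

lemma W_mob:
  assumes \<gamma>: "\<gamma> \<in> SL2Z" and z: "Im z > 0"
  shows "W (mob \<gamma> z) = (\<upsilon> \<gamma>)\<^sup>2 * det (\<rho> \<gamma>) * ((jfac \<gamma> z)\<^sup>2 * (jfac \<gamma> z powr of_real k0)\<^sup>2 * W z)"
proof -
  define \<phi> where "\<phi> = (\<lambda>z. jfac \<gamma> z powr of_real k0)"
  \<comment> \<open>Multiplier and representation go into the constant matrix \<open>R\<close>, so
    that \<open>\<phi>\<close> is the automorphy factor alone.\<close>
  define R where "R = (\<lambda>i j. \<upsilon> \<gamma> * \<rho> \<gamma> $ i $ j)"
  define g where "g = (\<lambda>i z. R i 1 * F0 z $ 1 + R i 2 * F0 z $ 2)"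
  have ghol: "g i holomorphic_on UHP" for i
    unfolding g_def by (intro holomorphic_intros F0_holomorphic)
  have gd: "deriv (g i) z = R i 1 * deriv (\<lambda>z. F0 z $ 1) z + R i 2 * deriv (\<lambda>z. F0 z $ 2) z" for i
  proof -
    have "(g i has_field_derivative R i 1 * deriv (\<lambda>z. F0 z $ 1) z + R i 2 * deriv (\<lambda>z. F0 z $ 2) z) (at z)"
      unfolding g_def using holomorphic_derivI[OF F0_holomorphic open_UHP] z
      by (auto intro!: derivative_eq_intros)
    then show ?thesis by (rule DERIV_imp_deriv)
  qed
  have d\<phi>: "(\<phi> has_field_derivative of_real k0 * of_int (lower_left \<gamma>) / jfac \<gamma> z * \<phi> z) (at z)"
    unfolding \<phi>_def by (rule jfac_powr_has_derivative[OF \<gamma> z])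
  have fg: "F0 (mob \<gamma> w) $ i = \<phi> w * g i w" if "Im w > 0" for w i
    by (simp add: F0_mob[OF \<gamma> that] \<phi>_def g_def R_def matrix_vector_2 algebra_simps)
  have "F0 (mob \<gamma> z) $ 1 * deriv (\<lambda>z. F0 z $ 2) (mob \<gamma> z) - F0 (mob \<gamma> z) $ 2 * deriv (\<lambda>z. F0 z $ 1) (mob \<gamma> z)
    = (jfac \<gamma> z)\<^sup>2 * (\<phi> z)\<^sup>2 * (g 1 z * deriv (g 2) z - g 2 z * deriv (g 1) z)"
    by (rule wronskian_mob[OF \<gamma> z F0_holomorphic[of 1] F0_holomorphic[of 2] ghol[of 1] ghol[of 2] d\<phi>])
      (rule fg, assumption)+
  also have "g 1 z * deriv (g 2) z - g 2 z * deriv (g 1) z = (\<upsilon> \<gamma>)\<^sup>2 * det (\<rho> \<gamma>) *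
      (F0 z $ 1 * deriv (\<lambda>z. F0 z $ 2) z - F0 z $ 2 * deriv (\<lambda>z. F0 z $ 1) z)"
    unfolding gd by (simp add: g_def R_def det_2 algebra_simps power2_eq_square)
  finally show ?thesis
    unfolding W_deriv[OF z] W_deriv[OF mob_UHP[OF \<gamma> z]] by (simp add: \<phi>_def)
qed

text \<open>Comparing the logarithmic derivatives of the two sides of the transformation law of \<open>W\<close> gives the
  transformation law of \<open>P\<close>, because the weight \<open>2 k\<^sub>0 + 2\<close> of the Wronskian is nonzero.\<close>

sublocale quasimodular_Pfun
proof
  fix \<gamma> z assume \<gamma>: "\<gamma> \<in> SL2Z" and z: "Im z > 0"
  obtain C where C: "C \<noteq> 0" "\<And>z. Im z > 0 \<Longrightarrow> W z = C * eta_pow (l1 + l2) z"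
    using W_eta_pow by blast
  define \<delta> where "\<delta> = (\<upsilon> \<gamma>)\<^sup>2 * det (\<rho> \<gamma>)"
  define E where "E = eta_pow (l1 + l2)"
  define \<phi> where "\<phi> = (\<lambda>z. jfac \<gamma> z powr of_real k0)"
  define J c where "J = jfac \<gamma> z" and "c = (of_int (lower_left \<gamma>) :: complex)"
  \<comment> \<open>The weight of \<open>W\<close>. It arises as \<open>12 * (l1 + l2)\<close> from
    the differential equation and as \<open>2 + 2 * k0\<close> from the automorphy factor.\<close>
  define t where "t = 12 * complex_of_real (l1 + l2)"
  have J: "J \<noteq> 0" unfolding J_def by (rule jfac_nonzero[OF \<gamma> z])
  have t0: "t \<noteq> 0" unfolding t_def using l_pos by (simp del: of_real_add)
  have t: "t = 2 + 2 * of_real k0"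
  proof -
    have "12 * (l1 + l2) = 2 + 2 * k0" using k0 by (simp add: l1_def l2_def)
    then have "complex_of_real (12 * (l1 + l2)) = complex_of_real (2 + 2 * k0)" by (rule arg_cong)
    then show ?thesis by (simp add: t_def)
  qed
  have E: "E (mob \<gamma> w) = \<delta> * ((jfac \<gamma> w)\<^sup>2 * (\<phi> w)\<^sup>2 * E w)" if "Im w > 0" for w
    using W_mob[OF \<gamma> that] C(1) unfolding C(2)[OF that] C(2)[OF mob_UHP[OF \<gamma> that]]
    by (simp add: E_def \<delta>_def \<phi>_def mult_ac)
  have dE: "(E has_field_derivative - t * tpi * Pfun w * E w) (at w)" if "Im w > 0" for w
    unfolding E_def t_def using eta_pow_has_derivative[OF that, of "l1 + l2"] by simp
  have "((\<lambda>w. E (mob \<gamma> w)) has_field_derivative - t * tpi * Pfun (mob \<gamma> z) * E (mob \<gamma> z) * (1 / J\<^sup>2)) (at z)"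
    unfolding J_def
    by (rule DERIV_chain2[where g = "mob \<gamma>", OF dE[OF mob_UHP[OF \<gamma> z]] mob_has_derivative[OF \<gamma> z]])
  moreover have "((\<lambda>w. E (mob \<gamma> w)) has_field_derivative E (mob \<gamma> z) * (t * c / J - t * tpi * Pfun z)) (at z)"
  proof (rule has_field_derivative_transform_within_open[OF _ open_UHP])
    have d\<phi>: "(\<phi> has_field_derivative of_real k0 * c / J * \<phi> z) (at z)"
      unfolding \<phi>_def J_def c_def by (rule jfac_powr_has_derivative[OF \<gamma> z])
    have dJ: "(jfac \<gamma> has_field_derivative c) (at z)"
      unfolding c_def by (rule jfac_has_derivative)
    have deriv: "((\<lambda>w. \<delta> * ((jfac \<gamma> w)\<^sup>2 * (\<phi> w)\<^sup>2 * E w)) has_field_derivative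
        \<delta> * ((2 * J * c * (\<phi> z)\<^sup>2 + J\<^sup>2 * (2 * \<phi> z * (of_real k0 * c / J * \<phi> z))) * E z
          + J\<^sup>2 * (\<phi> z)\<^sup>2 * (- t * tpi * Pfun z * E z))) (at z)"
      unfolding J_def by (rule derivative_eq_intros d\<phi>[unfolded J_def] dJ dE[OF z] refl)+
        (simp add: algebra_simps)
    have deriv_eq: "\<delta> * ((2 * J * c * (\<phi> z)\<^sup>2 + J\<^sup>2 * (2 * \<phi> z * (of_real k0 * c / J * \<phi> z))) * E z
          + J\<^sup>2 * (\<phi> z)\<^sup>2 * (- t * tpi * Pfun z * E z))
        = \<delta> * (J\<^sup>2 * (\<phi> z)\<^sup>2 * E z) * (t * c / J - t * tpi * Pfun z)"
    proof -
      have "2 * J * c * (\<phi> z)\<^sup>2 = J\<^sup>2 * (\<phi> z)\<^sup>2 * (2 * c / J)"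
        using J by (simp add: power2_eq_square)
      moreover have "J\<^sup>2 * (2 * \<phi> z * (of_real k0 * c / J * \<phi> z)) = J\<^sup>2 * (\<phi> z)\<^sup>2 * (2 * of_real k0 * c / J)"
        by (simp add: power2_eq_square)
      moreover have "t * c / J = 2 * c / J + 2 * of_real k0 * c / J"
        by (simp add: t ring_distribs add_divide_distrib)
      ultimately show ?thesis by (simp only:) (simp add: algebra_simps)
    qed
    show "((\<lambda>w. \<delta> * ((jfac \<gamma> w)\<^sup>2 * (\<phi> w)\<^sup>2 * E w)) has_field_derivative
        E (mob \<gamma> z) * (t * c / J - t * tpi * Pfun z)) (at z)"
      using deriv unfolding deriv_eq unfolding E[OF z] J_def .
  qed (use z E in auto)
  ultimately have "- t * tpi * Pfun (mob \<gamma> z) * E (mob \<gamma> z) * (1 / J\<^sup>2) = E (mob \<gamma> z) * (t * c / J - t * tpi * Pfun z)"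
    by (rule DERIV_unique)
  \<comment> \<open>The constant \<open>\<delta>\<close> is hidden in
    \<open>E (mob \<gamma> z)\<close>, which is nonzero; as \<open>t\<close> is nonzero too, both
    factors cancel.\<close>
  then have "E (mob \<gamma> z) * (t * (tpi * Pfun (mob \<gamma> z) * (1 / J\<^sup>2))) = E (mob \<gamma> z) * (t * (tpi * Pfun z - c / J))"
    by (simp add: algebra_simps)
  then have eq: "tpi * Pfun (mob \<gamma> z) * (1 / J\<^sup>2) = tpi * Pfun z - c / J"
    by (simp only: mult_cancel_left E_def eta_pow_nonzero t0 simp_thms)
  have "Pfun (mob \<gamma> z) = J\<^sup>2 * (tpi * Pfun (mob \<gamma> z) * (1 / J\<^sup>2)) / tpi" using J by simp
  also have "\<dots> = J\<^sup>2 * Pfun z - c * J / tpi"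
    unfolding eq using J by (simp add: right_diff_distrib diff_divide_distrib power2_eq_square mult_ac)
  finally show "Pfun (mob \<gamma> z) = (jfac \<gamma> z)\<^sup>2 * Pfun z - of_int (lower_left \<gamma>) * jfac \<gamma> z / tpi"
    by (simp add: J_def c_def)
qed

text \<open>Weight \<open>k0 + i\<close>, with the integral part of the weight split off so that
  weights add without regard to branches. Both \<open>F0\<close> and its derivative fit this form,
  and the expansion replaces moderate growth as the condition at the cusp.\<close>

definition homogeneous :: "int \<Rightarrow> (complex \<Rightarrow> complex^2) \<Rightarrow> bool" where
  "homogeneous i X \<longleftrightarrow> (\<forall>j. (\<lambda>z. X z $ j) holomorphic_on UHP) \<and> (\<exists>a b. coordinates X a b) \<and>
     (\<forall>\<gamma> z. \<gamma> \<in> SL2Z \<longrightarrow> Im z > 0 \<longrightarrow>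
        X (mob \<gamma> z) = (\<upsilon> \<gamma> * jfac \<gamma> z powr of_real k0 * jfac \<gamma> z powi i) *s (\<rho> \<gamma> *v X z))"

lemma homogeneousD:
  assumes "homogeneous i X"
  shows "(\<lambda>z. X z $ j) holomorphic_on UHP" "\<exists>a b. coordinates X a b"
    and "\<gamma> \<in> SL2Z \<Longrightarrow> Im z > 0 \<Longrightarrow>
      X (mob \<gamma> z) = (\<upsilon> \<gamma> * jfac \<gamma> z powr of_real k0 * jfac \<gamma> z powi i) *s (\<rho> \<gamma> *v X z)"
  using assms unfolding homogeneous_def by blast+

lemma homogeneous_vvmf:
  assumes G: "G \<in> vvmf (k0 + of_int n) \<rho> \<upsilon>"
  shows "homogeneous n G"
proof -
  have "G (mob \<gamma> z) = (\<upsilon> \<gamma> * jfac \<gamma> z powr of_real k0 * jfac \<gamma> z powi n) *s (\<rho> \<gamma> *v G z)"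
    if "\<gamma> \<in> SL2Z" "Im z > 0" for \<gamma> z
    using vvmf_mob[OF G that(1) \<upsilon>_nonzero[OF that(1)] that(2)]
    unfolding powr_add_int[OF jfac_nonzero[OF that]] by (simp only: mult.assoc)
  moreover obtain a b where "coordinates G a b" using vvmf_coordinates[OF G] .
  ultimately show ?thesis
    unfolding homogeneous_def using vvmf_holomorphic[OF G] by blast
qed

lemma homogeneous_F0: "homogeneous 0 F0"
  using homogeneous_vvmf[of F0 0] F0 by simp

text \<open>D is linear and so commutes with the constant matrix built from multiplier and
  representation; each component then follows from the law of D.\<close>

lemma homogeneous_D0: "homogeneous 2 D0"
proof -
  have "D0 (mob \<gamma> z) = (\<upsilon> \<gamma> * jfac \<gamma> z powr of_real k0 * jfac \<gamma> z powi 2) *s (\<rho> \<gamma> *v D0 z)"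
    if \<gamma>: "\<gamma> \<in> SL2Z" and z: "Im z > 0" for \<gamma> z
  proof -
    define \<phi> where "\<phi> = (\<lambda>z. jfac \<gamma> z powr of_real k0)"
    define R where "R = (\<lambda>i j. \<upsilon> \<gamma> * \<rho> \<gamma> $ i $ j)"
    define g where "g = (\<lambda>i z. R i 1 * F0 z $ 1 + R i 2 * F0 z $ 2)"
    have ghol: "g i holomorphic_on UHP" for i
      unfolding g_def by (intro holomorphic_intros F0_holomorphic)
    have d\<phi>: "(\<phi> has_field_derivative of_real k0 * of_int (lower_left \<gamma>) / jfac \<gamma> w * \<phi> w) (at w)"
      if "Im w > 0" for w
      unfolding \<phi>_def by (rule jfac_powr_has_derivative[OF \<gamma> that])
    have fg: "F0 (mob \<gamma> w) $ i = \<phi> w * g i w" if "Im w > 0" for w i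
      by (simp add: F0_mob[OF \<gamma> that] \<phi>_def g_def R_def matrix_vector_2 algebra_simps)
    have "Dop k0 (\<lambda>z. F0 z $ i) (mob \<gamma> z) = (jfac \<gamma> z)\<^sup>2 * \<phi> z * Dop k0 (g i) z" for i
      by (rule Dop_mob[OF \<gamma> F0_holomorphic ghol d\<phi> fg z])
    moreover have "Dop k0 (g i) z = R i 1 * Dop k0 (\<lambda>z. F0 z $ 1) z + R i 2 * Dop k0 (\<lambda>z. F0 z $ 2) z" for i
      unfolding g_def by (rule Dop_linear[OF F0_holomorphic F0_holomorphic])
    ultimately show ?thesis
      by (simp add: vec_eq_iff Dvec_def matrix_vector_2 R_def \<phi>_def algebra_simps)
  qed
  moreover obtain a b where "coordinates F0 a b" using vvmf_coordinates[OF F0] .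
  then have "\<exists>a b. coordinates D0 a b" using coordinates_Dvec[OF _ F0_holomorphic] by blast
  moreover have "(\<lambda>z. D0 z $ j) holomorphic_on UHP" for j
    by (simp add: Dvec_def Dop_holomorphic F0_holomorphic)
  ultimately show ?thesis unfolding homogeneous_def by blast
qed

text \<open>Multiplier, determinant and the real power of the automorphy factor agree in numerator
  and denominator, as do the powers of \<open>q\<close>. Only the integral weight
  \<open>i + j\<close>, less the 2 of the derivative in \<open>W\<close>, remains.\<close>

lemma cr_over_W_modforms:
  assumes X: "homogeneous i X" and Y: "homogeneous j Y"
  shows "(\<lambda>z. if Im z > 0 then cr (X z) (Y z) / W z else 0) \<in> modforms (i + j - 2)"
proof -
  obtain a b c d where co: "coordinates X a b" "coordinates Y c d"
    using homogeneousD(2)[OF X] homogeneousD(2)[OF Y] by blast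
  obtain \<omega> where \<omega>: "qexp (l1 + l2) \<omega> W" "\<And>q. \<omega> q \<noteq> 0" using W_qexp by metis
  have "qexp (l1 + l2 - (l1 + l2)) (\<lambda>q. (b q * c q - a q * d q) / cr v1 v2 / \<omega> q) (\<lambda>z. cr (X z) (Y z) / W z)"
    by (rule qexp_divide[OF coordinates_cr[OF co] \<omega>(1)]) (rule \<omega>(2))
  then have "qexp 0 (\<lambda>q. (b q * c q - a q * d q) / cr v1 v2 / \<omega> q) (\<lambda>z. cr (X z) (Y z) / W z)"
    by simp
  then have q: "qexp 0 (\<lambda>q. (b q * c q - a q * d q) / cr v1 v2 / \<omega> q)
      (\<lambda>z. if Im z > 0 then cr (X z) (Y z) / W z else 0)"
    by (rule qexp_cong) simp
  have "cr (X (mob \<gamma> z)) (Y (mob \<gamma> z)) / W (mob \<gamma> z) = jfac \<gamma> z powi (i + j - 2) * (cr (X z) (Y z) / W z)"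
    if \<gamma>: "\<gamma> \<in> SL2Z" and z: "Im z > 0" for \<gamma> z
  proof -
    define J where "J = jfac \<gamma> z"
    define K where "K = (\<upsilon> \<gamma> * J powr of_real k0)\<^sup>2 * det (\<rho> \<gamma>)"
    have J: "J \<noteq> 0" unfolding J_def by (rule jfac_nonzero[OF \<gamma> z])
    have W: "W (mob \<gamma> z) = K * (J\<^sup>2 * W z)"
      by (simp add: W_mob[OF \<gamma> z] K_def J_def power_mult_distrib mult_ac)
    then have "K \<noteq> 0" using W_nonzero[OF mob_UHP[OF \<gamma> z]] by auto
    moreover have "cr (X (mob \<gamma> z)) (Y (mob \<gamma> z)) = K * (J powi (i + j) * cr (X z) (Y z))"
      using J by (simp add: homogeneousD(3)[OF X \<gamma> z] homogeneousD(3)[OF Y \<gamma> z] cr_smult_left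
          cr_smult_right cr_mult K_def J_def [symmetric] power_int_add power2_eq_square mult_ac)
    moreover have "J powi (i + j - 2) = J powi (i + j) / J\<^sup>2"
      using J by (simp add: power_int_diff)
    ultimately show ?thesis by (simp add: W J_def [symmetric])
  qed
  then show ?thesis by (intro modformsI[OF _ q]) (simp_all add: mob_UHP)
qed

lemma modforms_smult_vvmf:
  assumes M: "M \<in> modforms j" and X: "homogeneous i X"
    and k: "k = k0 + of_int (i + j)"
  shows "(\<lambda>z. M z *s X z) \<in> vvmf k \<rho> \<upsilon>"
proof (rule vvmfI[OF _ _ _ \<upsilon>_nonzero])
  obtain u where u: "qexp 0 u M" using M modforms_qexp by metis
  obtain a b where "coordinates X a b" using homogeneousD(2)[OF X] by blast
  then show "bounded_at_cusp (\<lambda>z. (M z *s X z) $ l)" for l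
    unfolding vector_smult_component
    by (intro bounded_at_cusp_mult qexp_bounded[OF u] coordinates_bounded) simp_all
  show "(\<lambda>z. (M z *s X z) $ l) holomorphic_on UHP" for l
    unfolding vector_smult_component
    by (intro holomorphic_intros qexp_holomorphic[OF u] homogeneousD(1)[OF X])
  show "M (mob \<gamma> z) *s X (mob \<gamma> z) = (\<upsilon> \<gamma> * jfac \<gamma> z powr of_real k) *s (\<rho> \<gamma> *v (M z *s X z))"
    if \<gamma>: "\<gamma> \<in> SL2Z" and z: "Im z > 0" for \<gamma> z
    unfolding k powr_add_int[OF jfac_nonzero[OF that]] modforms_mob[OF M that] homogeneousD(3)[OF X that]
    using jfac_nonzero[OF that]
    by (simp add: vec_eq_iff matrix_vector_2 power_int_add algebra_simps)
qed (use modforms_outside[OF M] in auto)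

text \<open>Pairing with \<open>D0\<close> and with \<open>F0\<close> isolates one coefficient each,
  multiplied by the nonzero \<open>W z\<close>.\<close>

lemma combination_unique:
  assumes eq: "\<And>z. Im z > 0 \<Longrightarrow> M z *s F0 z + N z *s D0 z = M' z *s F0 z + N' z *s D0 z"
    and z: "Im z > 0"
  shows "M z = M' z \<and> N z = N' z"
proof -
  have "cr (M z *s F0 z + N z *s D0 z) (D0 z) = cr (M' z *s F0 z + N' z *s D0 z) (D0 z)"
    "cr (F0 z) (M z *s F0 z + N z *s D0 z) = cr (F0 z) (M' z *s F0 z + N' z *s D0 z)"
    using eq[OF z] by simp_all
  then show ?thesis
    using W_nonzero[OF z]
    by (simp add: cr_add_left cr_add_right cr_smult_left cr_smult_right W_def)
qed

lemma vvmf_decompose: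
  assumes G: "G \<in> vvmf (k0 + of_int n) \<rho> \<upsilon>"
  obtains M N where "M \<in> modforms n" "N \<in> modforms (n - 2)"
    "G = (\<lambda>z. M z *s F0 z + N z *s D0 z)"
proof -
  define M where "M = (\<lambda>z. if Im z > 0 then cr (G z) (D0 z) / W z else 0)"
  define N where "N = (\<lambda>z. if Im z > 0 then cr (F0 z) (G z) / W z else 0)"
  have "M \<in> modforms n"
    using cr_over_W_modforms[OF homogeneous_vvmf[OF G] homogeneous_D0] by (simp add: M_def)
  moreover have "N \<in> modforms (n - 2)"
    using cr_over_W_modforms[OF homogeneous_F0 homogeneous_vvmf[OF G]] by (simp add: N_def)
  moreover have "G z = M z *s F0 z + N z *s D0 z" for z
  proof (cases "Im z > 0")
    case True
    have "W z * G z $ i = cr (G z) (D0 z) * F0 z $ i + cr (F0 z) (G z) * D0 z $ i" for i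
      using exhaust_2[of i] by (auto simp: W_def cr_def algebra_simps)
    then have "G z $ i = (cr (G z) (D0 z) * F0 z $ i + cr (F0 z) (G z) * D0 z $ i) / W z" for i
      using W_nonzero[OF True] by (metis nonzero_mult_div_cancel_left)
    then have "G z $ i = M z * F0 z $ i + N z * D0 z $ i" for i
      using True by (simp add: M_def N_def add_divide_distrib)
    then show ?thesis by (simp only: vec_eq_iff vector_add_component vector_smult_component) simp
  next
    case False
    then show ?thesis using vvmf_outside[OF G False] by (simp add: M_def N_def)
  qed
  then have "G = (\<lambda>z. M z *s F0 z + N z *s D0 z)" by (rule ext)
  ultimately show ?thesis by (rule that)
qed

section \<open>Dimensions of the spaces of vector-valued forms\<close>

lemma vvmf_cdim:
  assumes p: "modforms_dim (2 * int k) p" and q: "modforms_dim (2 * int k - 2) q"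
  shows "has_cdim (vvmf (k0 + 2 * real k) \<rho> \<upsilon>) (p + q)"
proof -
  obtain A where A: "\<forall>i<p. A i \<in> modforms (2 * int k)"
    and spanA: "\<forall>f\<in>modforms (2 * int k). \<exists>c. \<forall>z. f z = (\<Sum>i<p. c i * A i z)"
    and indepA: "\<forall>c. (\<forall>z. Im z > 0 \<longrightarrow> (\<Sum>i<p. c i * A i z) = 0) \<longrightarrow> (\<forall>i<p. c i = 0)"
    using p unfolding modforms_dim_def by (elim exE conjE)
  obtain B where B: "\<forall>i<q. B i \<in> modforms (2 * int k - 2)"
    and spanB: "\<forall>f\<in>modforms (2 * int k - 2). \<exists>c. \<forall>z. f z = (\<Sum>i<q. c i * B i z)"
    and indepB: "\<forall>c. (\<forall>z. Im z > 0 \<longrightarrow> (\<Sum>i<q. c i * B i z) = 0) \<longrightarrow> (\<forall>i<q. c i = 0)"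
    using q unfolding modforms_dim_def by (elim exE conjE)
  \<comment> \<open>A basis of weight \<open>2 * k\<close> times \<open>F0\<close>, followed by one
    of weight \<open>2 * k - 2\<close> times \<open>D0\<close>, since D raises the weight by
    2.\<close>
  define E where "E = (\<lambda>i. if i < p then (\<lambda>z. A i z *s F0 z) else (\<lambda>z. B (i - p) z *s D0 z))"
  have sum_split: "(\<Sum>i<p + q. f i) = (\<Sum>i<p. f i) + (\<Sum>i<q. f (p + i))" for f :: "nat \<Rightarrow> complex^2"
    by (induction q) simp_all
  have sum_E: "(\<Sum>i<p + q. c i *s E i z) = (\<Sum>i<p. c i * A i z) *s F0 z + (\<Sum>i<q. c (p + i) * B i z) *s D0 z"
    for c z
    by (simp add: sum_split E_def vec.scale_sum_left)
  have mem: "E i \<in> vvmf (k0 + 2 * real k) \<rho> \<upsilon>" if "i < p + q" for i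
  proof (cases "i < p")
    case True
    then show ?thesis
      using modforms_smult_vvmf[OF A[rule_format] homogeneous_F0] by (simp add: E_def)
  next
    case False
    then show ?thesis
      using that modforms_smult_vvmf[OF B[rule_format, of "i - p"] homogeneous_D0] by (simp add: E_def)
  qed
  have "\<exists>!c. (\<forall>i\<ge>p + q. c i = 0) \<and> G = (\<lambda>z. \<Sum>i<p + q. c i *s E i z)"
    if G: "G \<in> vvmf (k0 + 2 * real k) \<rho> \<upsilon>" for G
  proof (rule ex_ex1I)
    obtain M N where MN: "M \<in> modforms (2 * int k)" "N \<in> modforms (2 * int k - 2)"
      "G = (\<lambda>z. M z *s F0 z + N z *s D0 z)"
      using vvmf_decompose[of G "2 * int k"] G by auto
    obtain c where c: "\<forall>z. M z = (\<Sum>i<p. c i * A i z)" using bspec[OF spanA MN(1)] by (elim exE)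
    obtain d where d: "\<forall>z. N z = (\<Sum>i<q. d i * B i z)" using bspec[OF spanB MN(2)] by (elim exE)
    \<comment> \<open>The value 0 from index \<open>p + q\<close> on is required by
      \<open>has_cdim\<close> and makes the coefficient function unique.\<close>
    define h where "h = (\<lambda>i. if i < p then c i else if i < p + q then d (i - p) else 0)"
    have "(\<Sum>i<p. h i * A i z) = M z" "(\<Sum>i<q. h (p + i) * B i z) = N z" for z
      using c d by (simp_all add: h_def)
    then have "G = (\<lambda>z. \<Sum>i<p + q. h i *s E i z)" unfolding sum_E by (simp add: MN(3))
    moreover have "\<forall>i\<ge>p + q. h i = 0" by (simp add: h_def)
    ultimately show "\<exists>c. (\<forall>i\<ge>p + q. c i = 0) \<and> G = (\<lambda>z. \<Sum>i<p + q. c i *s E i z)" by blast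
  next
    fix c d
    assume c: "(\<forall>i\<ge>p + q. c i = 0) \<and> G = (\<lambda>z. \<Sum>i<p + q. c i *s E i z)"
      and d: "(\<forall>i\<ge>p + q. d i = 0) \<and> G = (\<lambda>z. \<Sum>i<p + q. d i *s E i z)"
    have eq: "(\<Sum>i<p. c i * A i z) *s F0 z + (\<Sum>i<q. c (p + i) * B i z) *s D0 z
        = (\<Sum>i<p. d i * A i z) *s F0 z + (\<Sum>i<q. d (p + i) * B i z) *s D0 z" for z
      using c d unfolding sum_E by metis
    have "(\<Sum>i<p. c i * A i z) = (\<Sum>i<p. d i * A i z) \<and>
        (\<Sum>i<q. c (p + i) * B i z) = (\<Sum>i<q. d (p + i) * B i z)" if "Im z > 0" for z
      by (rule combination_unique[OF _ that]) (rule eq)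
    then have "(\<Sum>i<p. (c i - d i) * A i z) = 0" "(\<Sum>i<q. (c (p + i) - d (p + i)) * B i z) = 0" if "Im z > 0" for z
      using that by (simp_all add: left_diff_distrib sum_subtractf)
    then have "\<forall>i<p. c i - d i = 0" "\<forall>i<q. c (p + i) - d (p + i) = 0"
      using indepA[rule_format, of "\<lambda>i. c i - d i"] indepB[rule_format, of "\<lambda>i. c (p + i) - d (p + i)"]
      by blast+
    then have "c i = d i" if "i < p + q" for i
      using that by (cases "i < p") (auto simp: dest: spec[of _ "i - p"])
    then show "c = d" using c d by (metis ext leI)
  qed
  then show ?thesis unfolding has_cdim_def using mem by (intro exI[of _ E]) blast
qed

text \<open>Adding the dimensions of two neighbouring even weights turns the gap at residue 1 modulo
  6 into steps of length 3. For \<open>k = 0\<close> the second summand has negative weight and is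
  treated apart.\<close>

lemma vvmf_cdim_div_3: "has_cdim (vvmf (k0 + 2 * real k) \<rho> \<upsilon>) (k div 3 + 1)"
proof (cases k)
  case 0
  have "modforms_dim (2 * int 0) 1" using modforms_dim_even[of 0] by simp
  moreover have "modforms_dim (2 * int 0 - 2) 0" by (rule modforms_dim_negative) simp
  ultimately show ?thesis using vvmf_cdim[of 0 1 0] 0 by simp
next
  case (Suc l)
  have "2 * int k - 2 = 2 * int l" using Suc by simp
  then have "has_cdim (vvmf (k0 + 2 * real k) \<rho> \<upsilon>)
      ((if k mod 6 = 1 then k div 6 else k div 6 + 1) + (if l mod 6 = 1 then l div 6 else l div 6 + 1))"
    using vvmf_cdim[OF modforms_dim_even] modforms_dim_even[of l] by simp
  moreover have "(if k mod 6 = 1 then k div 6 else k div 6 + 1) + (if l mod 6 = 1 then l div 6 else l div 6 + 1)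
      = k div 3 + 1"
  proof -
    \<comment> \<open>For \<open>b = 0\<close> the gap occurs in the summand for \<open>k\<close>,
      for \<open>b = 1\<close> in the one for \<open>l\<close>; \<open>b = 5\<close> is the carry to
      the next multiple of 6.\<close>
    define a b where "a = l div 6" and "b = l mod 6"
    have l: "l = 6 * a + b" and b: "b < 6" by (simp_all add: a_def b_def)
    have "k div 3 = 2 * a + (if b = 5 then 2 else if 2 \<le> b then 1 else 0)"
      using b by (intro div_nat_eqI) (auto simp: Suc l)
    moreover have "k div 6 = a + (if b = 5 then 1 else 0)"
      using b by (intro div_nat_eqI) (auto simp: Suc l)
    moreover have "k mod 6 = (if b = 5 then 0 else Suc b)"
      by (simp add: Suc mod_Suc b_def)
    ultimately show ?thesis using b by (auto simp: a_def [symmetric] b_def [symmetric])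
  qed
  ultimately show ?thesis by simp
qed

end

section \<open>The free module theorem\<close>

theorem theorem4p7:
  fixes \<rho> :: "sl2 \<Rightarrow> complex^2^2"
    and \<upsilon> :: "sl2 \<Rightarrow> complex"
    and w m r1 r2 k0 :: real
    and F0 :: "complex \<Rightarrow> complex^2"
  assumes rep: "is_rep \<rho>"
    and Tdet: "T_determined \<rho>"
    and Tunit: "T_unitarizable \<rho>"
    and mult: "multiplier_system w \<upsilon>"
    and cusp: "0 \<le> m" "m < 12" "\<upsilon> Tmat = ee (m / 12)"
    and r: "0 \<le> r1" "r1 < 1" "0 \<le> r2" "r2 < 1"
    and eig: "\<forall>x. det (mat x - \<rho> Tmat) = (x - ee r1) * (x - ee r2)"
    and k0: "k0 = 6 * (frac (r1 + m / 12) + frac (r2 + m / 12)) - 1"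
    and grading: "k0 - w \<in> \<int>"
                 "\<forall>n::int. vvmf (k0 + of_int n) \<rho> \<upsilon> \<noteq> {\<lambda>z. 0} \<longrightarrow> n \<ge> 0 \<and> even n"
    and F0: "F0 \<in> vvmf k0 \<rho> \<upsilon>" "F0 \<noteq> (\<lambda>z. 0)"
    and mlde: "\<exists>M4 \<in> modforms 4. mlde2_fundamental_system k0 M4 (\<lambda>z. F0 z $ 1) (\<lambda>z. F0 z $ 2)"
  shows "(\<forall>n::int. \<forall>G \<in> vvmf (k0 + of_int n) \<rho> \<upsilon>.
            \<exists>!(M, N). M \<in> modforms n \<and> N \<in> modforms (n - 2) \<and>
                      G = (\<lambda>z. M z *s F0 z + N z *s Dvec k0 F0 z))
       \<and> (\<forall>n::int. \<forall>G \<in> vvmf (k0 + of_int n) \<rho> \<upsilon>.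
            \<exists>J::nat. \<exists>M :: nat \<Rightarrow> complex \<Rightarrow> complex.
               (\<forall>j\<le>J. M j \<in> modforms (n - 2 * int j)) \<and>
               G = (\<lambda>z. \<Sum>j\<le>J. M j z *s Dpow k0 j F0 z))
       \<and> (\<forall>k::nat. has_cdim (vvmf (k0 + 2 * real k) \<rho> \<upsilon>) (k div 3 + 1))"
proof -
  obtain M4 where fundamental: "mlde2_fundamental_system k0 M4 (\<lambda>z. F0 z $ 1) (\<lambda>z. F0 z $ 2)"
    using mlde by blast
  obtain P U :: "complex^2^2" where PU: "invertible P" "unitary_mat U" "\<rho> Tmat ** P = P ** U"
    using Tunit unfolding T_unitarizable_def by blast
  have "norm (ee r1) = 1" by (simp add: ee_def)
  then obtain v1 v2 where v: "cr v1 v2 \<noteq> 0" "\<rho> Tmat *v v1 = ee r1 *s v1" "\<rho> Tmat *v v2 = ee r2 *s v2"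
    using eigenbasis_unitarizable[OF PU, of "ee r1" "ee r2"] eig by blast
  have \<upsilon>: "\<forall>\<gamma>\<in>SL2Z. norm (\<upsilon> \<gamma>) = 1"
    using mult unfolding multiplier_system_def by (elim conjE)
  interpret minimal_vvmf \<rho> \<upsilon> k0 "m / 12" r1 r2 F0 v1 v2 M4
  proof
    show "\<upsilon> \<gamma> \<noteq> 0" if "\<gamma> \<in> SL2Z" for \<gamma>
      using bspec[OF \<upsilon> that] by auto
    show "k0 + 1 = 6 * (frac (r1 + m / 12) + frac (r2 + m / 12))" using k0 by simp
  qed (fact cusp v F0 fundamental)+
  have free: "\<exists>!(M, N). M \<in> modforms n \<and> N \<in> modforms (n - 2) \<and>
      G = (\<lambda>z. M z *s F0 z + N z *s D0 z)"
    if G: "G \<in> vvmf (k0 + of_int n) \<rho> \<upsilon>" for n :: int and G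
  proof -
    obtain M N where MN: "M \<in> modforms n" "N \<in> modforms (n - 2)" "G = (\<lambda>z. M z *s F0 z + N z *s D0 z)"
      using vvmf_decompose[OF G] .
    have "M' = M \<and> N' = N" if M'N': "M' \<in> modforms n" "N' \<in> modforms (n - 2)"
      "G = (\<lambda>z. M' z *s F0 z + N' z *s D0 z)" for M' N'
    proof -
      have eq: "M' z *s F0 z + N' z *s D0 z = M z *s F0 z + N z *s D0 z" for z
        using MN(3) M'N'(3) by metis
      have "M' z = M z \<and> N' z = N z" if "Im z > 0" for z
        by (rule combination_unique[OF _ that]) (rule eq)
      then show ?thesis using modforms_eqI[OF M'N'(1) MN(1)] modforms_eqI[OF M'N'(2) MN(2)] by blast
    qed
    then show ?thesis
      using MN by (intro ex1I[of _ "(M, N)"]) auto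
  qed
  have cyclic: "\<exists>J::nat. \<exists>M :: nat \<Rightarrow> complex \<Rightarrow> complex. (\<forall>j\<le>J. M j \<in> modforms (n - 2 * int j)) \<and>
      G = (\<lambda>z. \<Sum>j\<le>J. M j z *s Dpow k0 j F0 z)"
    if G: "G \<in> vvmf (k0 + of_int n) \<rho> \<upsilon>" for n :: int and G
  proof -
    obtain M N where MN: "M \<in> modforms n" "N \<in> modforms (n - 2)" "G = (\<lambda>z. M z *s F0 z + N z *s D0 z)"
      using vvmf_decompose[OF G] .
    \<comment> \<open>Two terms suffice, so \<open>J = 1\<close>: the first iterate of D on
      \<open>F0\<close> is \<open>D0\<close>.\<close>
    have "(if j = 0 then M else N) \<in> modforms (n - 2 * int j)" if "j \<le> 1" for j
      using MN that by (cases j) auto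
    moreover have "G = (\<lambda>z. \<Sum>j\<le>(1::nat). (if j = 0 then M else N) z *s Dpow k0 j F0 z)"
      by (simp add: MN(3))
    ultimately show ?thesis
      by (intro exI[of _ 1] exI[of _ "\<lambda>j. if j = 0 then M else N"]) blast
  qed
  show ?thesis
    by (intro conjI allI ballI free cyclic vvmf_cdim_div_3)
qed

end
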